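(* Let $\psi\in P$, $1\le s<\infty$ and $\beta\in\mathbb{R}$. Then $$E_n(L^{\psi}_{\beta,\infty})_s\asymp \mathcal{E}_n(L^{\psi}_{\beta,\infty})_s\asymp\psi(n),$$ that is, there exist positive constants $K_1,K_2$, independent of $n$, such that for all $n\in\mathbb{N}$ $$K_1\psi(n)\le E_n(L^{\psi}_{\beta,\infty})_s\le K_2\psi(n)\quad\text{and}\quad K_1\psi(n)\le \mathcal{E}_n(L^{\psi}_{\beta,\infty})_s\le K_2\psi(n).$$
   Context: Spaces. For $1\le p<\infty$, $L_p$ is the space of $2\pi$-periodic functions $f:\mathbb{R}\to\mathbb{C}$ summable to the power $p$ on $[0,2\pi)$, with norm $\|f\|_p=\left(\int_0^{2\pi}|f(t)|^p\,dt\right)^{1/p}$; $L_\infty$ is the space of $2\pi$-periodic measurable essentially bounded functions with $\|f\|_\infty=\operatorname{ess\,sup}_t|f(t)|$. Fourier coefficients are $\hat f(k)=\frac1{2\pi}\int_{-\pi}^{\pi}f(t)e^{-ikt}\,dt$, $k\in\mathbb{Z}$. $\mathbb{N}=\{1,2,\dots\}$. $(\psi,\beta)$-derivative. Let $\psi(k)$, $k\in\mathbb{N}$, be a sequence of positive numbers, $\beta\in\mathbb{R}$, and $f\in L_1$ real-valued. If the series $$\sum_{k\in\mathbb{Z}\setminus\{0\}}\frac{\hat f(k)}{\psi(|k|)}e^{i\left(kx+\frac{\beta\pi}{2}\operatorname{sign}k\right)}$$ is the Fourier series of some function in $L_1$, that function is called the $(\psi,\beta)$-derivative of $f$ and is denoted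 $f^\psi_\beta$. Class $L^\psi_{\beta,\infty}$. It is the set of all real-valued $f\in L_1$ whose $(\psi,\beta)$-derivative exists and satisfies $\|f^\psi_\beta\|_\infty\le 1$. Approximation quantities. For $n\in\mathbb{N}$ put $S_{n-1}(f;x)=\sum_{k=-n+1}^{n-1}\hat f(k)e^{ikx}$ and $$\mathcal{E}_n(L^\psi_{\beta,\infty})_s=\sup_{f\in L^\psi_{\beta,\infty}}\|f-S_{n-1}(f;\cdot)\|_s,\qquad E_n(L^\psi_{\beta,\infty})_s=\sup_{f\in L^\psi_{\beta,\infty}}\ \inf_{t_{n-1}\in\mathcal{T}_{2n-1}}\|f-t_{n-1}\|_s,$$ where $\mathcal{T}_{2n-1}$ is the space of all trigonometric polynomials with real coefficients of degree at most $n-1$. Set $P$. $P$ is the set of positive sequences $\psi(k)$, $k\ge1$, that are almost decreasing (there is a constant $M>0$ with $\psi(k_2)\le M\psi(k_1)$ whenever $k_1\le k_2$) and for which there is a constant $K$, independent of $n$, such that for all $n\in\mathbb{N}$ $$\sup_{m\in\mathbb{N}}\sum_{k=2^m}^{2^{m+1}}|\psi_n(k+1)-\psi_n(k)|\le K\psi(n),$$ where $\psi_n(k)=0$ for $k<n$ and $\psi_n(k)=\psi(k)$ for $k\ge n$. For positive sequences, $A(n)\asymp B(n)$ means that there are positive constants $K_1,K_2$ with $K_1B(n)\le A(n)\le K_2B(n)$ for all $n\in\mathbb{N}$. *)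

theory Defs
  imports "HOL-Probability.Essential_Supremum"
begin

text \<open>Elements of $L_p$ are represented by functions rather than by classes modulo null sets.\<close>

definition L1_per :: "(real \<Rightarrow> complex) set" where
  "L1_per = {f. (\<forall>x. f (x + 2 * pi) = f x) \<and> set_integrable lebesgue {0..<2 * pi} f}"

text \<open>The norms are extended-valued, so that they can be applied to a function before it is known
  to lie in the corresponding space, and so that suprema of norms always exist.\<close>

definition Lp_norm :: "real \<Rightarrow> (real \<Rightarrow> complex) \<Rightarrow> ennreal" where
  "Lp_norm p f =
     (let I = (\<integral>\<^sup>+ t\<in>{0..<2 * pi}. ennreal (norm (f t) powr p) \<partial>lebesgue)
      in if I = \<infinity> then \<infinity> else ennreal (enn2real I powr (1 / p)))"

definition Linf_norm :: "(real \<Rightarrow> complex) \<Rightarrow> ennreal" where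
  "Linf_norm f = esssup lebesgue (\<lambda>t. ennreal (norm (f t)))"

definition fourier_coeff :: "(real \<Rightarrow> complex) \<Rightarrow> int \<Rightarrow> complex" where
  "fourier_coeff f k =
     1 / (2 * pi) * (LINT t:{-pi..pi}|lebesgue. f t * exp (- \<i> * of_int k * of_real t))"

text \<open>\<open>fourier_sum m f\<close> is the partial sum over all frequencies of modulus at most \<open>m\<close>.\<close>

definition fourier_sum :: "nat \<Rightarrow> (real \<Rightarrow> complex) \<Rightarrow> real \<Rightarrow> complex" where
  "fourier_sum m f x =
     (\<Sum>k = - int m..int m. fourier_coeff f k * exp (\<i> * of_int k * of_real x))"

text \<open>The derivative is determined only up to null sets by its Fourier series, so it is given as a
  relation between \<open>f\<close> and its derivative \<open>g\<close>. The series defining it has no constant term.\<close>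

definition has_psi_beta_deriv ::
  "(nat \<Rightarrow> real) \<Rightarrow> real \<Rightarrow> (real \<Rightarrow> complex) \<Rightarrow> (real \<Rightarrow> complex) \<Rightarrow> bool" where
  "has_psi_beta_deriv \<psi> \<beta> f g \<longleftrightarrow>
     g \<in> L1_per \<and> fourier_coeff g 0 = 0 \<and>
     (\<forall>k. k \<noteq> 0 \<longrightarrow>
        fourier_coeff g k =
          fourier_coeff f k / of_real (\<psi> (nat \<bar>k\<bar>))
            * exp (\<i> * of_real (\<beta> * pi / 2 * of_int (sgn k))))"

definition psi_class :: "(nat \<Rightarrow> real) \<Rightarrow> real \<Rightarrow> (real \<Rightarrow> complex) set" where
  "psi_class \<psi> \<beta> =
     {f \<in> L1_per. (\<forall>x. f x \<in> \<real>) \<and> (\<exists>g. has_psi_beta_deriv \<psi> \<beta> f g \<and> Linf_norm g \<le> 1)}"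

definition trig_polys :: "nat \<Rightarrow> (real \<Rightarrow> complex) set" where
  "trig_polys m =
     {t. \<exists>(a :: nat \<Rightarrow> real) (b :: nat \<Rightarrow> real). \<forall>x.
        t x = of_real (a 0 + (\<Sum>k = 1..m. a k * cos (real k * x) + b k * sin (real k * x)))}"

text \<open>The index \<open>n\<close> of both approximation quantities is meant to be positive: approximation is by
  trigonometric polynomials of degree at most \<open>n - 1\<close>.\<close>

definition fourier_approx_err :: "nat \<Rightarrow> (real \<Rightarrow> complex) set \<Rightarrow> real \<Rightarrow> ennreal" where
  "fourier_approx_err n F s = (SUP f\<in>F. Lp_norm s (\<lambda>x. f x - fourier_sum (n - 1) f x))"

definition best_approx_err :: "nat \<Rightarrow> (real \<Rightarrow> complex) set \<Rightarrow> real \<Rightarrow> ennreal" where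
  "best_approx_err n F s = (SUP f\<in>F. INF t\<in>trig_polys (n - 1). Lp_norm s (\<lambda>x. f x - t x))"

text \<open>Sequences indexed by the positive integers are functions on \<open>nat\<close> whose value at \<open>0\<close> is
  ignored. The supremum over \<open>m\<close> is taken in \<open>ereal\<close>, where it always exists.\<close>

definition psi_trunc :: "(nat \<Rightarrow> real) \<Rightarrow> nat \<Rightarrow> nat \<Rightarrow> real" where
  "psi_trunc \<psi> n k = (if k < n then 0 else \<psi> k)"

definition almost_decreasing :: "(nat \<Rightarrow> real) \<Rightarrow> bool" where
  "almost_decreasing \<psi> \<longleftrightarrow>
     (\<exists>M>0. \<forall>k1 k2. 1 \<le> k1 \<and> k1 \<le> k2 \<longrightarrow> \<psi> k2 \<le> M * \<psi> k1)"

definition class_P :: "(nat \<Rightarrow> real) set" where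
  "class_P =
     {\<psi>. (\<forall>k\<ge>1. \<psi> k > 0) \<and> almost_decreasing \<psi> \<and>
        (\<exists>K::real. \<forall>n\<ge>1.
           (SUP m\<in>{1..}. ereal (\<Sum>k = 2 ^ m..2 ^ (m + 1). \<bar>psi_trunc \<psi> n (k + 1) - psi_trunc \<psi> n k\<bar>))
             \<le> ereal (K * \<psi> n))}"

end

(* Marcinkiewicz multiplier estimate from bounded functions to L_s, for s = 2^(r+1), by elementary means.
   Riesz: if f_i has frequencies >= a_i and h_i has frequencies < a_i, then the mean of
   (sum f_i cnj(h_i))^p is 0, which controls f by u = f + h, also for vectors. Littlewood-Paley, upper half:
   for lacunary blocks d_J one doubles the exponent, applying the induction hypothesis and Riesz to
   the cross terms of (sum d_J)^2. Littlewood-Paley, lower half, for bounded g: if h has frequencies of size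
   at most 2^k, then h * D_j g is D_j (h g) up to a small commutator for j >= k, so Bessel's
   inequality bounds sum_{j>=k} ||h D_j g||_2^2 by C ||h||_2^2, and iteration gives all even moments of the
   square function. Abel summation inside dyadic blocks connects the two halves.
   A remainder f - S_{n-1} f is such a multiplier transform of the derivative of f, tested against trigonometric
   polynomials by means of Fejer sums. The lower bound comes from f = psi(n) cos(n x). *)

theory Submission
  imports Defs
begin

section \<open>Characters of the circle\<close>

text \<open>Only bounded derivatives occur in the class, and this is what makes elementary means
  sufficient: the lower half of the square function estimate is needed for bounded g alone, where
  multiplication by g does not increase mean squares; no interpolation enters. Even exponents are
  enough because on a finite measure space a larger exponent controls a smaller one, and for them
  the moments become means of products of trigonometric polynomials, whose frequencies can be
  located. The parameter \<open>\<beta>\<close> is harmless: a real function is determined by its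
  frequencies k \<ge> 0, and on k > 0 the rotation is one constant of modulus 1. What remains is the
  multiplier \<open>psi_trunc \<psi> n\<close>, whose values and dyadic variation are at most a
  multiple of \<open>\<psi> n\<close> by the two conditions in P. The constants depend on the
  exponent, but neither on the number of blocks nor on degrees. This permits working with Fejer
  means of the derivative, which are continuous and again bounded by 1, and passing to the limit at
  the end.\<close>

definition character :: "int \<Rightarrow> real \<Rightarrow> complex" where
  "character k x = cis (of_int k * x)"

lemma character_0 [simp]: "character 0 x = 1"
  and character_add: "character (j + k) x = character j x * character k x"
  and cnj_character: "cnj (character k x) = character (- k) x"
  and norm_character [simp]: "norm (character k x) = 1"
  by (simp_all add: character_def cis_mult cis_cnj ring_distribs)

lemma character_diff_arg: "character k (x - y) = character k x * character (- k) y"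
  by (simp add: character_def cis_mult ring_distribs)

lemma continuous_on_character [continuous_intros]:
  "continuous_on S f \<Longrightarrow> continuous_on S (\<lambda>x. character k (f x))"
  unfolding character_def by (intro continuous_intros)

lemma cont_character: "continuous_on S (character k)"
  using continuous_on_character[OF continuous_on_id] by simp

section \<open>Means of continuous functions over a period\<close>

text \<open>The gauge integral is used because the estimates run on continuous functions, with
  \<open>cont\<close> as the recurring side condition. The normalisation makes the characters
  orthonormal, and \<open>euclidean_space\<close> covers real moments and complex pairings
  alike.\<close>

definition avg :: "(real \<Rightarrow> 'a::euclidean_space) \<Rightarrow> 'a" where
  "avg f = (1 / (2 * pi)) *\<^sub>R integral {0..2 * pi} f"

abbreviation cont :: "(real \<Rightarrow> 'a::topological_space) \<Rightarrow> bool" where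
  "cont f \<equiv> continuous_on UNIV f"

lemma cont_integrable: "cont f \<Longrightarrow> (f :: real \<Rightarrow> 'a::euclidean_space) integrable_on {a..b}"
  by (meson continuous_on_subset integrable_continuous_interval subset_UNIV)

lemma avg_add: "cont f \<Longrightarrow> cont g \<Longrightarrow> avg (\<lambda>x. f x + g x) = avg f + avg g"
  by (simp add: avg_def integral_add cont_integrable scaleR_right_distrib)

lemma avg_diff: "cont f \<Longrightarrow> cont g \<Longrightarrow> avg (\<lambda>x. f x - g x) = avg f - avg g"
  by (simp add: avg_def integral_diff cont_integrable scaleR_right_diff_distrib)

lemma avg_zero [simp]: "avg (\<lambda>x. 0) = 0"
  by (simp add: avg_def)

lemma avg_const [simp]: "avg (\<lambda>x. c) = c"
  by (simp add: avg_def)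

lemma avg_sum: "(\<And>i. i \<in> I \<Longrightarrow> cont (f i)) \<Longrightarrow> avg (\<lambda>x. \<Sum>i\<in>I. f i x) = (\<Sum>i\<in>I. avg (f i))"
proof (induction I rule: infinite_finite_induct)
  case (insert i I)
  then have "cont (\<lambda>x. \<Sum>i\<in>I. f i x)" by (intro continuous_intros) auto
  with insert show ?case by (simp add: avg_add)
qed auto

lemma avg_cmult: "avg (\<lambda>x. c * f x) = c * avg f" for f :: "real \<Rightarrow> complex"
  by (cases "c = 0") (auto simp: avg_def)

lemma avg_cmult_real: "avg (\<lambda>x. c * f x) = c * avg f" for f :: "real \<Rightarrow> real"
  by (cases "c = 0") (auto simp: avg_def)

lemma avg_mono: "cont f \<Longrightarrow> cont g \<Longrightarrow> (\<And>x. f x \<le> g x) \<Longrightarrow> avg f \<le> avg g" for f :: "real \<Rightarrow> real"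
  by (auto simp: avg_def intro!: integral_le cont_integrable divide_right_mono)

lemma avg_nonneg: "cont f \<Longrightarrow> (\<And>x. 0 \<le> f x) \<Longrightarrow> 0 \<le> avg f" for f :: "real \<Rightarrow> real"
  using avg_mono[of "\<lambda>x. 0" f] by auto

lemma avg_linear: "bounded_linear L \<Longrightarrow> cont f \<Longrightarrow> avg (\<lambda>x. L (f x)) = L (avg f)"
  using integral_linear[OF cont_integrable, of f L 0 "2 * pi"]
  by (simp add: avg_def o_def linear_simps(5))

lemma avg_Re: "cont f \<Longrightarrow> avg (\<lambda>x. Re (f x)) = Re (avg f)"
  by (rule avg_linear[OF bounded_linear_Re])

lemma avg_cnj: "cont f \<Longrightarrow> avg (\<lambda>x. cnj (f x)) = cnj (avg f)"
  by (rule avg_linear[OF bounded_linear_cnj])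

lemma avg_of_real: "cont f \<Longrightarrow> avg (\<lambda>x. complex_of_real (f x)) = of_real (avg f)"
  by (rule avg_linear[OF bounded_linear_of_real])

lemma norm_avg_le: "cont f \<Longrightarrow> norm (avg f) \<le> avg (\<lambda>x. norm (f x))"
proof -
  assume f: "cont f"
  have "norm (integral {0..2 * pi} f) \<le> integral {0..2 * pi} (\<lambda>x. norm (f x))"
    using f by (intro integral_norm_bound_integral cont_integrable continuous_intros) auto
  then show ?thesis by (simp add: avg_def divide_right_mono)
qed

lemma avg_character: "avg (character k) = (if k = 0 then 1 else 0)"
proof (cases "k = 0")
  case True
  then have "character k = (\<lambda>x. 1)" by auto
  then show ?thesis using True by (simp del: avg_const add: avg_const[of "1::complex"])
next
  case False
  have "((\<lambda>z. - \<i> / of_int k * exp (\<i> * of_int k * z)) has_field_derivative exp (\<i> * of_int k * z)) (at z)" for z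
    using False by (auto intro!: derivative_eq_intros)
  from has_vector_derivative_real_field[OF this]
  have "((\<lambda>x. - \<i> / of_int k * character k x) has_vector_derivative character k x) (at x within {0..2*pi})" for x
    by (simp add: character_def cis_conv_exp mult.assoc)
  then have "(character k has_integral (- \<i> / of_int k * character k (2*pi) - - \<i> / of_int k * character k 0)) {0..2*pi}"
    by (intro fundamental_theorem_of_calculus) auto
  moreover have "character k (2 * pi) = character k 0"
    by (simp add: character_def mult.commute complex_eq_iff) (metis cos_int_2pin sin_int_2pin mult.commute mult.assoc)
  ultimately have "(character k has_integral 0) {0..2*pi}" by simp
  then have "integral {0..2*pi} (character k) = 0" by (rule integral_unique)
  with False show ?thesis by (simp add: avg_def)
qed

section \<open>Trigonometric polynomials with prescribed frequencies\<close>

text \<open>The set S may be infinite, typically a half-line: it records where the spectrum lies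
  without fixing a degree, and under products such sets just add. Members are finite sums
  nevertheless.\<close>

inductive trig_poly :: "int set \<Rightarrow> (real \<Rightarrow> complex) \<Rightarrow> bool" for S where
  trig_poly_zero: "trig_poly S (\<lambda>x. 0)"
| trig_poly_step: "trig_poly S f \<Longrightarrow> k \<in> S \<Longrightarrow> trig_poly S (\<lambda>x. c * character k x + f x)"

lemma trig_poly_cont: "trig_poly S f \<Longrightarrow> cont f"
  by (induction rule: trig_poly.induct) (auto intro!: continuous_intros)

lemma trig_poly_mono: "trig_poly S f \<Longrightarrow> S \<subseteq> T \<Longrightarrow> trig_poly T f"
  by (induction rule: trig_poly.induct) (auto intro!: trig_poly.intros)

lemma trig_poly_add: "trig_poly S f \<Longrightarrow> trig_poly S g \<Longrightarrow> trig_poly S (\<lambda>x. f x + g x)"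
  by (induction rule: trig_poly.induct) (auto simp: add.assoc intro!: trig_poly.intros)

lemma trig_poly_character: "k \<in> S \<Longrightarrow> trig_poly S (\<lambda>x. c * character k x)"
  using trig_poly_step[OF trig_poly_zero] by simp

lemma trig_poly_const: "0 \<in> S \<Longrightarrow> trig_poly S (\<lambda>x. c)"
  using trig_poly_character[of 0 S c] by simp

lemma trig_poly_shift:
  assumes "trig_poly S f" "\<And>l. l \<in> S \<Longrightarrow> k + l \<in> T" shows "trig_poly T (\<lambda>x. c * character k x * f x)"
  using assms
proof (induction rule: trig_poly.induct)
  case (trig_poly_step f l d)
  then have "trig_poly T (\<lambda>x. (c * d) * character (k + l) x + c * character k x * f x)"
    by (intro trig_poly.trig_poly_step) auto
  then show ?case by (simp add: character_add algebra_simps)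
qed (simp add: trig_poly.trig_poly_zero)

lemma trig_poly_mult:
  assumes "trig_poly S f" "trig_poly T g" "\<And>k l. k \<in> S \<Longrightarrow> l \<in> T \<Longrightarrow> k + l \<in> U"
  shows "trig_poly U (\<lambda>x. f x * g x)"
  using assms
proof (induction rule: trig_poly.induct)
  case (trig_poly_step f k c)
  then have "trig_poly U (\<lambda>x. c * character k x * g x + f x * g x)"
    by (intro trig_poly_add trig_poly_shift[OF trig_poly_step(4)]) auto
  then show ?case by (simp add: ring_distribs)
qed (simp add: trig_poly.trig_poly_zero)

lemma trig_poly_cmult: "trig_poly S f \<Longrightarrow> trig_poly S (\<lambda>x. c * f x)"
  using trig_poly_shift[of S f 0 S c] by simp

lemma trig_poly_uminus: "trig_poly S f \<Longrightarrow> trig_poly S (\<lambda>x. - f x)"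
  using trig_poly_cmult[of S f "-1"] by simp

lemma trig_poly_sum: "(\<And>i. i \<in> I \<Longrightarrow> trig_poly S (f i)) \<Longrightarrow> trig_poly S (\<lambda>x. \<Sum>i\<in>I. f i x)"
  by (induction I rule: infinite_finite_induct) (auto intro!: trig_poly_add trig_poly_zero)

lemma trig_poly_cnj:
  assumes "trig_poly S f" "\<And>k. k \<in> S \<Longrightarrow> - k \<in> T" shows "trig_poly T (\<lambda>x. cnj (f x))"
  using assms
  by (induction rule: trig_poly.induct) (auto simp: cnj_character intro!: trig_poly.intros)

lemma trig_poly_power_pos:
  assumes "trig_poly {1..} f" shows "trig_poly {1..} (\<lambda>x. f x ^ Suc p)"
proof (induction p)
  case (Suc p)
  then show ?case using trig_poly_mult[OF assms Suc, of "{1..}"] by simp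
qed (simp add: assms)

lemma avg_trig_poly: "trig_poly S f \<Longrightarrow> 0 \<notin> S \<Longrightarrow> avg f = 0"
proof (induction rule: trig_poly.induct)
  case (trig_poly_step f k c)
  have "avg (\<lambda>x. c * character k x + f x) = avg (\<lambda>x. c * character k x) + avg f"
    using trig_poly_cont[OF trig_poly_step(1)] by (intro avg_add continuous_intros)
  moreover have "k \<noteq> 0" using trig_poly_step by auto
  ultimately show ?case using trig_poly_step by (simp add: avg_cmult avg_character)
qed simp

section \<open>A vector-valued M. Riesz inequality\<close>

text \<open>Linearisation at w = 0. For norm w \<le> 2^-(p+1) it keeps (1 - w)^p within 1/2 of 1,
  which is how \<open>riesz_pointwise\<close> uses it.\<close>

lemma norm_one_minus_power_le:
  fixes w :: complex
  assumes "norm w \<le> 1" shows "norm ((1 - w) ^ p - 1) \<le> (2 ^ p - 1) * norm w"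
proof (induction p)
  case (Suc p)
  have eq: "(1 - w) ^ Suc p - 1 = (1 - w) * ((1 - w) ^ p - 1) - w" by (simp add: algebra_simps)
  have "norm (1 - w) \<le> 2" using norm_triangle_ineq4[of 1 w] assms by simp
  then have "norm (1 - w) * norm ((1 - w) ^ p - 1) \<le> 2 * ((2 ^ p - 1) * norm w)"
    using Suc by (intro mult_mono) auto
  moreover have "norm ((1 - w) ^ Suc p - 1) \<le> norm (1 - w) * norm ((1 - w) ^ p - 1) + norm w"
    unfolding eq by (metis norm_mult norm_triangle_ineq4)
  ultimately show ?case by (simp add: algebra_simps)
qed simp

text \<open>Two regimes, separated by \<kappa> = 4^(p+1). If X \<le> \<kappa> U, then X and norm (X
  - Y) are at most 2 \<kappa> U; the factor 3 counts X^p once and the real part twice. Otherwise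
  norm Y / X \<le> \<kappa>^(-1/2) = 2^-(p+1), and the real part of (X - Y)^p is at least X^p /
  2.\<close>

lemma riesz_pointwise:
  fixes X U :: real and Y :: complex
  assumes X: "X \<ge> 0" and U: "U \<ge> 0" and Y: "norm Y ^ 2 \<le> X * U"
  shows "X ^ p \<le> 2 * Re ((of_real X - Y) ^ p) + 3 * (2 * 4 ^ (p + 1)) ^ p * U ^ p"
proof -
  define \<kappa> :: real where "\<kappa> = 4 ^ (p + 1)"
  have k1: "\<kappa> \<ge> 1" unfolding \<kappa>_def by (rule one_le_power) simp
  show ?thesis
  proof (cases "X \<le> \<kappa> * U")
    case True
    have "norm Y ^ 2 \<le> (\<kappa> * U) * U"
      using Y mult_right_mono[OF True U] by linarith
    also have "\<dots> \<le> (\<kappa> * U) ^ 2"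
      unfolding power2_eq_square using mult_right_mono[OF k1 U] U k1 by (intro mult_left_mono) auto
    finally have "norm Y \<le> \<kappa> * U" using U k1 by (intro power2_le_imp_le[of "norm Y"]) auto
    then have "norm (of_real X - Y) \<le> 2 * \<kappa> * U"
      using norm_triangle_ineq4[of "of_real X" Y] True X by simp
    then have "norm ((of_real X - Y) ^ p) \<le> (2 * \<kappa> * U) ^ p"
      by (simp add: norm_power power_mono)
    then have "\<bar>Re ((of_real X - Y) ^ p)\<bar> \<le> (2 * \<kappa> * U) ^ p"
      using abs_Re_le_cmod order_trans by blast
    moreover have "X ^ p \<le> (2 * \<kappa> * U) ^ p"
    proof (rule power_mono)
      show "X \<le> 2 * \<kappa> * U" using True k1 U mult_nonneg_nonneg[of \<kappa> U] by linarith
    qed (use X in auto)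
    moreover have "3 * (2 * 4 ^ (p + 1)) ^ p * U ^ p = 3 * (2 * \<kappa> * U) ^ p"
      by (simp only: \<kappa>_def power_mult_distrib mult.assoc)
    ultimately show ?thesis by linarith
  next
    case False
    then have Xp: "X > 0" using U k1 mult_nonneg_nonneg[of \<kappa> U] by linarith
    define w where "w = Y / of_real X"
    have "norm Y ^ 2 * \<kappa> \<le> X * (\<kappa> * U)"
      using mult_right_mono[OF Y, of \<kappa>] k1 by (simp add: mult_ac)
    also have "\<dots> \<le> X * X" using False Xp by simp
    finally have "norm Y ^ 2 * \<kappa> \<le> X ^ 2" by (simp add: power2_eq_square)
    moreover have "\<kappa> = (2 ^ (p + 1)) ^ 2"
      using power_mult[of "2 :: real" 2 "p + 1"] power_even_eq[of "2 :: real" "p + 1"]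
      by (simp add: \<kappa>_def)
    ultimately have "(norm Y * 2 ^ (p + 1)) ^ 2 \<le> X ^ 2" by (simp only: power_mult_distrib)
    then have "norm Y * 2 ^ (p + 1) \<le> X" by (rule power2_le_imp_le[OF _ less_imp_le[OF Xp]])
    then have w: "norm w * 2 ^ (p + 1) \<le> 1" using Xp by (simp add: w_def norm_divide)
    moreover have "norm w * 1 \<le> norm w * 2 ^ (p + 1)" by (intro mult_left_mono one_le_power) auto
    ultimately have "norm ((1 - w) ^ p - 1) \<le> (2 ^ p - 1) * norm w"
      by (intro norm_one_minus_power_le) simp
    also have "\<dots> = norm w * 2 ^ (p + 1) / 2 - norm w" by (simp add: algebra_simps)
    also have "\<dots> \<le> 1 / 2" using w norm_ge_zero[of w] by linarith
    finally have "norm (1 - (1 - w) ^ p) \<le> 1 / 2" by (simp add: norm_minus_commute)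
    then have "Re (1 - (1 - w) ^ p) \<le> 1 / 2"
      using complex_Re_le_cmod[of "1 - (1 - w) ^ p"] by linarith
    then have "1 / 2 \<le> Re ((1 - w) ^ p)" by simp
    moreover have "(of_real X - Y) ^ p = of_real (X ^ p) * (1 - w) ^ p"
    proof -
      have "of_real X - Y = of_real X * (1 - w)" using Xp by (simp add: w_def algebra_simps)
      then show ?thesis by (simp add: power_mult_distrib)
    qed
    ultimately have "X ^ p * (1 / 2) \<le> Re ((of_real X - Y) ^ p)"
      using Xp by (simp del: of_real_power)
    then have "X ^ p \<le> 2 * Re ((of_real X - Y) ^ p)" by linarith
    moreover have "0 \<le> 3 * (2 * 4 ^ (p + 1)) ^ p * U ^ p" using U by simp
    ultimately show ?thesis by linarith
  qed
qed

definition riesz_const :: "nat \<Rightarrow> real" where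
  "riesz_const p = 3 * (2 * 4 ^ (p + 1)) ^ p"

lemma riesz_const_nonneg: "0 \<le> riesz_const p"
  by (simp add: riesz_const_def)

text \<open>With \<open>u i = f i + h i\<close>, the mean of \<open>(\<Sum>i. f i * cnj (h i)) ^ p\<close> vanishes because only
  positive frequencies occur, and this sum equals \<open>\<Sum>i. (norm (f i))\<^sup>2 - f i * cnj (u i)\<close>.\<close>

lemma riesz_high:
  assumes f: "\<And>i. i \<in> I \<Longrightarrow> trig_poly {a i..} (f i)" and h: "\<And>i. i \<in> I \<Longrightarrow> trig_poly {..<a i} (h i)"
  shows "avg (\<lambda>x. (\<Sum>i\<in>I. norm (f i x) ^ 2) ^ p)
      \<le> riesz_const p * avg (\<lambda>x. (\<Sum>i\<in>I. norm (f i x + h i x) ^ 2) ^ p)"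
proof (cases "p = 0")
  case True
  then show ?thesis by (simp add: riesz_const_def)
next
  case False
  then obtain q where q: "p = Suc q" by (cases p) auto
  define X where "X x = (\<Sum>i\<in>I. norm (f i x) ^ 2)" for x
  define U where "U x = (\<Sum>i\<in>I. norm (f i x + h i x) ^ 2)" for x
  define Y where "Y x = (\<Sum>i\<in>I. f i x * cnj (f i x + h i x))" for x
  have cf: "cont (f i)" "cont (h i)" if "i \<in> I" for i using f h trig_poly_cont that by blast+
  have [continuous_intros]: "cont X" "cont U" "cont Y"
    unfolding X_def U_def Y_def using cf by (auto intro!: continuous_intros)
  have eq: "of_real (X x) - Y x = (\<Sum>i\<in>I. - (f i x * cnj (h i x)))" for x
    unfolding X_def Y_def
    by (simp add: sum_subtractf[symmetric] algebra_simps sum.distrib sum_negf complex_norm_square del: of_real_power)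
  \<comment> \<open>Frequencies at least \<open>a i\<close> from \<open>f i\<close> and above
    \<open>- a i\<close> from the conjugate of \<open>h i\<close> add up to at least 1.\<close>
  have "trig_poly {1..} (\<lambda>x. of_real (X x) - Y x)"
    unfolding eq
  proof (intro trig_poly_sum trig_poly_uminus)
    fix i assume i: "i \<in> I"
    show "trig_poly {1..} (\<lambda>x. f i x * cnj (h i x))"
      by (rule trig_poly_mult[OF f[OF i] trig_poly_cnj[OF h[OF i], of "{- a i<..}"]]) auto
  qed
  then have "trig_poly {1..} (\<lambda>x. (of_real (X x) - Y x) ^ p)" unfolding q by (rule trig_poly_power_pos)
  then have z: "avg (\<lambda>x. (of_real (X x) - Y x) ^ p) = 0" by (rule avg_trig_poly) auto
  \<comment> \<open>Cauchy-Schwarz over I gives the relation between X, Y and U that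
    \<open>riesz_pointwise\<close> asks for.\<close>
  have YX: "norm (Y x) ^ 2 \<le> X x * U x" for x
  proof -
    have "norm (Y x) \<le> (\<Sum>i\<in>I. \<bar>norm (f i x)\<bar> * \<bar>norm (f i x + h i x)\<bar>)"
      unfolding Y_def by (rule sum_norm_le) (simp add: norm_mult flip: complex_cnj_add)
    also have "\<dots> \<le> L2_set (\<lambda>i. norm (f i x)) I * L2_set (\<lambda>i. norm (f i x + h i x)) I"
      by (rule L2_set_mult_ineq)
    finally have "norm (Y x) ^ 2 \<le> (L2_set (\<lambda>i. norm (f i x)) I * L2_set (\<lambda>i. norm (f i x + h i x)) I) ^ 2"
      by (intro power_mono) auto
    then show ?thesis
      by (simp add: L2_set_def X_def U_def power_mult_distrib sum_nonneg)
  qed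
  have "avg (\<lambda>x. X x ^ p) \<le> avg (\<lambda>x. 2 * Re ((of_real (X x) - Y x) ^ p) + riesz_const p * U x ^ p)"
    using YX by (intro avg_mono continuous_intros riesz_pointwise[folded riesz_const_def]) (auto simp: X_def U_def sum_nonneg)
  also have "\<dots> = avg (\<lambda>x. 2 * Re ((of_real (X x) - Y x) ^ p)) + avg (\<lambda>x. riesz_const p * U x ^ p)"
    by (intro avg_add continuous_intros)
  also have "\<dots> = riesz_const p * avg (\<lambda>x. U x ^ p)"
  proof -
    have "cont (\<lambda>x. (of_real (X x) - Y x) ^ p)" by (intro continuous_intros)
    then show ?thesis using z by (simp add: avg_cmult_real avg_Re)
  qed
  finally show ?thesis by (simp add: X_def U_def)
qed

text \<open>Conjugation reflects spectra at 0: frequencies below a become frequencies at least 1 -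
  a, and those at least a fall below 1 - a, so \<open>riesz_high\<close> applies with the roles
  exchanged.\<close>

lemma riesz_low:
  assumes f: "\<And>i. i \<in> I \<Longrightarrow> trig_poly {a i..} (f i)" and h: "\<And>i. i \<in> I \<Longrightarrow> trig_poly {..<a i} (h i)"
  shows "avg (\<lambda>x. (\<Sum>i\<in>I. norm (h i x) ^ 2) ^ p)
      \<le> riesz_const p * avg (\<lambda>x. (\<Sum>i\<in>I. norm (h i x + f i x) ^ 2) ^ p)"
  using riesz_high[of I "\<lambda>i. 1 - a i" "\<lambda>i x. cnj (h i x)" "\<lambda>i x. cnj (f i x)" p]
    trig_poly_cnj[OF h] trig_poly_cnj[OF f]
  by (simp add: subset_iff flip: complex_cnj_add)

text \<open>The upper part is removed by \<open>riesz_low\<close> and the lower one by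
  \<open>riesz_high\<close>, at the price of one \<open>riesz_const\<close> each. It is essential
  that the band may vary with i: later, partial sums of the same function with many different ends
  stand side by side.\<close>

lemma riesz_band:
  assumes l: "\<And>i. i \<in> I \<Longrightarrow> trig_poly {..<a i} (l i)" and c: "\<And>i. i \<in> I \<Longrightarrow> trig_poly {a i..b i} (c i)"
    and u: "\<And>i. i \<in> I \<Longrightarrow> trig_poly {b i<..} (u i)" and ab: "\<And>i. i \<in> I \<Longrightarrow> a i \<le> b i"
  shows "avg (\<lambda>x. (\<Sum>i\<in>I. norm (c i x) ^ 2) ^ p)
      \<le> riesz_const p ^ 2 * avg (\<lambda>x. (\<Sum>i\<in>I. norm (l i x + c i x + u i x) ^ 2) ^ p)"
proof -
  have 1: "avg (\<lambda>x. (\<Sum>i\<in>I. norm (c i x) ^ 2) ^ p)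
      \<le> riesz_const p * avg (\<lambda>x. (\<Sum>i\<in>I. norm (c i x + u i x) ^ 2) ^ p)"
    by (rule riesz_low[where a = "\<lambda>i. b i + 1"]) (auto intro: trig_poly_mono[OF c] trig_poly_mono[OF u])
  have 2: "avg (\<lambda>x. (\<Sum>i\<in>I. norm (c i x + u i x) ^ 2) ^ p)
      \<le> riesz_const p * avg (\<lambda>x. (\<Sum>i\<in>I. norm ((c i x + u i x) + l i x) ^ 2) ^ p)"
    using ab
    by (intro riesz_high[where a = a] l trig_poly_add trig_poly_mono[OF c] trig_poly_mono[OF u]) force+
  have "c i x + u i x + l i x = l i x + c i x + u i x" for i x by simp
  with order_trans[OF 1 mult_left_mono[OF 2 riesz_const_nonneg]] show ?thesis
    by (simp only: power2_eq_square mult.assoc)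
qed

section \<open>Lacunary sums\<close>

lemma add_power_le:
  fixes a b :: real
  assumes "0 \<le> a" "0 \<le> b" shows "(a + b) ^ n \<le> 2 ^ n * (a ^ n + b ^ n)"
proof -
  have "(a + b) ^ n \<le> (2 * max a b) ^ n" using assms by (intro power_mono) auto
  also have "\<dots> = 2 ^ n * max a b ^ n" by (simp add: power_mult_distrib)
  also have "max a b ^ n \<le> a ^ n + b ^ n" using assms by (auto simp: max_def)
  finally show ?thesis by simp
qed

lemma avg_norm_sq_orthogonal:
  fixes d :: "'i \<Rightarrow> real \<Rightarrow> complex"
  assumes d: "\<And>i. i \<in> I \<Longrightarrow> cont (d i)"
    and orth: "\<And>i j. i \<in> I \<Longrightarrow> j \<in> I \<Longrightarrow> i \<noteq> j \<Longrightarrow> avg (\<lambda>x. d i x * cnj (d j x)) = 0"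
  shows "avg (\<lambda>x. norm (\<Sum>i\<in>I. d i x) ^ 2) = (\<Sum>i\<in>I. avg (\<lambda>x. norm (d i x) ^ 2))"
proof (cases "finite I")
  case True
  have "complex_of_real (avg (\<lambda>x. norm (\<Sum>i\<in>I. d i x) ^ 2))
      = avg (\<lambda>x. of_real (norm (\<Sum>i\<in>I. d i x) ^ 2))"
    using d by (intro avg_of_real[symmetric] continuous_intros)
  also have "\<dots> = avg (\<lambda>x. \<Sum>i\<in>I. \<Sum>j\<in>I. d i x * cnj (d j x))"
    unfolding complex_norm_square by (simp add: sum_product)
  also have "\<dots> = (\<Sum>i\<in>I. avg (\<lambda>x. \<Sum>j\<in>I. d i x * cnj (d j x)))"
    using d by (intro avg_sum continuous_intros)
  also have "\<dots> = (\<Sum>i\<in>I. \<Sum>j\<in>I. avg (\<lambda>x. d i x * cnj (d j x)))"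
    using d by (intro sum.cong refl avg_sum continuous_intros)
  also have "\<dots> = (\<Sum>i\<in>I. \<Sum>j\<in>I. if i = j then avg (\<lambda>x. d i x * cnj (d i x)) else 0)"
    using orth by (intro sum.cong refl) auto
  also have "\<dots> = (\<Sum>i\<in>I. avg (\<lambda>x. d i x * cnj (d i x)))"
    using True by simp
  also have "\<dots> = (\<Sum>i\<in>I. avg (\<lambda>x. of_real (norm (d i x) ^ 2)))"
    unfolding complex_norm_square ..
  also have "\<dots> = (\<Sum>i\<in>I. of_real (avg (\<lambda>x. norm (d i x) ^ 2)))"
    using d by (intro sum.cong refl avg_of_real continuous_intros)
  finally show ?thesis by (simp flip: of_real_sum)
qed simp

lemma avg_trig_poly_mult_cnj:
  assumes "trig_poly S f" "trig_poly T g" "S \<inter> T = {}" shows "avg (\<lambda>x. f x * cnj (g x)) = 0"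
proof -
  have "trig_poly {k - l | k l. k \<in> S \<and> l \<in> T} (\<lambda>x. f x * cnj (g x))"
    by (rule trig_poly_mult[OF assms(1) trig_poly_cnj[OF assms(2), of "uminus ` T"]]) force+
  then show ?thesis by (rule avg_trig_poly) (use assms(3) in auto)
qed

lemma square_of_sum:
  fixes d :: "nat \<Rightarrow> 'a::comm_ring_1"
  shows "(\<Sum>J<m. d J) ^ 2 = (\<Sum>J<m. d J ^ 2) + 2 * (\<Sum>J<m. (\<Sum>I<J. d I) * d J)"
  by (induction m) (auto simp: power2_eq_square algebra_simps)

text \<open>The exponent is doubled at each step: in \<open>(\<Sum>J. d J)\<^sup>2 = (\<Sum>J. d J\<^sup>2) + 2 (\<Sum>J. P J * d J)\<close> with
  \<open>P J = (\<Sum>I<J. d I)\<close> the last sum is again lacunary, and \<open>P J * d J\<close> is the low frequency part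
  of \<open>((\<Sum>I. d I) - d J) * d J\<close>.\<close>

lemma lacunary_upper:
  "\<exists>C\<ge>0. \<forall>d a b m.
     (\<forall>J. 0 \<le> a J \<and> a J \<le> b J \<and> trig_poly {a J..b J} (d J)) \<longrightarrow> (\<forall>J. \<forall>I<J. 2 ^ r * b I < a J) \<longrightarrow>
     avg (\<lambda>x. norm (\<Sum>J<m. d J x) ^ (2 * 2 ^ r))
       \<le> C * avg (\<lambda>x. (\<Sum>J<m::nat. norm (d J x) ^ 2) ^ 2 ^ r)"
proof (induction r)
  case 0
  have "avg (\<lambda>x. norm (\<Sum>J<m. d J x) ^ 2) = avg (\<lambda>x. \<Sum>J<m. norm (d J x) ^ 2)"
    if d: "\<forall>J. 0 \<le> a J \<and> a J \<le> b J \<and> trig_poly {a J..b J} (d J)" and lac: "\<forall>J. \<forall>I<J. b I < a J"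
    for a b :: "nat \<Rightarrow> int" and d and m :: nat
  proof -
    have c: "cont (d J)" for J using d trig_poly_cont by blast
    have "avg (\<lambda>x. norm (\<Sum>J<m. d J x) ^ 2) = (\<Sum>J<m. avg (\<lambda>x. norm (d J x) ^ 2))"
    proof (rule avg_norm_sq_orthogonal)
      fix I J :: nat assume "I \<noteq> J"
      then have "b I < a J \<or> b J < a I" using lac by (metis nat_neq_iff)
      then show "avg (\<lambda>x. d I x * cnj (d J x)) = 0"
      proof -
        have "trig_poly {a I..b I} (d I)" "trig_poly {a J..b J} (d J)" using d by blast+
        moreover have "{a I..b I} \<inter> {a J..b J} = {}"
          using \<open>b I < a J \<or> b J < a I\<close> by auto
        ultimately show ?thesis by (rule avg_trig_poly_mult_cnj)
      qed
    qed (rule c)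
    also have "\<dots> = avg (\<lambda>x. \<Sum>J<m. norm (d J x) ^ 2)"
      using c by (intro avg_sum[symmetric] continuous_intros)
    finally show ?thesis .
  qed
  then show ?case by (intro exI[of _ 1]) simp
next
  case (Suc r)
  define q :: nat where "q = 2 ^ r"
  from Suc obtain C where C: "C \<ge> 0" and IH: "\<And>d a b m.
     (\<forall>J. 0 \<le> a J \<and> a J \<le> b J \<and> trig_poly {a J..b J} (d J)) \<Longrightarrow> (\<forall>J. \<forall>I<J. 2 ^ r * b I < a J) \<Longrightarrow>
     avg (\<lambda>x. norm (\<Sum>J<m. d J x) ^ (2 * q))
       \<le> C * avg (\<lambda>x. (\<Sum>J<m::nat. norm (d J x) ^ 2) ^ q)"
    unfolding q_def by blast
  \<comment> \<open>One 2^(2q) comes from \<open>add_power_le\<close>, the other from the factor 2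
    in front of the cross terms; C is the constant of the induction hypothesis,
    \<open>riesz_const q\<close> pays for dropping the high frequencies, and 4^q arises in the
    pointwise bound by F and V.\<close>
  define K where "K = 2 ^ (2 * q) * 2 ^ (2 * q) * (C * (riesz_const q * 4 ^ q))"
  have K0: "K \<ge> 0" using C riesz_const_nonneg by (simp add: K_def)
  have "avg (\<lambda>x. norm (\<Sum>J<m. d J x) ^ (4 * q))
      \<le> 2 * (2 ^ (2 * q) + K + K ^ 2 / 2) * avg (\<lambda>x. (\<Sum>J<m. norm (d J x) ^ 2) ^ (2 * q))"
    if d: "\<forall>J. 0 \<le> a J \<and> a J \<le> b J \<and> trig_poly {a J..b J} (d J)"
      and lac: "\<forall>J. \<forall>I<J. 2 ^ Suc r * b I < a J"
    for a b :: "nat \<Rightarrow> int" and d and m :: nat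
  proof -
    define P H where "P J x = (\<Sum>I<J. d I x)" and "H J x = (\<Sum>I=Suc J..<m. d I x)" for J x
    define F where "F x = (\<Sum>J<m. d J x)" for x
    define V where "V x = (\<Sum>J<m. norm (d J x) ^ 2)" for x
    define G where "G x = (\<Sum>J<m. P J x * d J x)" for x
    have ab: "0 \<le> a J" "a J \<le> b J" "0 \<le> b J" "trig_poly {a J..b J} (d J)" for J
      using d order_trans by blast+
    have [continuous_intros]: "cont (d J)" for J using ab trig_poly_cont by blast
    have [continuous_intros]: "cont (P J)" "cont (H J)" "cont F" "cont V" for J
      unfolding P_def H_def F_def V_def by (intro continuous_intros)+
    have [continuous_intros]: "cont G"
      unfolding G_def by (intro continuous_intros)
    have V0: "V x \<ge> 0" for x by (simp add: V_def sum_nonneg)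
    \<comment> \<open>The products \<open>P J x * d J x\<close> occupy [a J, 2 * b J]. The doubled
      upper end uses up one factor 2 of the gap, which is why the required gap grows with r.\<close>
    have lac2: "2 ^ r * (2 * b I) < a J" "2 * b I < a J" "b I < a J" if "I < J" for I J
    proof -
      show 1: "2 ^ r * (2 * b I) < a J" using lac that by (simp add: mult_ac)
      have "1 * (2 * b I) \<le> 2 ^ r * (2 * b I)" using ab(3) by (intro mult_right_mono one_le_power) auto
      with 1 show 2: "2 * b I < a J" by simp
      then show "b I < a J" using ab(3)[of I] by simp
    qed
    have tpP: "trig_poly {0..b J} (P J)" for J
      unfolding P_def
    proof (intro trig_poly_sum)
      fix I assume "I \<in> {..<J}"
      then have "b I < a J" using lac2 by auto
      then show "trig_poly {0..b J} (d I)" using ab(1)[of I] ab(2)[of J] by (intro trig_poly_mono[OF ab(4)]) auto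
    qed
    have tpH: "trig_poly {2 * b J + 1..} (H J)" for J
      unfolding H_def
    proof (intro trig_poly_sum)
      fix I assume "I \<in> {Suc J..<m}"
      then have "2 * b J < a I" using lac2 by auto
      then show "trig_poly {2 * b J + 1..} (d I)" by (intro trig_poly_mono[OF ab(4)]) auto
    qed
    have tpPd: "trig_poly {a J..2 * b J} (\<lambda>x. P J x * d J x)" for J
      by (rule trig_poly_mult[OF tpP ab(4)]) auto
    have tpHd: "trig_poly {2 * b J + 1..} (\<lambda>x. H J x * d J x)" for J
      by (rule trig_poly_mult[OF tpH ab(4)]) (use ab(1)[of J] in auto)
    have split: "P J x * d J x + H J x * d J x = (F x - d J x) * d J x" if "J < m" for J x
    proof -
      have "F x = (\<Sum>I<J. d I x) + (\<Sum>I=J..<m. d I x)"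
        unfolding F_def lessThan_atLeast0 using that by (simp add: sum.atLeastLessThan_concat)
      also have "(\<Sum>I=J..<m. d I x) = d J x + H J x"
        unfolding H_def using that by (rule sum.atLeast_Suc_lessThan)
      finally show ?thesis by (simp add: P_def algebra_simps)
    qed
    have step1: "avg (\<lambda>x. norm (G x) ^ (2 * q)) \<le> C * avg (\<lambda>x. (\<Sum>J<m. norm (P J x * d J x) ^ 2) ^ q)"
      unfolding G_def
    proof (rule IH)
      show "\<forall>J. 0 \<le> a J \<and> a J \<le> 2 * b J \<and> trig_poly {a J..2 * b J} (\<lambda>x. P J x * d J x)"
      proof
        fix J show "0 \<le> a J \<and> a J \<le> 2 * b J \<and> trig_poly {a J..2 * b J} (\<lambda>x. P J x * d J x)"
          using ab[of J] tpPd by auto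
      qed
      show "\<forall>J. \<forall>I<J. 2 ^ r * (2 * b I) < a J" using lac2 by blast
    qed
    also have "avg (\<lambda>x. (\<Sum>J<m. norm (P J x * d J x) ^ 2) ^ q)
        \<le> riesz_const q * avg (\<lambda>x. (\<Sum>J<m. norm (P J x * d J x + H J x * d J x) ^ 2) ^ q)"
      by (rule riesz_low[where a = "\<lambda>J. 2 * b J + 1"]) (auto intro: tpHd trig_poly_mono[OF tpPd])
    also have "avg (\<lambda>x. (\<Sum>J<m. norm (P J x * d J x + H J x * d J x) ^ 2) ^ q)
        \<le> avg (\<lambda>x. 4 ^ q * (norm (F x) ^ (2 * q) * V x ^ q + V x ^ (2 * q)))"
    proof (intro avg_mono continuous_intros)
      fix x
      have "(\<Sum>J<m. norm (P J x * d J x + H J x * d J x) ^ 2)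
          \<le> (\<Sum>J<m. 2 * norm (F x) ^ 2 * norm (d J x) ^ 2 + 2 * (norm (d J x) ^ 2) ^ 2)"
      proof (rule sum_mono)
        fix J assume J: "J \<in> {..<m}"
        have "norm (F x - d J x) ^ 2 \<le> (norm (F x) + norm (d J x)) ^ 2"
          by (intro power_mono norm_triangle_ineq4) auto
        also have "\<dots> \<le> 2 * norm (F x) ^ 2 + 2 * norm (d J x) ^ 2"
          using sum_squares_bound[of "norm (F x)" "norm (d J x)"] by (simp add: power2_sum)
        finally have "norm (F x - d J x) ^ 2 * norm (d J x) ^ 2
            \<le> (2 * norm (F x) ^ 2 + 2 * norm (d J x) ^ 2) * norm (d J x) ^ 2"
          by (rule mult_right_mono) simp
        then show "norm (P J x * d J x + H J x * d J x) ^ 2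
            \<le> 2 * norm (F x) ^ 2 * norm (d J x) ^ 2 + 2 * (norm (d J x) ^ 2) ^ 2"
          using J by (simp add: split norm_mult power_mult_distrib power2_eq_square[of "norm (d J x) ^ 2"]
              distrib_right mult.assoc del: left_diff_distrib)
      qed
      also have "\<dots> = 2 * norm (F x) ^ 2 * V x + 2 * (\<Sum>J<m. (norm (d J x) ^ 2) ^ 2)"
        by (simp add: V_def sum.distrib sum_distrib_left)
      also have "(\<Sum>J<m. (norm (d J x) ^ 2) ^ 2) \<le> V x ^ 2"
        unfolding V_def by (induction m) (auto simp: power2_sum intro!: add_increasing2 mult_nonneg_nonneg sum_nonneg)
      finally have "(\<Sum>J<m. norm (P J x * d J x + H J x * d J x) ^ 2) ^ q
          \<le> (2 * norm (F x) ^ 2 * V x + 2 * V x ^ 2) ^ q"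
        by (intro power_mono sum_nonneg) auto
      also have "\<dots> = 2 ^ q * (norm (F x) ^ 2 * V x + V x ^ 2) ^ q"
        by (simp flip: power_mult_distrib add: ring_distribs mult_ac)
      also have "\<dots> \<le> 2 ^ q * (2 ^ q * ((norm (F x) ^ 2 * V x) ^ q + (V x ^ 2) ^ q))"
        using V0 by (intro mult_left_mono add_power_le) auto
      also have "\<dots> = 4 ^ q * (norm (F x) ^ (2 * q) * V x ^ q + V x ^ (2 * q))"
        by (simp add: power_mult_distrib power_mult flip: mult.assoc power_mult_distrib[of 2 2])
      finally show "(\<Sum>J<m. norm (P J x * d J x + H J x * d J x) ^ 2) ^ q
          \<le> 4 ^ q * (norm (F x) ^ (2 * q) * V x ^ q + V x ^ (2 * q))" .
    qed
    finally have G: "avg (\<lambda>x. norm (G x) ^ (2 * q))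
        \<le> C * (riesz_const q * (4 ^ q * avg (\<lambda>x. norm (F x) ^ (2 * q) * V x ^ q + V x ^ (2 * q))))"
      using C riesz_const_nonneg by (simp add: mult_left_mono avg_cmult_real)
    have "avg (\<lambda>x. norm (F x) ^ (4 * q))
        \<le> avg (\<lambda>x. 2 ^ (2 * q) * V x ^ (2 * q) + 2 ^ (2 * q) * 2 ^ (2 * q) * norm (G x) ^ (2 * q))"
    proof (intro avg_mono continuous_intros)
      fix x
      have "norm (F x ^ 2) \<le> norm (\<Sum>J<m. d J x ^ 2) + 2 * norm (G x)"
        unfolding F_def G_def P_def square_of_sum
        by (rule order_trans[OF norm_triangle_ineq]) (simp add: norm_mult)
      also have "norm (\<Sum>J<m. d J x ^ 2) \<le> V x"
        unfolding V_def by (rule sum_norm_le) (simp add: norm_power)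
      finally have "norm (F x ^ 2) ^ (2 * q) \<le> (V x + 2 * norm (G x)) ^ (2 * q)"
        by (intro power_mono) auto
      also have "\<dots> \<le> 2 ^ (2 * q) * (V x ^ (2 * q) + (2 * norm (G x)) ^ (2 * q))"
        using V0 by (intro add_power_le) auto
      finally show "norm (F x) ^ (4 * q)
          \<le> 2 ^ (2 * q) * V x ^ (2 * q) + 2 ^ (2 * q) * 2 ^ (2 * q) * norm (G x) ^ (2 * q)"
        by (simp add: norm_power power_mult_distrib ring_distribs flip: power_mult)
    qed
    also have "\<dots> = 2 ^ (2 * q) * avg (\<lambda>x. V x ^ (2 * q))
        + 2 ^ (2 * q) * 2 ^ (2 * q) * avg (\<lambda>x. norm (G x) ^ (2 * q))"
      by (subst avg_add) (auto intro!: continuous_intros simp: avg_cmult_real)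
    also have "\<dots> \<le> 2 ^ (2 * q) * avg (\<lambda>x. V x ^ (2 * q)) + 2 ^ (2 * q) * 2 ^ (2 * q)
        * (C * (riesz_const q * (4 ^ q * avg (\<lambda>x. norm (F x) ^ (2 * q) * V x ^ q + V x ^ (2 * q)))))"
      by (intro add_left_mono mult_left_mono G) auto
    also have "\<dots> = avg (\<lambda>x. 2 ^ (2 * q) * V x ^ (2 * q)
        + K * (norm (F x) ^ (2 * q) * V x ^ q + V x ^ (2 * q)))"
      by (subst avg_add) (auto intro!: continuous_intros simp: avg_cmult_real K_def)
    \<comment> \<open>The mixed term is split by 2ab \<le> a^2 + b^2 so that only half of the moment
      of F is left over. This half is moved to the left side at the end, which doubles the
      constant.\<close>
    also have "\<dots> \<le> avg (\<lambda>x. (2 ^ (2 * q) + K + K ^ 2 / 2) * V x ^ (2 * q) + 1 / 2 * norm (F x) ^ (4 * q))"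
    proof (intro avg_mono continuous_intros)
      fix x
      have "2 * norm (F x) ^ (2 * q) * (K * V x ^ q) \<le> (norm (F x) ^ (2 * q)) ^ 2 + (K * V x ^ q) ^ 2"
        by (rule sum_squares_bound)
      also have "\<dots> = norm (F x) ^ (4 * q) + K ^ 2 * V x ^ (2 * q)"
        by (simp add: power_mult_distrib mult.commute flip: power_mult)
      finally show "2 ^ (2 * q) * V x ^ (2 * q) + K * (norm (F x) ^ (2 * q) * V x ^ q + V x ^ (2 * q))
          \<le> (2 ^ (2 * q) + K + K ^ 2 / 2) * V x ^ (2 * q) + 1 / 2 * norm (F x) ^ (4 * q)"
        by (simp add: field_simps)
    qed
    also have "\<dots> = (2 ^ (2 * q) + K + K ^ 2 / 2) * avg (\<lambda>x. V x ^ (2 * q))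
        + 1 / 2 * avg (\<lambda>x. norm (F x) ^ (4 * q))"
      by (subst avg_add) (auto intro!: continuous_intros simp: avg_cmult_real avg_cmult_real[of "1/2", simplified])
    finally show ?thesis by (simp add: F_def V_def field_simps)
  qed
  then show ?case
    using K0 by (intro exI[of _ "2 * (2 ^ (2 * q) + K + K ^ 2 / 2)"]) (simp add: q_def mult_ac)
qed

section \<open>Fourier coefficients of continuous functions\<close>

text \<open>Fourier coefficients for the calculus of continuous functions; on continuous members of
  \<open>L1_per\<close> they agree with \<open>fourier_coeff\<close>, see
  \<open>fourier_coeff_eq_fc\<close>.\<close>

definition fc :: "(real \<Rightarrow> complex) \<Rightarrow> int \<Rightarrow> complex" where
  "fc u k = avg (\<lambda>x. u x * character (- k) x)"

lemma avg_cnj_mult_character: "cont u \<Longrightarrow> avg (\<lambda>x. cnj (u x) * character k x) = cnj (fc u k)"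
  using avg_cnj[of "\<lambda>x. u x * character (- k) x"] by (simp add: fc_def cnj_character continuous_intros)

lemma avg_character_mult_cnj: "avg (\<lambda>x. character k x * cnj (character l x)) = (if k = l then 1 else 0)"
  using avg_character[of "k - l"] by (simp add: cnj_character flip: character_add)

lemma fc_sum:
  assumes "finite A"
  shows "fc (\<lambda>x. \<Sum>k\<in>A. c k * character k x) l = (if l \<in> A then c l else 0)"
proof -
  have "fc (\<lambda>x. \<Sum>k\<in>A. c k * character k x) l = avg (\<lambda>x. \<Sum>k\<in>A. c k * (character k x * cnj (character l x)))"
    by (simp add: fc_def cnj_character sum_distrib_right mult.assoc)
  also have "\<dots> = (\<Sum>k\<in>A. avg (\<lambda>x. c k * (character k x * cnj (character l x))))"
    by (intro avg_sum continuous_intros)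
  also have "\<dots> = (\<Sum>k\<in>A. if l = k then c k else 0)"
    by (intro sum.cong refl) (simp add: avg_cmult avg_character_mult_cnj)
  finally show ?thesis using assms by simp
qed

lemma trig_poly_obtain:
  assumes "trig_poly S f" "finite S" obtains c where "f = (\<lambda>x. \<Sum>k\<in>S. c k * character k x)"
proof -
  have "\<exists>c. f = (\<lambda>x. \<Sum>k\<in>S. c k * character k x)"
    using assms
  proof (induction rule: trig_poly.induct)
    case trig_poly_zero
    then show ?case by (intro exI[of _ "\<lambda>k. 0"]) simp
  next
    case (trig_poly_step f l d)
    then obtain c where c: "f = (\<lambda>x. \<Sum>k\<in>S. c k * character k x)" by auto
    have "d * character l x + f x = (\<Sum>k\<in>S. (c k + (if k = l then d else 0)) * character k x)" for x
      using trig_poly_step c by (simp add: ring_distribs sum.distrib if_distrib[of "\<lambda>z. z * _"] cong: if_cong)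
    then show ?case by (intro exI[of _ "\<lambda>k. c k + (if k = l then d else 0)"]) simp
  qed
  then show ?thesis using that by blast
qed

lemma trig_poly_expand:
  assumes "trig_poly S f" "finite S" shows "f x = (\<Sum>k\<in>S. fc f k * character k x)"
proof -
  obtain c where c: "f = (\<lambda>x. \<Sum>k\<in>S. c k * character k x)" using trig_poly_obtain[OF assms] .
  have "fc f k = c k" if "k \<in> S" for k
    unfolding c by (subst fc_sum[OF assms(2)]) (simp add: that)
  then show ?thesis by (subst c) (auto intro!: sum.cong)
qed

lemma fc_trig_poly: "trig_poly S f \<Longrightarrow> k \<notin> S \<Longrightarrow> fc f k = 0"
  unfolding fc_def using trig_poly_mult[of S f "{- k}" "\<lambda>x. character (- k) x" "(\<lambda>l. l - k) ` S"] trig_poly_character[of "- k" "{- k}" 1]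
  by (intro avg_trig_poly[of "(\<lambda>l. l - k) ` S"]) auto

lemma parseval:
  "avg (\<lambda>x. norm (\<Sum>k\<in>A. c k * character k x) ^ 2) = (\<Sum>k\<in>A. norm (c k) ^ 2)"
proof -
  have "avg (\<lambda>x. norm (\<Sum>k\<in>A. c k * character k x) ^ 2) = (\<Sum>k\<in>A. avg (\<lambda>x. norm (c k * character k x) ^ 2))"
  proof (rule avg_norm_sq_orthogonal)
    fix k l :: int assume "k \<noteq> l"
    then have "avg (\<lambda>x. (c k * cnj (c l)) * (character k x * cnj (character l x))) = 0"
      by (simp add: avg_cmult avg_character_mult_cnj)
    then show "avg (\<lambda>x. c k * character k x * cnj (c l * character l x)) = 0" by (simp add: mult_ac)
  qed (intro continuous_intros)
  then show ?thesis by (simp add: norm_mult)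
qed

text \<open>Expand the mean square of u - s, where s is the partial sum over A: the pairing of u
  with s and the mean square of s both equal the left side.\<close>

lemma bessel:
  assumes u: "cont u" shows "(\<Sum>k\<in>A. norm (fc u k) ^ 2) \<le> avg (\<lambda>x. norm (u x) ^ 2)"
proof -
  define s where "s x = (\<Sum>k\<in>A. fc u k * character k x)" for x
  have s: "cont s" unfolding s_def by (intro continuous_intros)
  have "avg (\<lambda>x. cnj (u x) * s x) = avg (\<lambda>x. \<Sum>k\<in>A. fc u k * (cnj (u x) * character k x))"
    by (simp add: s_def sum_distrib_left mult_ac)
  also have "\<dots> = (\<Sum>k\<in>A. avg (\<lambda>x. fc u k * (cnj (u x) * character k x)))"
    by (intro avg_sum continuous_intros u)
  also have "\<dots> = (\<Sum>k\<in>A. of_real (norm (fc u k) ^ 2))"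
    unfolding complex_norm_square by (simp add: avg_cmult avg_cnj_mult_character[OF u])
  finally have us: "avg (\<lambda>x. cnj (u x) * s x) = of_real (\<Sum>k\<in>A. norm (fc u k) ^ 2)" by simp
  have "0 \<le> avg (\<lambda>x. norm (u x - s x) ^ 2)"
    by (intro avg_nonneg continuous_intros u s) auto
  also have "(\<lambda>x. norm (u x - s x) ^ 2)
      = (\<lambda>x. (norm (u x) ^ 2 + norm (s x) ^ 2) - 2 * Re (cnj (u x) * s x))"
    unfolding cmod_power2 by (auto simp: power2_eq_square algebra_simps)
  also have "avg \<dots> = avg (\<lambda>x. norm (u x) ^ 2 + norm (s x) ^ 2) - avg (\<lambda>x. 2 * Re (cnj (u x) * s x))"
    by (intro avg_diff continuous_intros u s)
  also have "\<dots> = avg (\<lambda>x. norm (u x) ^ 2) + avg (\<lambda>x. norm (s x) ^ 2) - 2 * Re (avg (\<lambda>x. cnj (u x) * s x))"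
    unfolding avg_cmult_real
    by (subst avg_add, (intro continuous_intros u s)+, subst avg_Re, (intro continuous_intros u s)+) (rule refl)
  finally show ?thesis unfolding us by (simp add: s_def parseval)
qed

section \<open>Fejer means\<close>

text \<open>The cut at 0 gives every integer a weight, so that means of different orders can be
  written over a common range (\<open>cesaro_extend\<close>). For n = 0, division by zero yields the
  weight 1.\<close>

definition fejer_weight :: "nat \<Rightarrow> int \<Rightarrow> real" where
  "fejer_weight n k = max 0 (1 - \<bar>of_int k\<bar> / real n)"

definition cesaro :: "nat \<Rightarrow> (real \<Rightarrow> complex) \<Rightarrow> real \<Rightarrow> complex" where
  "cesaro n u x = (\<Sum>k = - int n..int n. of_real (fejer_weight n k) * fc u k * character k x)"

text \<open>As the square of a one-sided Dirichlet sum the kernel is visibly nonnegative; the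
  expansion with triangular weights is \<open>fejer_kernel_eq\<close>.\<close>

definition fejer_kernel :: "nat \<Rightarrow> real \<Rightarrow> real" where
  "fejer_kernel n x = norm (\<Sum>j<n. character (int j) x) ^ 2 / n"

lemma fejer_weight_nonneg: "0 \<le> fejer_weight n k" and fejer_weight_le_1: "fejer_weight n k \<le> 1"
  by (simp_all add: fejer_weight_def)

lemma fejer_weight_eq_0: "0 < n \<Longrightarrow> int n \<le> \<bar>k\<bar> \<Longrightarrow> fejer_weight n k = 0"
  by (auto simp: fejer_weight_def le_divide_eq)

lemma fejer_weight_0: "fejer_weight n 0 = 1"
  by (simp add: fejer_weight_def)

lemma fejer_kernel_nonneg: "0 \<le> fejer_kernel n x"
  by (simp add: fejer_kernel_def)

lemma cont_fejer_kernel: "cont f \<Longrightarrow> cont (\<lambda>x. fejer_kernel n (f x))"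
  unfolding fejer_kernel_def by (cases "n = 0") (auto intro!: continuous_intros)

lemma sum_symmetric_Suc:
  "(\<Sum>k = - int (Suc n)..int (Suc n). f k) = (\<Sum>k = - int n..int n. f k) + (f (int n + 1) + f (- int n - 1))"
  for f :: "int \<Rightarrow> 'a::comm_monoid_add"
proof -
  have "{- int (Suc n)..int (Suc n)} = insert (int n + 1) (insert (- int n - 1) {- int n..int n})"
    by auto
  then show ?thesis by (simp add: add_ac)
qed

text \<open>Adjoining the character of frequency n adds to the square its cross terms and 1, which
  together form the full sum over \<bar>k\<bar> \<le> n; each coefficient n - \<bar>k\<bar> thereby
  grows by one.\<close>

lemma norm_dirichlet_sq:
  "of_real (norm (\<Sum>j<n. character (int j) x) ^ 2) = (\<Sum>k = - int n..int n. of_real (real n - \<bar>real_of_int k\<bar>) * character k x)"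
proof (induction n)
  case (Suc n)
  define D where "D = (\<Sum>j<n. character (int j) x)"
  have sym: "1 + (\<Sum>j<m. cnj (character (int j + 1) x)) + (\<Sum>j<m. character (int j + 1) x) = (\<Sum>k = - int m..int m. character k x)" for m
  proof (induction m)
    case (Suc m)
    show ?case unfolding sum_symmetric_Suc Suc[symmetric] by (simp add: cnj_character)
  qed simp
  have sh: "character (int n) x * cnj D = (\<Sum>j<n. character (int j + 1) x)"
  proof -
    have "character (int n) x * cnj D = (\<Sum>j<n. character (int n - int j) x)"
      by (simp add: D_def sum_distrib_left cnj_character flip: character_add)
    also have "\<dots> = (\<Sum>j<n. character (int n - int (n - Suc j)) x)"
      by (rule sum.nat_diff_reindex[symmetric])
    also have "\<dots> = (\<Sum>j<n. character (int j + 1) x)"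
      by (intro sum.cong refl) (simp add: of_nat_diff algebra_simps)
    finally show ?thesis .
  qed
  have "of_real (norm (\<Sum>j<Suc n. character (int j) x) ^ 2) = (D + character (int n) x) * cnj (D + character (int n) x)"
    unfolding complex_norm_square by (simp add: D_def)
  also have "\<dots> = D * cnj D + (1 + cnj (character (int n) x * cnj D) + character (int n) x * cnj D)"
    by (simp add: cnj_character algebra_simps flip: character_add)
  also have "\<dots> = of_real (norm D ^ 2) + (\<Sum>k = - int n..int n. character k x)"
    unfolding sh complex_norm_square sym[symmetric] by (simp only: cnj_sum)
  also have "\<dots> = (\<Sum>k = - int n..int n. of_real (real (Suc n) - \<bar>real_of_int k\<bar>) * character k x)"
    unfolding D_def Suc by (simp add: algebra_simps flip: sum.distrib)
  \<comment> \<open>The two new frequencies n + 1 and - n - 1 have coefficient 0.\<close>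
  also have "\<dots> = (\<Sum>k = - int (Suc n)..int (Suc n). of_real (real (Suc n) - \<bar>real_of_int k\<bar>) * character k x)"
    unfolding sum_symmetric_Suc by simp
  finally show ?case .
qed simp

lemma fejer_kernel_eq:
  assumes "n > 0"
  shows "of_real (fejer_kernel n x) = (\<Sum>k = - int n..int n. of_real (fejer_weight n k) * character k x)"
proof -
  have "complex_of_real (fejer_kernel n x) = of_real (norm (\<Sum>j<n. character (int j) x) ^ 2) / of_nat n"
    by (simp add: fejer_kernel_def)
  also have "\<dots> = (\<Sum>k = - int n..int n. of_real (real n - \<bar>real_of_int k\<bar>) / of_nat n * character k x)"
    unfolding norm_dirichlet_sq by (simp add: sum_divide_distrib)
  also have "\<dots> = (\<Sum>k = - int n..int n. of_real (fejer_weight n k) * character k x)"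
  proof (intro sum.cong refl)
    fix k assume "k \<in> {- int n..int n}"
    then have "\<bar>real_of_int k\<bar> \<le> real n" by auto
    then have "fejer_weight n k = (real n - \<bar>real_of_int k\<bar>) / real n" using assms
      by (simp add: fejer_weight_def diff_divide_distrib)
    then show "of_real (real n - \<bar>real_of_int k\<bar>) / of_nat n * character k x = of_real (fejer_weight n k) * character k x"
      by simp
  qed
  finally show ?thesis .
qed

lemma avg_fejer_kernel:
  assumes n: "n > 0" shows "avg (\<lambda>y. fejer_kernel n (x - y)) = 1"
proof -
  have "complex_of_real (avg (\<lambda>y. fejer_kernel n (x - y))) = avg (\<lambda>y. of_real (fejer_kernel n (x - y)))"
    by (intro avg_of_real[symmetric] cont_fejer_kernel continuous_intros)
  also have "\<dots> = avg (\<lambda>y. \<Sum>k = - int n..int n. (of_real (fejer_weight n k) * character k x) * character (- k) y)"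
    unfolding fejer_kernel_eq[OF n] character_diff_arg by (simp add: mult.assoc)
  also have "\<dots> = (\<Sum>k = - int n..int n. avg (\<lambda>y. (of_real (fejer_weight n k) * character k x) * character (- k) y))"
    by (intro avg_sum continuous_intros)
  also have "\<dots> = (\<Sum>k = - int n..int n. if 0 = k then 1 else 0)"
    unfolding avg_cmult avg_character by (intro sum.cong refl) (auto simp: fejer_weight_0)
  also have "\<dots> = 1" by simp
  finally show ?thesis by simp
qed

lemma cesaro_eq:
  assumes n: "n > 0" and u: "cont u"
  shows "cesaro n u x = avg (\<lambda>y. of_real (fejer_kernel n (x - y)) * u y)"
proof -
  have "avg (\<lambda>y. of_real (fejer_kernel n (x - y)) * u y)
      = avg (\<lambda>y. \<Sum>k = - int n..int n. (of_real (fejer_weight n k) * character k x) * (u y * character (- k) y))"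
    unfolding fejer_kernel_eq[OF n] character_diff_arg by (simp add: sum_distrib_right sum_distrib_left mult_ac)
  also have "\<dots> = (\<Sum>k = - int n..int n. avg (\<lambda>y. (of_real (fejer_weight n k) * character k x) * (u y * character (- k) y)))"
    by (intro avg_sum continuous_intros u)
  finally show ?thesis unfolding avg_cmult by (simp add: cesaro_def fc_def mult_ac)
qed

lemma cont_cesaro: "cont (cesaro n u)"
  unfolding cesaro_def by (intro continuous_intros)

lemma avg_cesaro: "avg (cesaro n u) = avg u"
proof -
  have "avg (cesaro n u) = (\<Sum>k = - int n..int n. avg (\<lambda>x. of_real (fejer_weight n k) * fc u k * character k x))"
    unfolding cesaro_def by (intro avg_sum continuous_intros)
  also have "\<dots> = (\<Sum>k = - int n..int n. if 0 = k then fc u 0 else 0)"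
    unfolding avg_cmult avg_character by (intro sum.cong refl) (auto simp: fejer_weight_0)
  also have "\<dots> = avg u" by (simp add: fc_def)
  finally show ?thesis .
qed

text \<open>Nonnegativity of the variance of v under the probability density w.\<close>

lemma avg_weighted_square_le:
  fixes v w :: "real \<Rightarrow> real"
  assumes w: "cont w" "\<And>y. 0 \<le> w y" "avg w = 1" and v: "cont v"
  shows "avg (\<lambda>y. w y * v y) ^ 2 \<le> avg (\<lambda>y. w y * v y ^ 2)"
proof -
  define t where "t = avg (\<lambda>y. w y * v y)"
  have "0 \<le> avg (\<lambda>y. w y * (v y - t) ^ 2)"
    using w by (intro avg_nonneg continuous_intros v) auto
  also have "\<dots> = avg (\<lambda>y. (w y * v y ^ 2 - (2 * t) * (w y * v y)) + t ^ 2 * w y)"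
    by (simp add: power2_diff algebra_simps)
  also have "\<dots> = avg (\<lambda>y. w y * v y ^ 2 - (2 * t) * (w y * v y)) + avg (\<lambda>y. t ^ 2 * w y)"
    by (intro avg_add continuous_intros w v)
  also have "avg (\<lambda>y. w y * v y ^ 2 - (2 * t) * (w y * v y)) = avg (\<lambda>y. w y * v y ^ 2) - avg (\<lambda>y. (2 * t) * (w y * v y))"
    by (intro avg_diff continuous_intros w v)
  also have "\<dots> + avg (\<lambda>y. t ^ 2 * w y) = avg (\<lambda>y. w y * v y ^ 2) - t ^ 2"
    unfolding avg_cmult_real using w(3) by (simp add: t_def power2_eq_square)
  finally show ?thesis by (simp add: t_def)
qed

text \<open>The commutator is \<open>avg (\<lambda>y. fejer_kernel n (x - y) * (h x - h y) * g y)\<close>; its mean square is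
  bounded by an expression which is diagonal in the Fourier coefficients of \<open>h\<close>.\<close>

lemma cesaro_commutator:
  assumes n: "n > 0" and g: "cont g" "\<And>x. norm (g x) \<le> 1" and h: "trig_poly {- int N..int N} h"
  shows "avg (\<lambda>x. norm (h x * cesaro n g x - cesaro n (\<lambda>y. h y * g y) x) ^ 2)
      \<le> 2 * real N / real n * avg (\<lambda>x. norm (h x) ^ 2)"
proof -
  have hc: "cont h" using h by (rule trig_poly_cont)
  define H2 where "H2 y = complex_of_real (norm (h y) ^ 2)" for y
  have H2c: "cont H2" unfolding H2_def by (intro continuous_intros hc)
  \<comment> \<open>This is the mean over y of \<open>fejer_kernel n (x - y)\<close> times the
    square of norm (h x - h y), expanded: its terms involve the Fejer means of 1, of h and of the
    squared norm of h.\<close>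
  define B where "B x = (norm (h x) ^ 2 - 2 * Re (cnj (h x) * cesaro n h x)) + Re (cesaro n H2 x)" for x
  note ci = continuous_intros hc g(1) cont_fejer_kernel H2c cont_cesaro
  have pw: "norm (h x * cesaro n g x - cesaro n (\<lambda>y. h y * g y) x) ^ 2 \<le> B x" for x
  proof -
    let ?w = "\<lambda>y. fejer_kernel n (x - y)"
    have "h x * cesaro n g x - cesaro n (\<lambda>y. h y * g y) x
        = avg (\<lambda>y. h x * (of_real (?w y) * g y)) - avg (\<lambda>y. of_real (?w y) * (h y * g y))"
      using n by (simp add: cesaro_eq avg_cmult g hc continuous_intros)
    also have "\<dots> = avg (\<lambda>y. h x * (of_real (?w y) * g y) - of_real (?w y) * (h y * g y))"
      by (intro avg_diff[symmetric] ci)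
    also have "\<dots> = avg (\<lambda>y. of_real (?w y) * ((h x - h y) * g y))"
      by (simp add: algebra_simps)
    also have "norm \<dots> \<le> avg (\<lambda>y. norm (of_real (?w y) * ((h x - h y) * g y)))"
      by (intro norm_avg_le ci)
    also have "\<dots> \<le> avg (\<lambda>y. ?w y * norm (h x - h y))"
    proof (intro avg_mono ci)
      fix y
      have "norm (h x - h y) * norm (g y) \<le> norm (h x - h y) * 1"
        by (intro mult_left_mono g) auto
      then show "norm (of_real (?w y) * ((h x - h y) * g y)) \<le> ?w y * norm (h x - h y)"
        by (simp add: norm_mult fejer_kernel_nonneg mult_left_mono)
    qed
    finally have "norm (h x * cesaro n g x - cesaro n (\<lambda>y. h y * g y) x) ^ 2
        \<le> avg (\<lambda>y. ?w y * norm (h x - h y)) ^ 2"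
      by (intro power_mono) auto
    also have "\<dots> \<le> avg (\<lambda>y. ?w y * norm (h x - h y) ^ 2)"
      using avg_fejer_kernel[OF n] fejer_kernel_nonneg by (intro avg_weighted_square_le ci) auto
    also have "\<dots> = avg (\<lambda>y. Re (of_real (norm (h x) ^ 2) * of_real (?w y)
        - 2 * (cnj (h x) * (of_real (?w y) * h y)) + of_real (?w y) * H2 y))"
    proof -
      have "norm (h x - h y) ^ 2 = norm (h x) ^ 2 - 2 * Re (cnj (h x) * h y) + norm (h y) ^ 2" for y
        unfolding cmod_power2 by (simp add: power2_eq_square algebra_simps)
      then have "?w y * norm (h x - h y) ^ 2 = Re (of_real (norm (h x) ^ 2) * of_real (?w y)
          - 2 * (cnj (h x) * (of_real (?w y) * h y)) + of_real (?w y) * H2 y)" for y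
        by (simp only:) (simp add: H2_def algebra_simps)
      then show ?thesis by simp
    qed
    also have "\<dots> = Re (avg (\<lambda>y. of_real (norm (h x) ^ 2) * of_real (?w y)
        - 2 * (cnj (h x) * (of_real (?w y) * h y)) + of_real (?w y) * H2 y))"
      by (intro avg_Re ci)
    also have "avg (\<lambda>y. of_real (norm (h x) ^ 2) * of_real (?w y)
        - 2 * (cnj (h x) * (of_real (?w y) * h y)) + of_real (?w y) * H2 y)
        = avg (\<lambda>y. of_real (norm (h x) ^ 2) * of_real (?w y) - 2 * (cnj (h x) * (of_real (?w y) * h y)))
          + avg (\<lambda>y. of_real (?w y) * H2 y)"
      by (intro avg_add ci)
    also have "avg (\<lambda>y. of_real (norm (h x) ^ 2) * of_real (?w y) - 2 * (cnj (h x) * (of_real (?w y) * h y)))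
        = avg (\<lambda>y. of_real (norm (h x) ^ 2) * of_real (?w y)) - avg (\<lambda>y. 2 * (cnj (h x) * (of_real (?w y) * h y)))"
      by (intro avg_diff ci)
    also have "\<dots> = of_real (norm (h x) ^ 2) * of_real (avg ?w) - 2 * (cnj (h x) * avg (\<lambda>y. (of_real (?w y) * h y)))"
      unfolding avg_cmult by (subst avg_of_real) (auto intro!: ci)
    finally show ?thesis
      using n by (simp add: B_def cesaro_eq[OF n] hc H2c avg_fejer_kernel)
  qed
  have diag: "avg (\<lambda>x. cnj (h x) * cesaro n h x) = of_real (\<Sum>k = - int n..int n. fejer_weight n k * norm (fc h k) ^ 2)"
  proof -
    have "avg (\<lambda>x. cnj (h x) * cesaro n h x)
        = avg (\<lambda>x. \<Sum>k = - int n..int n. of_real (fejer_weight n k) * fc h k * (cnj (h x) * character k x))"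
      by (simp add: cesaro_def sum_distrib_left mult_ac)
    also have "\<dots> = (\<Sum>k = - int n..int n. avg (\<lambda>x. of_real (fejer_weight n k) * fc h k * (cnj (h x) * character k x)))"
      by (intro avg_sum ci)
    also have "\<dots> = (\<Sum>k = - int n..int n. of_real (fejer_weight n k) * of_real (norm (fc h k) ^ 2))"
      unfolding avg_cmult avg_cnj_mult_character[OF hc] complex_norm_square by (simp add: mult_ac)
    finally show ?thesis by simp
  qed
  have pars: "avg (\<lambda>x. norm (h x) ^ 2) = (\<Sum>k = - int N..int N. norm (fc h k) ^ 2)"
    unfolding parseval[symmetric] using trig_poly_expand[OF h] by simp
  have "avg (\<lambda>x. norm (h x * cesaro n g x - cesaro n (\<lambda>y. h y * g y) x) ^ 2) \<le> avg B"
    unfolding B_def[abs_def] using pw by (intro avg_mono ci) (auto simp: B_def)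
  also have "avg B = avg (\<lambda>x. norm (h x) ^ 2 - 2 * Re (cnj (h x) * cesaro n h x)) + avg (\<lambda>x. Re (cesaro n H2 x))"
    unfolding B_def by (intro avg_add ci)
  also have "avg (\<lambda>x. norm (h x) ^ 2 - 2 * Re (cnj (h x) * cesaro n h x))
      = avg (\<lambda>x. norm (h x) ^ 2) - avg (\<lambda>x. 2 * Re (cnj (h x) * cesaro n h x))"
    by (intro avg_diff ci)
  also have "avg (\<lambda>x. 2 * Re (cnj (h x) * cesaro n h x)) = 2 * Re (avg (\<lambda>x. cnj (h x) * cesaro n h x))"
    unfolding avg_cmult_real by (subst avg_Re) (auto intro!: ci)
  also have "avg (\<lambda>x. Re (cesaro n H2 x)) = avg (\<lambda>x. norm (h x) ^ 2)"
  proof -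
    have "avg (\<lambda>x. Re (cesaro n H2 x)) = Re (avg H2)"
      by (subst avg_Re) (auto intro: ci simp: avg_cesaro)
    also have "avg H2 = of_real (avg (\<lambda>x. norm (h x) ^ 2))"
      unfolding H2_def by (intro avg_of_real ci)
    finally show ?thesis by simp
  qed
  also have "avg (\<lambda>x. norm (h x) ^ 2) - 2 * Re (avg (\<lambda>x. cnj (h x) * cesaro n h x)) + avg (\<lambda>x. norm (h x) ^ 2)
      = 2 * ((\<Sum>k = - int N..int N. norm (fc h k) ^ 2) - (\<Sum>k = - int n..int n. fejer_weight n k * norm (fc h k) ^ 2))"
    unfolding diag pars by simp
  \<comment> \<open>Frequencies with \<bar>k\<bar> \<ge> n have weight 0 and all terms are
    nonnegative, so the range may be changed to that of h whichever of n and N is larger.\<close>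
  also have "\<dots> \<le> 2 * ((\<Sum>k = - int N..int N. norm (fc h k) ^ 2) - (\<Sum>k = - int N..int N. fejer_weight n k * norm (fc h k) ^ 2))"
  proof -
    have "(\<Sum>k = - int N..int N. fejer_weight n k * norm (fc h k) ^ 2)
        = (\<Sum>k \<in> {- int N..int N} \<inter> {- int n..int n}. fejer_weight n k * norm (fc h k) ^ 2)"
      by (rule sum.mono_neutral_right) (use n in \<open>auto intro!: fejer_weight_eq_0\<close>)
    also have "\<dots> \<le> (\<Sum>k = - int n..int n. fejer_weight n k * norm (fc h k) ^ 2)"
      by (rule sum_mono2) (auto simp: fejer_weight_nonneg)
    finally show ?thesis by simp
  qed
  also have "2 * ((\<Sum>k = - int N..int N. norm (fc h k) ^ 2) - (\<Sum>k = - int N..int N. fejer_weight n k * norm (fc h k) ^ 2))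
      = (\<Sum>k = - int N..int N. 2 * (1 - fejer_weight n k) * norm (fc h k) ^ 2)"
    by (simp add: sum_distrib_left algebra_simps flip: sum_subtractf)
  \<comment> \<open>The gain of the estimate: the defect 1 - \<open>fejer_weight n k\<close> is at
    most \<bar>k\<bar> / n, hence at most N / n on the spectrum of h.\<close>
  also have "\<dots> \<le> (\<Sum>k = - int N..int N. 2 * real N / real n * norm (fc h k) ^ 2)"
  proof (intro sum_mono mult_right_mono)
    fix k assume "k \<in> {- int N..int N}"
    then have "\<bar>real_of_int k\<bar> \<le> real N" by auto
    then have "\<bar>real_of_int k\<bar> / n \<le> real N / n" by (rule divide_right_mono) simp
    moreover have "1 - fejer_weight n k \<le> \<bar>real_of_int k\<bar> / n" by (simp add: fejer_weight_def)
    ultimately show "2 * (1 - fejer_weight n k) \<le> 2 * real N / real n" by simp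
  qed simp
  also have "\<dots> = 2 * real N / real n * avg (\<lambda>x. norm (h x) ^ 2)"
    unfolding pars by (simp add: sum_distrib_left)
  finally show ?thesis by simp
qed

section \<open>A smooth Littlewood--Paley inequality for bounded functions\<close>

text \<open>In t = \<bar>k\<bar> / 2^j this is a trapezoid: it rises as t on [0,1], equals 1 on
  [1,2], falls to 0 on [2,4] and vanishes beyond. The plateau covers a dyadic block, and as a
  combination of three Fejer weights it is accessible to \<open>cesaro_commutator\<close>.\<close>

definition lp_mult :: "nat \<Rightarrow> int \<Rightarrow> real" where
  "lp_mult j k = 2 * fejer_weight (2 ^ (j + 2)) k - fejer_weight (2 ^ (j + 1)) k - fejer_weight (2 ^ j) k"

definition lp_piece :: "nat \<Rightarrow> (real \<Rightarrow> complex) \<Rightarrow> real \<Rightarrow> complex" where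
  "lp_piece j u x = (\<Sum>k = - (2 ^ (j + 2))..2 ^ (j + 2). of_real (lp_mult j k) * fc u k * character k x)"

lemma cesaro_extend:
  assumes "0 < n" "int n \<le> N"
  shows "cesaro n u x = (\<Sum>k = - N..N. of_real (fejer_weight n k) * fc u k * character k x)"
  unfolding cesaro_def using assms by (intro sum.mono_neutral_left) (auto simp: fejer_weight_eq_0)

lemma lp_piece_eq:
  "lp_piece j u x = 2 * cesaro (2 ^ (j + 2)) u x - cesaro (2 ^ (j + 1)) u x - cesaro (2 ^ j) u x"
proof -
  have "(2::int) ^ j \<le> 2 ^ (j + 2)" "(2::int) ^ (j + 1) \<le> 2 ^ (j + 2)"
    by (intro power_increasing; simp)+
  then show ?thesis
    by (simp only: cesaro_extend[where N = "2 ^ (j + 2)"] zero_less_power zero_less_numeral of_nat_power of_nat_numeral order_refl)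
      (simp add: lp_piece_def lp_mult_def ring_distribs sum.distrib sum_subtractf sum_distrib_left mult_ac)
qed

lemma cont_lp_piece: "cont (lp_piece j u)"
  unfolding lp_piece_def by (intro continuous_intros)

lemma trig_poly_lp_piece: "trig_poly {- int (2 ^ (j + 2))..int (2 ^ (j + 2))} (lp_piece j u)"
  unfolding lp_piece_def by (intro trig_poly_sum trig_poly_character) auto

lemma fejer_weight_double_mono: "fejer_weight n k \<le> fejer_weight (2 * n) k"
proof -
  have "\<bar>real_of_int k\<bar> / real (2 * n) \<le> \<bar>real_of_int k\<bar> / real n"
    by (cases "n = 0") (auto intro!: divide_left_mono)
  then show ?thesis by (simp add: fejer_weight_def)
qed

lemma lp_mult_nonneg: "0 \<le> lp_mult j k"
  using fejer_weight_double_mono[of "2 ^ j" k] fejer_weight_double_mono[of "2 ^ (j + 1)" k]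
  by (simp add: lp_mult_def)

lemma lp_mult_le_1: "lp_mult j k \<le> 1"
proof -
  define t where "t = \<bar>real_of_int k\<bar> / 2 ^ (j + 2)"
  have "2 * t = \<bar>real_of_int k\<bar> / 2 ^ (j + 1)" by (simp add: t_def)
  then have f: "fejer_weight (2 ^ (j + 2)) k = max 0 (1 - t)" "fejer_weight (2 ^ (j + 1)) k = max 0 (1 - 2 * t)"
    by (simp_all add: fejer_weight_def t_def)
  have "0 \<le> t" by (simp add: t_def)
  then show ?thesis
    unfolding lp_mult_def f using fejer_weight_nonneg[of "2 ^ j" k] by (auto simp: max_def)
qed

lemma lp_mult_eq_1:
  assumes "2 ^ j \<le> k" "k \<le> 2 ^ (j + 1)" shows "lp_mult j k = 1"
proof -
  have "real_of_int (2 ^ j) \<le> real_of_int k" "real_of_int k \<le> real_of_int (2 ^ (j + 1))"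
    using assms by (simp_all only: of_int_le_iff)
  then have k: "2 ^ j \<le> real_of_int k" "real_of_int k \<le> 2 * 2 ^ j" by simp_all
  define t where "t = \<bar>real_of_int k\<bar> / 2 ^ j"
  have "0 \<le> real_of_int k" using k(1) order_trans[of 0 "2 ^ j" "real_of_int k"] by simp
  with k have t: "1 \<le> t" "t \<le> 2" by (simp_all add: t_def divide_le_eq le_divide_eq)
  have f: "fejer_weight (2 ^ (j + 2)) k = max 0 (1 - t / 4)" "fejer_weight (2 ^ (j + 1)) k = max 0 (1 - t / 2)"
    "fejer_weight (2 ^ j) k = max 0 (1 - t)"
    by (simp_all add: fejer_weight_def t_def mult.commute)
  show ?thesis unfolding lp_mult_def f using t by (auto simp: max_def)
qed

text \<open>With w(i) the Fejer weight of order 2^i, each term is 2 (w(j+2) - w(j+1)) + (w(j+1) -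
  w(j)); the sum telescopes to at most 2 + 1.\<close>

lemma sum_lp_mult_le: "(\<Sum>j<m. lp_mult j k) \<le> 3"
proof -
  have "(\<Sum>j<m. lp_mult j k)
      = 2 * fejer_weight (2 ^ (m + 1)) k - 2 * fejer_weight 2 k + fejer_weight (2 ^ m) k - fejer_weight 1 k"
    by (induction m) (simp_all add: lp_mult_def)
  then show ?thesis
    using fejer_weight_le_1[of "2 ^ (m + 1)" k] fejer_weight_le_1[of "2 ^ m" k] fejer_weight_nonneg[of 2 k] fejer_weight_nonneg[of 1 k]
    by linarith
qed

text \<open>Parseval turns the left side into a sum of squared multipliers. Having values in [0,1],
  they may lose the square; then the overlap bound 3 and Bessel's inequality apply.\<close>

lemma sum_avg_lp_piece_le:
  assumes u: "cont u"
  shows "(\<Sum>j<m. avg (\<lambda>x. norm (lp_piece j u x) ^ 2)) \<le> 3 * avg (\<lambda>x. norm (u x) ^ 2)"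
proof -
  define N :: int where "N = 2 ^ (m + 2)"
  have "(\<Sum>j<m. avg (\<lambda>x. norm (lp_piece j u x) ^ 2)) \<le> (\<Sum>j<m. \<Sum>k = - N..N. lp_mult j k * norm (fc u k) ^ 2)"
  proof (rule sum_mono)
    fix j assume "j \<in> {..<m}"
    then have le: "(2::int) ^ (j + 2) \<le> N" unfolding N_def by (intro power_increasing) auto
    have "avg (\<lambda>x. norm (lp_piece j u x) ^ 2)
        = (\<Sum>k = - (2 ^ (j + 2))..2 ^ (j + 2). lp_mult j k ^ 2 * norm (fc u k) ^ 2)"
      unfolding lp_piece_def parseval by (simp add: norm_mult power_mult_distrib)
    also have "\<dots> \<le> (\<Sum>k = - (2 ^ (j + 2))..2 ^ (j + 2). lp_mult j k * norm (fc u k) ^ 2)"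
      using mult_left_le[OF lp_mult_le_1 lp_mult_nonneg]
      by (intro sum_mono mult_right_mono) (auto simp: power2_eq_square)
    also have "\<dots> \<le> (\<Sum>k = - N..N. lp_mult j k * norm (fc u k) ^ 2)"
      using le by (intro sum_mono2) (auto simp: lp_mult_nonneg)
    finally show "avg (\<lambda>x. norm (lp_piece j u x) ^ 2) \<le> (\<Sum>k = - N..N. lp_mult j k * norm (fc u k) ^ 2)" .
  qed
  also have "\<dots> = (\<Sum>k = - N..N. (\<Sum>j<m. lp_mult j k) * norm (fc u k) ^ 2)"
    by (subst sum.swap) (simp add: sum_distrib_right)
  also have "\<dots> \<le> (\<Sum>k = - N..N. 3 * norm (fc u k) ^ 2)"
    by (intro sum_mono mult_right_mono sum_lp_mult_le) auto
  also have "\<dots> \<le> 3 * avg (\<lambda>x. norm (u x) ^ 2)"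
    using bessel[OF u, of "{- N..N}"] by (simp flip: sum_distrib_left)
  finally show ?thesis .
qed

lemma norm_sum4_sq_le:
  fixes a b c d :: complex
  shows "norm (a + 2 * b - c - d) ^ 2 \<le> 4 * norm a ^ 2 + 16 * norm b ^ 2 + 4 * norm c ^ 2 + 4 * norm d ^ 2"
proof -
  have sq: "(p + q) ^ 2 \<le> 2 * p ^ 2 + 2 * q ^ 2" for p q :: real
    using sum_squares_bound[of p q] by (simp add: power2_sum)
  have "norm (a + 2 * b - c - d) \<le> norm (a + 2 * b) + norm (c + d)"
    using norm_triangle_ineq4[of "a + 2 * b" "c + d"] by (simp add: algebra_simps)
  also have "\<dots> \<le> (norm a + 2 * norm b) + (norm c + norm d)"
    using norm_triangle_ineq[of a "2 * b"] norm_triangle_ineq[of c d] by (simp add: norm_mult)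
  finally have "norm (a + 2 * b - c - d) ^ 2 \<le> ((norm a + 2 * norm b) + (norm c + norm d)) ^ 2"
    by (intro power_mono) auto
  also have "\<dots> \<le> 2 * (norm a + 2 * norm b) ^ 2 + 2 * (norm c + norm d) ^ 2" by (rule sq)
  also have "\<dots> \<le> 2 * (2 * norm a ^ 2 + 2 * (2 * norm b) ^ 2) + 2 * (2 * norm c ^ 2 + 2 * norm d ^ 2)"
    by (intro add_mono mult_left_mono sq) auto
  finally show ?thesis by (simp add: power_mult_distrib)
qed

lemma sum_geometric_tail: "k \<le> m \<Longrightarrow> (\<Sum>j=k..<m. 1 / 2 ^ j) = 2 / 2 ^ k - 2 / (2 ^ m :: real)"
  by (induction m rule: dec_induct) simp_all

text \<open>A Carleson type estimate: up to a commutator with geometrically decaying mean square,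
  \<open>h * lp_piece j g\<close> is \<open>lp_piece j (h * g)\<close>.\<close>

lemma sum_avg_mult_lp_piece_le:
  fixes c :: nat
  assumes g: "cont g" "\<And>x. norm (g x) \<le> 1" and h: "trig_poly {- int N..int N} h" and N: "N \<le> c * 2 ^ k"
  shows "(\<Sum>j=k..<m. avg (\<lambda>x. norm (h x * lp_piece j g x) ^ 2)) \<le> (12 + 96 * real c) * avg (\<lambda>x. norm (h x) ^ 2)"
proof (cases "k \<le> m")
  case True
  have hc: "cont h" using h by (rule trig_poly_cont)
  note ci = continuous_intros hc g(1) cont_lp_piece cont_cesaro
  define H where "H = avg (\<lambda>x. norm (h x) ^ 2)"
  have H0: "0 \<le> H" unfolding H_def by (intro avg_nonneg ci) auto
  define hg where "hg x = h x * g x" for x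
  define E where "E n x = h x * cesaro n g x - cesaro n hg x" for n x
  have Ec: "cont (E n)" for n unfolding E_def by (intro ci)
  define R where "R j = real N * H * (1 / 2 ^ j)" for j :: nat
  have E: "avg (\<lambda>x. norm (E n x) ^ 2) \<le> 2 * R j" if "2 ^ j \<le> n" for n j
  proof -
    have n: "0 < n" using that by (metis less_le_trans zero_less_numeral zero_less_power)
    have "(2::real) ^ j \<le> real n" using that by (metis of_nat_le_iff of_nat_numeral of_nat_power)
    have "avg (\<lambda>x. norm (E n x) ^ 2) \<le> 2 * real N / real n * H"
      using cesaro_commutator[OF n g h] by (simp add: E_def hg_def[abs_def] H_def)
    also have "\<dots> \<le> 2 * real N / 2 ^ j * H"
      using \<open>2 ^ j \<le> real n\<close> n by (intro mult_right_mono divide_left_mono H0) auto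
    finally show ?thesis by (simp add: R_def mult_ac)
  qed
  \<comment> \<open>Three commutators enter, with the weights 16, 4 and 4 of
    \<open>norm_sum4_sq_le\<close>; each has mean square at most 2 * R j, which makes 48 * R
    j.\<close>
  have one: "avg (\<lambda>x. norm (h x * lp_piece j g x) ^ 2)
      \<le> 4 * avg (\<lambda>x. norm (lp_piece j hg x) ^ 2) + 48 * R j" for j
  proof -
    have "h x * lp_piece j g x = lp_piece j hg x + 2 * E (2 ^ (j + 2)) x - E (2 ^ (j + 1)) x - E (2 ^ j) x" for x
      by (simp add: lp_piece_eq E_def algebra_simps)
    then have "avg (\<lambda>x. norm (h x * lp_piece j g x) ^ 2)
        \<le> avg (\<lambda>x. 4 * norm (lp_piece j hg x) ^ 2 + 16 * norm (E (2 ^ (j + 2)) x) ^ 2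
            + 4 * norm (E (2 ^ (j + 1)) x) ^ 2 + 4 * norm (E (2 ^ j) x) ^ 2)"
      using norm_sum4_sq_le by (intro avg_mono ci Ec) auto
    also have "\<dots> = avg (\<lambda>x. 4 * norm (lp_piece j hg x) ^ 2 + 16 * norm (E (2 ^ (j + 2)) x) ^ 2
            + 4 * norm (E (2 ^ (j + 1)) x) ^ 2) + avg (\<lambda>x. 4 * norm (E (2 ^ j) x) ^ 2)"
      by (intro avg_add ci Ec)
    also have "avg (\<lambda>x. 4 * norm (lp_piece j hg x) ^ 2 + 16 * norm (E (2 ^ (j + 2)) x) ^ 2
            + 4 * norm (E (2 ^ (j + 1)) x) ^ 2) = avg (\<lambda>x. 4 * norm (lp_piece j hg x) ^ 2 + 16 * norm (E (2 ^ (j + 2)) x) ^ 2)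
            + avg (\<lambda>x. 4 * norm (E (2 ^ (j + 1)) x) ^ 2)"
      by (intro avg_add ci Ec)
    also have "avg (\<lambda>x. 4 * norm (lp_piece j hg x) ^ 2 + 16 * norm (E (2 ^ (j + 2)) x) ^ 2)
      = avg (\<lambda>x. 4 * norm (lp_piece j hg x) ^ 2) + avg (\<lambda>x. 16 * norm (E (2 ^ (j + 2)) x) ^ 2)"
      by (intro avg_add ci Ec)
    finally show ?thesis
      using E[of j "2 ^ (j + 2)"] E[of j "2 ^ (j + 1)"] E[of j "2 ^ j"]
      unfolding avg_cmult_real by simp
  qed
  have "(\<Sum>j=k..<m. avg (\<lambda>x. norm (h x * lp_piece j g x) ^ 2))
      \<le> (\<Sum>j=k..<m. 4 * avg (\<lambda>x. norm (lp_piece j hg x) ^ 2) + 48 * R j)"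
    by (intro sum_mono one)
  also have "\<dots> = 4 * (\<Sum>j=k..<m. avg (\<lambda>x. norm (lp_piece j hg x) ^ 2)) + 48 * real N * H * (\<Sum>j=k..<m. 1 / 2 ^ j)"
    by (simp add: R_def sum.distrib sum_distrib_left mult.assoc)
  also have "(\<Sum>j=k..<m. avg (\<lambda>x. norm (lp_piece j hg x) ^ 2)) \<le> (\<Sum>j<m. avg (\<lambda>x. norm (lp_piece j hg x) ^ 2))"
    by (intro sum_mono2) (auto intro!: avg_nonneg ci)
  also have "\<dots> \<le> 3 * avg (\<lambda>x. norm (hg x) ^ 2)"
    unfolding hg_def by (intro sum_avg_lp_piece_le ci)
  also have "avg (\<lambda>x. norm (hg x) ^ 2) \<le> H"
    unfolding H_def hg_def
  proof (intro avg_mono ci)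
    fix x show "norm (h x * g x) ^ 2 \<le> norm (h x) ^ 2"
      using mult_left_mono[OF g(2)[of x], of "norm (h x)"] by (intro power_mono) (auto simp: norm_mult)
  qed
  \<comment> \<open>The growth N \<le> c 2^k is compensated by the geometric tail 2 / 2^k; this is
    why only the indices j \<ge> k are summed.\<close>
  also have "48 * real N * H * (\<Sum>j=k..<m. 1 / 2 ^ j) \<le> 48 * (real c * 2 ^ k) * H * (2 / 2 ^ k)"
  proof (intro mult_mono)
    show "real N \<le> real c * 2 ^ k"
      using of_nat_mono[OF N, where ?'a = real] by simp
    show "(\<Sum>j=k..<m. 1 / 2 ^ j) \<le> 2 / (2 ^ k :: real)" by (simp add: sum_geometric_tail[OF True])
  qed (auto simp: H0 sum_nonneg)
  also have "\<dots> = 96 * real c * H" by simp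
  finally show ?thesis by (simp add: H_def algebra_simps)
qed (use h[THEN trig_poly_cont] in \<open>auto intro!: mult_nonneg_nonneg avg_nonneg continuous_intros\<close>)

section \<open>Even moments of the square function\<close>

lemma power_Suc_diff_le:
  fixes a b :: real
  assumes "0 \<le> b" "b \<le> a" shows "a ^ Suc p \<le> b ^ Suc p + real (Suc p) * (a - b) * a ^ p"
proof (induction p)
  case (Suc p)
  have "a ^ Suc (Suc p) \<le> a * (b ^ Suc p + real (Suc p) * (a - b) * a ^ p)"
    using mult_left_mono[OF Suc, of a] assms by simp
  also have "\<dots> = b ^ Suc (Suc p) + ((a - b) * b ^ Suc p + real (Suc p) * (a - b) * a ^ Suc p)"
    by (simp add: algebra_simps)
  also have "(a - b) * b ^ Suc p \<le> (a - b) * a ^ Suc p"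
    using assms by (intro mult_left_mono power_mono) auto
  finally show ?case by (simp add: algebra_simps)
qed simp

text \<open>A discrete form of T^(p+1) = (p+1) \<integral> T^p dT, telescoped over the tails. The
  order matters: the factor singled out has the smallest index j, and only indices i \<ge> j remain
  under the power.\<close>

lemma tail_power_le:
  fixes W :: "nat \<Rightarrow> real"
  assumes W: "\<And>j. 0 \<le> W j"
  shows "(\<Sum>j=k..<m. W j) ^ Suc p \<le> real (Suc p) * (\<Sum>j=k..<m. W j * (\<Sum>i=j..<m. W i) ^ p)"
proof (cases "k \<le> m")
  case True
  then show ?thesis
  proof (induction k rule: inc_induct)
    case (step k)
    define T where "T k = (\<Sum>j=k..<m. W j)" for k
    have T: "T k = W k + T (Suc k)" unfolding T_def using step by (simp add: sum.atLeast_Suc_lessThan)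
    have "T k ^ Suc p \<le> T (Suc k) ^ Suc p + real (Suc p) * (T k - T (Suc k)) * T k ^ p"
      by (rule power_Suc_diff_le) (auto simp: T W, simp add: T_def sum_nonneg W)
    also have "\<dots> \<le> real (Suc p) * (\<Sum>j=Suc k..<m. W j * T j ^ p) + real (Suc p) * (T k - T (Suc k)) * T k ^ p"
      using step by (simp add: T_def)
    also have "\<dots> = real (Suc p) * (W k * T k ^ p + (\<Sum>j=Suc k..<m. W j * T j ^ p))"
      by (simp add: T ring_distribs mult_ac)
    also have "W k * T k ^ p + (\<Sum>j=Suc k..<m. W j * T j ^ p) = (\<Sum>j=k..<m. W j * T j ^ p)"
      using step by (simp add: sum.atLeast_Suc_lessThan)
    finally show ?case by (simp add: T_def)
  qed simp
qed simp

text \<open>The argument c measures the degree of the test polynomial in units of 2^k.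
  Multiplication by \<open>lp_piece j g\<close> adds degree 2^(j+2) = 4 * 2^j, whence c + 4; the
  factor 12 + 96 c is the one of \<open>sum_avg_mult_lp_piece_le\<close>.\<close>

fun lp_const :: "nat \<Rightarrow> nat \<Rightarrow> real" where
  "lp_const 0 c = 1"
| "lp_const (Suc p) c = real (Suc p) * (lp_const p (c + 4) * (12 + 96 * real c))"

lemma lp_const_nonneg: "0 \<le> lp_const p c"
  by (induction p c rule: lp_const.induct) auto

text \<open>The weight h carries the induction on p. By \<open>tail_power_le\<close> the factor of
  lowest index j is absorbed into a new test polynomial, the product of h and
  \<open>lp_piece j g\<close>, while the remaining tail starts at the same j. The induction
  hypothesis thus applies with k := j, and summation over j is the Carleson type estimate.\<close>

lemma lp_square_function_aux:
  assumes g: "cont g" "\<And>x. norm (g x) \<le> 1"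
  shows "trig_poly {- int N..int N} h \<Longrightarrow> N \<le> c * 2 ^ k \<Longrightarrow>
    avg (\<lambda>x. norm (h x) ^ 2 * (\<Sum>j=k..<m. norm (lp_piece j g x) ^ 2) ^ p) \<le> lp_const p c * avg (\<lambda>x. norm (h x) ^ 2)"
proof (induction p arbitrary: c k N h)
  case (Suc p)
  have hc: "cont h" using Suc.prems(1) by (rule trig_poly_cont)
  note ci = continuous_intros hc g(1) cont_lp_piece
  define W where "W j x = norm (lp_piece j g x) ^ 2" for j x
  have Wc: "cont (W j)" for j unfolding W_def by (intro ci)
  have "avg (\<lambda>x. norm (h x) ^ 2 * (\<Sum>j=k..<m. W j x) ^ Suc p)
      \<le> avg (\<lambda>x. \<Sum>j=k..<m. real (Suc p) * (norm (h x * lp_piece j g x) ^ 2 * (\<Sum>i=j..<m. W i x) ^ p))"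
  proof (intro avg_mono ci Wc)
    fix x
    have "norm (h x) ^ 2 * (\<Sum>j=k..<m. W j x) ^ Suc p
        \<le> norm (h x) ^ 2 * (real (Suc p) * (\<Sum>j=k..<m. W j x * (\<Sum>i=j..<m. W i x) ^ p))"
      by (intro mult_left_mono tail_power_le) (auto simp: W_def)
    also have "\<dots> = (\<Sum>j=k..<m. real (Suc p) * (norm (h x * lp_piece j g x) ^ 2 * (\<Sum>i=j..<m. W i x) ^ p))"
      by (simp add: W_def sum_distrib_left norm_mult power_mult_distrib mult_ac)
    finally show "norm (h x) ^ 2 * (\<Sum>j=k..<m. W j x) ^ Suc p \<le> \<dots>" .
  qed
  also have "\<dots> = (\<Sum>j=k..<m. real (Suc p) * avg (\<lambda>x. norm (h x * lp_piece j g x) ^ 2 * (\<Sum>i=j..<m. W i x) ^ p))"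
    unfolding avg_cmult_real[symmetric] by (intro avg_sum ci Wc)
  also have "\<dots> \<le> (\<Sum>j=k..<m. real (Suc p) * (lp_const p (c + 4) * avg (\<lambda>x. norm (h x * lp_piece j g x) ^ 2)))"
  proof (intro sum_mono mult_left_mono)
    fix j assume j: "j \<in> {k..<m}"
    have "c * 2 ^ k \<le> c * 2 ^ j" using j by (intro mult_left_mono power_increasing) auto
    with Suc.prems(2) have "N \<le> c * 2 ^ j" by (rule order_trans)
    then have N: "N + 2 ^ (j + 2) \<le> (c + 4) * 2 ^ j" by (simp add: add_mult_distrib)
    show "avg (\<lambda>x. norm (h x * lp_piece j g x) ^ 2 * (\<Sum>i=j..<m. W i x) ^ p)
        \<le> lp_const p (c + 4) * avg (\<lambda>x. norm (h x * lp_piece j g x) ^ 2)"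
      unfolding W_def
      by (rule Suc.IH[OF _ N], rule trig_poly_mult[OF Suc.prems(1) trig_poly_lp_piece]) auto
  qed auto
  also have "\<dots> = real (Suc p) * (lp_const p (c + 4) * (\<Sum>j=k..<m. avg (\<lambda>x. norm (h x * lp_piece j g x) ^ 2)))"
    by (simp add: sum_distrib_left)
  also have "\<dots> \<le> real (Suc p) * (lp_const p (c + 4) * ((12 + 96 * real c) * avg (\<lambda>x. norm (h x) ^ 2)))"
    using sum_avg_mult_lp_piece_le[OF g Suc.prems] by (intro mult_left_mono lp_const_nonneg) auto
  finally show ?case by (simp add: W_def mult.assoc)
qed simp

lemma lp_square_function:
  assumes "cont g" "\<And>x. norm (g x) \<le> 1"
  shows "avg (\<lambda>x. (\<Sum>j<m. norm (lp_piece j g x) ^ 2) ^ p) \<le> lp_const p 0"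
  using lp_square_function_aux[OF assms trig_poly_const[of _ 1], of 0 0 0 m p]
  by (simp add: lessThan_atLeast0)

section \<open>Multipliers of bounded dyadic variation\<close>

lemma abel_summation:
  fixes \<mu> :: "nat \<Rightarrow> complex"
  assumes "a \<le> e"
  shows "(\<Sum>k=a..e. \<mu> k * c k) = \<mu> e * (\<Sum>l=a..e. c l) - (\<Sum>k=a..<e. (\<mu> (k + 1) - \<mu> k) * (\<Sum>l=a..k. c l))"
  using assms by (induction e rule: dec_induct) (simp_all add: algebra_simps)

lemma norm_weighted_sum_sq_le:
  fixes s :: "'i \<Rightarrow> complex"
  shows "norm (\<Sum>k\<in>I. of_real (v k) * s k) ^ 2 \<le> (\<Sum>k\<in>I. \<bar>v k\<bar>) * (\<Sum>k\<in>I. \<bar>v k\<bar> * norm (s k) ^ 2)"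
proof -
  have "norm (\<Sum>k\<in>I. of_real (v k) * s k) \<le> (\<Sum>k\<in>I. \<bar>sqrt \<bar>v k\<bar>\<bar> * \<bar>sqrt \<bar>v k\<bar> * norm (s k)\<bar>)"
    by (rule sum_norm_le) (simp add: norm_mult abs_mult flip: mult.assoc)
  also have "\<dots> \<le> L2_set (\<lambda>k. sqrt \<bar>v k\<bar>) I * L2_set (\<lambda>k. sqrt \<bar>v k\<bar> * norm (s k)) I"
    by (rule L2_set_mult_ineq)
  finally have "norm (\<Sum>k\<in>I. of_real (v k) * s k) ^ 2
      \<le> (L2_set (\<lambda>k. sqrt \<bar>v k\<bar>) I * L2_set (\<lambda>k. sqrt \<bar>v k\<bar> * norm (s k)) I) ^ 2"
    by (intro power_mono) auto
  then show ?thesis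
    by (simp add: L2_set_def power_mult_distrib sum_nonneg)
qed

lemma sum_int_atLeastAtMost: "(\<Sum>l=a..k. f (int l)) = (\<Sum>l=int a..int k. f l)"
  unfolding image_int_atLeastAtMost[symmetric] by (subst sum.reindex) (auto intro: inj_onI)

text \<open>Half-open ranges make consecutive blocks partition the positive frequencies. Negative
  frequencies are recovered by conjugation in \<open>psi_class_fejer_mean_le\<close>.\<close>

definition dyadic_block :: "(nat \<Rightarrow> real) \<Rightarrow> (real \<Rightarrow> complex) \<Rightarrow> nat \<Rightarrow> real \<Rightarrow> complex" where
  "dyadic_block \<mu> g j x = (\<Sum>k=2^j..<2^(j+1). of_real (\<mu> k) * fc g (int k) * character (int k) x)"

lemma trig_poly_dyadic_block: "trig_poly {2 ^ j..2 ^ (j + 1)} (dyadic_block \<mu> g j)"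
  unfolding dyadic_block_def
proof (intro trig_poly_sum trig_poly_character)
  fix k :: nat assume "k \<in> {2 ^ j..<2 ^ (j + 1)}"
  then have "int (2 ^ j) \<le> int k" "int k \<le> int (2 ^ (j + 1))" by (simp_all only: of_nat_le_iff) auto
  then show "int k \<in> {2 ^ j..2 ^ (j + 1)}" by simp
qed

text \<open>Abel summation writes a block as a combination of the partial sums S j k with
  coefficients of total size at most 2 A. By Cauchy-Schwarz it suffices to bound the square function
  of all S j k, weighted by \<bar>v j k\<bar>. Each S j k is the band [2^j, k] of
  \<open>lp_piece j g\<close>, so \<open>riesz_band\<close> restores the whole piece, and summing
  the weights over k costs a second factor 2 A.\<close>

lemma dyadic_block_square_function:
  assumes g: "cont g" "\<And>x. norm (g x) \<le> 1"
    and A: "\<And>k. k \<ge> 1 \<Longrightarrow> \<bar>\<mu> k\<bar> \<le> A" "\<And>j. (\<Sum>k=2^j..<2^(j+1) - 1. \<bar>\<mu> (k + 1) - \<mu> k\<bar>) \<le> A"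
  shows "avg (\<lambda>x. (\<Sum>j<m. norm (dyadic_block \<mu> g j x) ^ 2) ^ q) \<le> riesz_const q ^ 2 * lp_const q 0 * (2 * A) ^ (2 * q)"
proof -
  define e :: "nat \<Rightarrow> nat" where "e j = 2 ^ (j + 1) - 1" for j
  have e: "2 ^ j \<le> e j" "e j < 2 ^ (j + 1)" "Suc (e j) = 2 ^ (j + 1)" for j
    using one_le_power[of "2::nat" j] by (auto simp: e_def)
  \<comment> \<open>Coefficients of the Abel summation: the value at the last index
    \<open>e j\<close> of the block, and the negated jumps before it. The jump into the next block
    does not occur.\<close>
  define v where "v j k = (if k = e j then \<mu> (e j) else - (\<mu> (k + 1) - \<mu> k))" for j k
  define S where "S j k x = (\<Sum>l=2^j..int k. fc g l * character l x)" for j k x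
  have A0: "0 \<le> A" using A(1)[of 1] by simp
  have vA: "(\<Sum>k=2^j..e j. \<bar>v j k\<bar>) \<le> 2 * A" for j
  proof -
    have "(\<Sum>k=2^j..e j. \<bar>v j k\<bar>) = (\<Sum>k=2^j..<e j. \<bar>v j k\<bar>) + \<bar>v j (e j)\<bar>"
      using e(1)[of j] by (simp add: sum.last_plus add.commute)
    also have "(\<Sum>k=2^j..<e j. \<bar>v j k\<bar>) = (\<Sum>k=2^j..<2^(j+1) - 1. \<bar>\<mu> (k + 1) - \<mu> k\<bar>)"
      unfolding e_def[symmetric] by (intro sum.cong refl) (auto simp: v_def)
    also have "\<dots> \<le> A" by (rule A(2))
    also have "\<bar>v j (e j)\<bar> \<le> A"
      using A(1)[of "e j"] order_trans[OF one_le_power e(1)[of j]] by (simp add: v_def)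
    finally show ?thesis by simp
  qed
  have block: "dyadic_block \<mu> g j x = (\<Sum>k=2^j..e j. of_real (v j k) * S j k x)" for j x
  proof -
    have S: "(\<Sum>l=2^j..k. fc g (int l) * character (int l) x) = S j k x" for k
      unfolding S_def using sum_int_atLeastAtMost[of "\<lambda>l. fc g l * character l x" "2 ^ j" k] by simp
    have "dyadic_block \<mu> g j x = (\<Sum>k=2^j..e j. of_real (\<mu> k) * (fc g (int k) * character (int k) x))"
      unfolding dyadic_block_def e(3)[symmetric] atLeastLessThanSuc_atLeastAtMost by (simp add: mult.assoc)
    also have "\<dots> = of_real (\<mu> (e j)) * S j (e j) x - (\<Sum>k=2^j..<e j. (of_real (\<mu> (k + 1)) - of_real (\<mu> k)) * S j k x)"
      by (subst abel_summation[OF e(1)]) (simp add: S)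
    also have "(\<Sum>k=2^j..<e j. (of_real (\<mu> (k + 1)) - of_real (\<mu> k)) * S j k x)
        = - (\<Sum>k=2^j..<e j. of_real (v j k) * S j k x)"
      unfolding sum_negf[symmetric] by (intro sum.cong refl) (auto simp: v_def algebra_simps)
    finally show ?thesis
      using e(1)[of j] by (simp add: sum.last_plus v_def)
  qed
  define I where "I = (SIGMA j:{..<m}. {2 ^ j..e j})"
  \<comment> \<open>The square root makes the weight a scalar factor of the functions, so that
    weighted sums of squares become the plain ones of \<open>riesz_band\<close>.\<close>
  define w where "w i = sqrt \<bar>v (fst i) (snd i)\<bar>" for i
  have sumI: "(\<Sum>j<m. \<Sum>k=2^j..e j. f j k) = (\<Sum>i\<in>I. f (fst i) (snd i))" for f :: "nat \<Rightarrow> nat \<Rightarrow> real"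
    unfolding I_def by (subst sum.Sigma) (auto simp: split_def)
  have Sc: "cont (S j k)" for j k unfolding S_def by (intro continuous_intros)
  have bc: "cont (dyadic_block \<mu> g j)" for j unfolding dyadic_block_def by (intro continuous_intros)
  note ci = continuous_intros g(1) cont_lp_piece Sc bc
  define lo where "lo i x = of_real (w i) * (\<Sum>l = - (2 ^ (fst i + 2))..<2 ^ fst i. of_real (lp_mult (fst i) l) * fc g l * character l x)" for i x
  define hi where "hi i x = of_real (w i) * (\<Sum>l = int (snd i) + 1..2 ^ (fst i + 2). of_real (lp_mult (fst i) l) * fc g l * character l x)" for i :: "nat \<times> nat" and x
  define mid where "mid i x = of_real (w i) * S (fst i) (snd i) x" for i x
  have split: "lo i x + mid i x + hi i x = of_real (w i) * lp_piece (fst i) g x" if "i \<in> I" for i x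
  proof -
    obtain j k where i: "i = (j, k)" by (cases i)
    have k: "2 ^ j \<le> k" "k < 2 ^ (j + 1)" using that e(2)[of j] by (auto simp: I_def i)
    then have k': "2 ^ j \<le> int k" "int k < 2 ^ (j + 1)"
      by (metis of_nat_le_iff of_nat_numeral of_nat_power) (metis k(2) of_nat_less_iff of_nat_numeral of_nat_power)
    define P Q :: int where "P = 2 ^ j" and "Q = 2 ^ (j + 2)"
    have PQ: "0 \<le> P" "P \<le> int k" "int k \<le> Q" using k' by (simp_all add: P_def Q_def)
    then have sets: "{- Q..Q} = ({- Q..<P} \<union> {P..int k}) \<union> {int k + 1..Q}" by auto
    let ?t = "\<lambda>l. of_real (lp_mult j l) * fc g l * character l x"
    have "sum ?t {- Q..Q} = sum ?t ({- Q..<P} \<union> {P..int k}) + sum ?t {int k + 1..Q}"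
      unfolding sets using PQ by (intro sum.union_disjoint) auto
    also have "sum ?t ({- Q..<P} \<union> {P..int k}) = sum ?t {- Q..<P} + sum ?t {P..int k}"
      by (intro sum.union_disjoint) auto
    finally have "lp_piece j g x = (\<Sum>l = - (2 ^ (j + 2))..<2 ^ j. of_real (lp_mult j l) * fc g l * character l x)
       + (\<Sum>l = 2 ^ j..int k. of_real (lp_mult j l) * fc g l * character l x)
       + (\<Sum>l = int k + 1..2 ^ (j + 2). of_real (lp_mult j l) * fc g l * character l x)"
      unfolding lp_piece_def P_def Q_def .
    \<comment> \<open>The plateau of \<open>lp_mult j\<close> contains [2^j, k], so this middle part
      is an exact partial sum of the Fourier series of g.\<close>
    also have "(\<Sum>l = 2 ^ j..int k. of_real (lp_mult j l) * fc g l * character l x) = S j k x"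
      unfolding S_def using k' by (intro sum.cong refl) (subst lp_mult_eq_1, auto)
    finally show ?thesis by (simp add: lo_def mid_def hi_def i ring_distribs)
  qed
  have "avg (\<lambda>x. (\<Sum>j<m. norm (dyadic_block \<mu> g j x) ^ 2) ^ q)
      \<le> avg (\<lambda>x. (2 * A) ^ q * (\<Sum>i\<in>I. norm (mid i x) ^ 2) ^ q)"
    unfolding mid_def
  proof (intro avg_mono ci)
    fix x
    have "(\<Sum>j<m. norm (dyadic_block \<mu> g j x) ^ 2) \<le> (\<Sum>j<m. 2 * A * (\<Sum>k=2^j..e j. \<bar>v j k\<bar> * norm (S j k x) ^ 2))"
      unfolding block
    proof (rule sum_mono)
      fix j
      show "norm (\<Sum>k=2^j..e j. of_real (v j k) * S j k x) ^ 2 \<le> 2 * A * (\<Sum>k=2^j..e j. \<bar>v j k\<bar> * norm (S j k x) ^ 2)"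
        by (rule order_trans[OF norm_weighted_sum_sq_le]) (intro mult_right_mono vA sum_nonneg, auto)
    qed
    also have "\<dots> = 2 * A * (\<Sum>j<m. \<Sum>k=2^j..e j. \<bar>v j k\<bar> * norm (S j k x) ^ 2)"
      by (simp add: sum_distrib_left)
    also have "\<dots> = 2 * A * (\<Sum>i\<in>I. norm (of_real (w i) * S (fst i) (snd i) x) ^ 2)"
      unfolding sumI by (simp add: w_def norm_mult power_mult_distrib)
    finally show "(\<Sum>j<m. norm (dyadic_block \<mu> g j x) ^ 2) ^ q
        \<le> (2 * A) ^ q * (\<Sum>i\<in>I. norm (of_real (w i) * S (fst i) (snd i) x) ^ 2) ^ q"
      unfolding power_mult_distrib[symmetric] by (intro power_mono sum_nonneg) auto
  qed
  also have "\<dots> = (2 * A) ^ q * avg (\<lambda>x. (\<Sum>i\<in>I. norm (mid i x) ^ 2) ^ q)"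
    by (rule avg_cmult_real)
  also have "avg (\<lambda>x. (\<Sum>i\<in>I. norm (mid i x) ^ 2) ^ q)
      \<le> riesz_const q ^ 2 * avg (\<lambda>x. (\<Sum>i\<in>I. norm (lo i x + mid i x + hi i x) ^ 2) ^ q)"
  proof (rule riesz_band[where a = "\<lambda>i. 2 ^ fst i" and b = "\<lambda>i. int (snd i)"])
    fix i assume i: "i \<in> I"
    show "trig_poly {..<2 ^ fst i} (lo i)" unfolding lo_def by (intro trig_poly_cmult trig_poly_sum trig_poly_character) auto
    show "trig_poly {2 ^ fst i..int (snd i)} (mid i)" unfolding mid_def S_def by (intro trig_poly_cmult trig_poly_sum trig_poly_character) auto
    show "trig_poly {int (snd i)<..} (hi i)" unfolding hi_def by (intro trig_poly_cmult trig_poly_sum trig_poly_character) auto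
    have "2 ^ fst i \<le> snd i" using i by (auto simp: I_def)
    then show "2 ^ fst i \<le> int (snd i)" by (metis of_nat_le_iff of_nat_numeral of_nat_power)
  qed
  also have "avg (\<lambda>x. (\<Sum>i\<in>I. norm (lo i x + mid i x + hi i x) ^ 2) ^ q)
      = avg (\<lambda>x. (\<Sum>i\<in>I. norm (of_real (w i) * lp_piece (fst i) g x) ^ 2) ^ q)"
    using split by (simp cong: sum.cong)
  also have "\<dots> \<le> avg (\<lambda>x. (2 * A) ^ q * (\<Sum>j<m. norm (lp_piece j g x) ^ 2) ^ q)"
  proof (intro avg_mono ci)
    fix x
    have "(\<Sum>i\<in>I. norm (of_real (w i) * lp_piece (fst i) g x) ^ 2)
        = (\<Sum>j<m. \<Sum>k=2^j..e j. \<bar>v j k\<bar> * norm (lp_piece j g x) ^ 2)"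
      unfolding sumI by (simp add: w_def norm_mult power_mult_distrib)
    also have "\<dots> = (\<Sum>j<m. (\<Sum>k=2^j..e j. \<bar>v j k\<bar>) * norm (lp_piece j g x) ^ 2)"
      by (simp add: sum_distrib_right)
    also have "\<dots> \<le> (\<Sum>j<m. 2 * A * norm (lp_piece j g x) ^ 2)"
      by (intro sum_mono mult_right_mono vA) auto
    finally show "(\<Sum>i\<in>I. norm (of_real (w i) * lp_piece (fst i) g x) ^ 2) ^ q
        \<le> (2 * A) ^ q * (\<Sum>j<m. norm (lp_piece j g x) ^ 2) ^ q"
      unfolding power_mult_distrib[symmetric] sum_distrib_left by (intro power_mono sum_nonneg) auto
  qed
  also have "\<dots> \<le> (2 * A) ^ q * lp_const q 0"
    unfolding avg_cmult_real using A0 by (intro mult_left_mono lp_square_function g) auto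
  finally have "avg (\<lambda>x. (\<Sum>j<m. norm (dyadic_block \<mu> g j x) ^ 2) ^ q)
      \<le> (2 * A) ^ q * (riesz_const q ^ 2 * ((2 * A) ^ q * lp_const q 0))"
    using A0 by (simp add: mult_left_mono)
  moreover have "(2 * A) ^ (2 * q) = (2 * A) ^ q * (2 * A) ^ q" by (simp only: mult_2 power_add)
  ultimately show ?thesis
    using A0 by (simp add: mult_left_mono mult_ac)
qed

section \<open>Assembly of the dyadic blocks by residue classes\<close>

lemma power_sum_le:
  fixes f :: "nat \<Rightarrow> real"
  assumes "0 < n" "\<And>i. 0 \<le> f i" shows "(\<Sum>i<L. f i) ^ n \<le> real L ^ n * (\<Sum>i<L. f i ^ n)"
proof (cases "L = 0")
  case True
  then show ?thesis using assms(1) by (simp add: power_0_left)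
next
  case False
  define M where "M = Max (f ` {..<L})"
  have "M \<in> f ` {..<L}" unfolding M_def using False by (intro Max_in) auto
  then obtain i0 where i0: "i0 < L" "M = f i0" by auto
  have "(\<Sum>i<L. f i) \<le> (\<Sum>i<L. M)" unfolding M_def by (intro sum_mono Max_ge) auto
  then have "(\<Sum>i<L. f i) ^ n \<le> (real L * M) ^ n" using assms by (intro power_mono sum_nonneg) auto
  also have "\<dots> = real L ^ n * f i0 ^ n" by (simp add: i0 power_mult_distrib)
  also have "\<dots> \<le> real L ^ n * (\<Sum>i<L. f i ^ n)"
    using i0 assms by (intro mult_left_mono member_le_sum) auto
  finally show ?thesis .
qed

lemma sum_residue_classes:
  "(\<Sum>j<m * L. f j) = (\<Sum>\<rho><L. \<Sum>J<m. f (J * L + \<rho>))" for f :: "nat \<Rightarrow> 'a::comm_monoid_add"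
proof -
  have "sum f {J * L..<J * L + L} = (\<Sum>\<rho><L. f (J * L + \<rho>))" for J
    using sum.shift_bounds_nat_ivl[of f 0 "J * L" L] by (simp add: lessThan_atLeast0 add.commute)
  then have "(\<Sum>j<m * L. f j) = (\<Sum>J<m. \<Sum>\<rho><L. f (J * L + \<rho>))"
    by (simp flip: sum.nat_group)
  then show ?thesis by (simp add: sum.swap[of _ "{..<L}"])
qed

lemma sum_dyadic_blocks:
  "(\<Sum>j<m. dyadic_block \<mu> g j x) = (\<Sum>k=1..<2^m. of_real (\<mu> k) * fc g (int k) * character (int k) x)"
proof (induction m)
  case (Suc m)
  have "(\<Sum>k=1..<2^m. of_real (\<mu> k) * fc g (int k) * character (int k) x) + dyadic_block \<mu> g m x
      = (\<Sum>k=1..<2^(m+1). of_real (\<mu> k) * fc g (int k) * character (int k) x)"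
    unfolding dyadic_block_def by (rule sum.atLeastLessThan_concat) auto
  then show ?case using Suc by simp
qed simp

text \<open>To apply \<open>lacunary_upper\<close>, the dyadic blocks are sorted according to their residues
  modulo \<open>r + 2\<close>.\<close>

lemma dyadic_variation_multiplier:
  "\<exists>C\<ge>0. \<forall>\<mu> A g m. cont g \<longrightarrow> (\<forall>x. norm (g x) \<le> 1) \<longrightarrow> (\<forall>k\<ge>1. \<bar>\<mu> k\<bar> \<le> A) \<longrightarrow>
     (\<forall>j. (\<Sum>k=2^j..<2^(j+1) - 1. \<bar>\<mu> (k + 1) - \<mu> k\<bar>) \<le> A) \<longrightarrow>
     avg (\<lambda>x. norm (\<Sum>k=1..<2^(m * (r + 2)). of_real (\<mu> k) * fc g (int k) * character (int k) x) ^ (2 * 2 ^ r))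
       \<le> C * A ^ (2 * 2 ^ r)"
proof -
  define q L :: nat where "q = 2 ^ r" and "L = r + 2"
  obtain C where C: "C \<ge> 0" and lac: "\<And>d a b m.
     (\<forall>J. 0 \<le> a J \<and> a J \<le> b J \<and> trig_poly {a J..b J} (d J)) \<Longrightarrow> (\<forall>J. \<forall>I<J. 2 ^ r * b I < a J) \<Longrightarrow>
     avg (\<lambda>x. norm (\<Sum>J<m. d J x) ^ (2 * q))
       \<le> C * avg (\<lambda>x. (\<Sum>J<m::nat. norm (d J x) ^ 2) ^ q)"
    unfolding q_def using lacunary_upper[of r] by blast
  define C' where "C' = real L ^ (2 * q) * (real L * (C * (riesz_const q ^ 2 * lp_const q 0 * 2 ^ (2 * q))))"
  have "avg (\<lambda>x. norm (\<Sum>k=1..<2^(m * L). of_real (\<mu> k) * fc g (int k) * character (int k) x) ^ (2 * q)) \<le> C' * A ^ (2 * q)"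
    if g: "cont g" "\<And>x. norm (g x) \<le> 1" and A: "\<forall>k\<ge>1. \<bar>\<mu> k\<bar> \<le> A"
      "\<forall>j. (\<Sum>k=2^j..<2^(j+1) - 1. \<bar>\<mu> (k + 1) - \<mu> k\<bar>) \<le> A"
    for \<mu> A g m
  proof -
    define d where "d = dyadic_block \<mu> g"
    have dc: "cont (d j)" for j unfolding d_def using trig_poly_dyadic_block by (rule trig_poly_cont)
    note ci = continuous_intros dc
    have cls: "avg (\<lambda>x. norm (\<Sum>J<m. d (J * L + \<rho>) x) ^ (2 * q)) \<le> C * (riesz_const q ^ 2 * lp_const q 0 * (2 * A) ^ (2 * q))"
      if \<rho>: "\<rho> < L" for \<rho>
    proof -
      have "avg (\<lambda>x. norm (\<Sum>J<m. d (J * L + \<rho>) x) ^ (2 * q))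
          \<le> C * avg (\<lambda>x. (\<Sum>J<m. norm (d (J * L + \<rho>) x) ^ 2) ^ q)"
      proof (rule lac[where a = "\<lambda>J. 2 ^ (J * L + \<rho>)" and b = "\<lambda>J. 2 ^ (J * L + \<rho> + 1)"])
        show "\<forall>J. (0::int) \<le> 2 ^ (J * L + \<rho>) \<and> (2::int) ^ (J * L + \<rho>) \<le> 2 ^ (J * L + \<rho> + 1)
            \<and> trig_poly {2 ^ (J * L + \<rho>)..2 ^ (J * L + \<rho> + 1)} (d (J * L + \<rho>))"
          unfolding d_def using trig_poly_dyadic_block by auto
        show "\<forall>J. \<forall>I<J. (2::int) ^ r * 2 ^ (I * L + \<rho> + 1) < 2 ^ (J * L + \<rho>)"
        proof (intro allI impI)
          fix I J :: nat assume "I < J"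
          then have "Suc I * L \<le> J * L" by (intro mult_right_mono) auto
          \<comment> \<open>This requires r + 1 < L, and L = r + 2 is the least such
            modulus.\<close>
          then have "r + (I * L + \<rho> + 1) < J * L + \<rho>" by (simp add: L_def)
          then have "(2::int) ^ (r + (I * L + \<rho> + 1)) < 2 ^ (J * L + \<rho>)" by (intro power_strict_increasing) auto
          then show "(2::int) ^ r * 2 ^ (I * L + \<rho> + 1) < 2 ^ (J * L + \<rho>)" by (simp only: power_add)
        qed
      qed
      also have "avg (\<lambda>x. (\<Sum>J<m. norm (d (J * L + \<rho>) x) ^ 2) ^ q) \<le> avg (\<lambda>x. (\<Sum>j<m * L. norm (d j x) ^ 2) ^ q)"
      proof (intro avg_mono ci)
        fix x
        have "(\<Sum>J<m. norm (d (J * L + \<rho>) x) ^ 2) \<le> (\<Sum>\<rho><L. \<Sum>J<m. norm (d (J * L + \<rho>) x) ^ 2)"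
          using \<rho> by (intro member_le_sum[of \<rho>]) (auto intro!: sum_nonneg)
        then show "(\<Sum>J<m. norm (d (J * L + \<rho>) x) ^ 2) ^ q \<le> (\<Sum>j<m * L. norm (d j x) ^ 2) ^ q"
          unfolding sum_residue_classes by (intro power_mono sum_nonneg) auto
      qed
      also have "\<dots> \<le> riesz_const q ^ 2 * lp_const q 0 * (2 * A) ^ (2 * q)"
        unfolding d_def using A by (intro dyadic_block_square_function g) auto
      finally show ?thesis using C by (simp add: mult_left_mono)
    qed
    have "avg (\<lambda>x. norm (\<Sum>k=1..<2^(m * L). of_real (\<mu> k) * fc g (int k) * character (int k) x) ^ (2 * q))
        \<le> avg (\<lambda>x. real L ^ (2 * q) * (\<Sum>\<rho><L. norm (\<Sum>J<m. d (J * L + \<rho>) x) ^ (2 * q)))"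
    proof (intro avg_mono ci)
      fix x
      have "(\<Sum>k=1..<2^(m * L). of_real (\<mu> k) * fc g (int k) * character (int k) x) = (\<Sum>\<rho><L. \<Sum>J<m. d (J * L + \<rho>) x)"
        unfolding sum_dyadic_blocks[symmetric] d_def by (rule sum_residue_classes)
      also have "norm \<dots> ^ (2 * q) \<le> (\<Sum>\<rho><L. norm (\<Sum>J<m. d (J * L + \<rho>) x)) ^ (2 * q)"
        by (intro power_mono norm_sum) auto
      also have "\<dots> \<le> real L ^ (2 * q) * (\<Sum>\<rho><L. norm (\<Sum>J<m. d (J * L + \<rho>) x) ^ (2 * q))"
        by (intro power_sum_le) (auto simp: q_def)
      finally show "norm (\<Sum>k=1..<2^(m * L). of_real (\<mu> k) * fc g (int k) * character (int k) x) ^ (2 * q) \<le> \<dots>" .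
    qed
    also have "\<dots> = real L ^ (2 * q) * (\<Sum>\<rho><L. avg (\<lambda>x. norm (\<Sum>J<m. d (J * L + \<rho>) x) ^ (2 * q)))"
      unfolding avg_cmult_real by (subst avg_sum) (auto intro!: ci)
    also have "\<dots> \<le> real L ^ (2 * q) * (\<Sum>\<rho><L. C * (riesz_const q ^ 2 * lp_const q 0 * (2 * A) ^ (2 * q)))"
      by (intro mult_left_mono sum_mono cls) auto
    also have "\<dots> = C' * A ^ (2 * q)"
      by (simp add: C'_def power_mult_distrib mult_ac)
    finally show ?thesis .
  qed
  moreover have "C' \<ge> 0" using C by (simp add: C'_def lp_const_nonneg)
  ultimately show ?thesis by (intro exI[of _ C']) (simp add: q_def L_def)
qed

section \<open>Approximation of bounded functions by trigonometric polynomials\<close>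

text \<open>The closed interval gives direct access to compactness and to the gauge integral behind
  \<open>avg\<close>; the added endpoint is a null set.\<close>

abbreviation circ :: "real measure" where
  "circ \<equiv> lebesgue_on {0..2 * pi}"

lemma finite_measure_circ: "finite_measure circ"
  by (rule finite_measure_lebesgue_on) simp

lemma cont_borel_circ: "cont u \<Longrightarrow> u \<in> borel_measurable circ"
  by (intro continuous_imp_measurable_on_sets_lebesgue) (auto intro: continuous_on_subset)

lemma cont_bounded:
  fixes u :: "real \<Rightarrow> 'a::real_normed_vector"
  assumes "cont u" obtains B where "\<And>x. x \<in> {0..2 * pi} \<Longrightarrow> norm (u x) \<le> B"
proof -
  have "compact (u ` {0..2 * pi})"
    by (intro compact_continuous_image continuous_on_subset[OF assms]) auto
  then have "bounded (u ` {0..2 * pi})" by (rule compact_imp_bounded)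
  then show ?thesis using that unfolding bounded_iff by blast
qed

lemma cont_integrable_circ:
  fixes u :: "real \<Rightarrow> 'a::euclidean_space"
  assumes "cont u" shows "integrable circ u"
proof -
  obtain B where "\<And>x. x \<in> {0..2 * pi} \<Longrightarrow> norm (u x) \<le> B" using cont_bounded[OF assms] by blast
  then show ?thesis
    using cont_borel_circ[OF assms]
    by (intro finite_measure.integrable_const_bound[OF finite_measure_circ, of _ B]) (auto intro!: AE_I2)
qed

lemma integral_circ_eq_avg:
  fixes u :: "real \<Rightarrow> 'a::euclidean_space"
  assumes "cont u" shows "integral\<^sup>L circ u = (2 * pi) *\<^sub>R avg u"
  using lebesgue_integral_eq_integral[OF cont_integrable_circ[OF assms]] by (simp add: avg_def)

lemma AE_circ:
  assumes "negligible N" "\<And>x. x \<in> {0..2 * pi} \<Longrightarrow> x \<notin> N \<Longrightarrow> P x" shows "AE x in circ. P x"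
proof -
  have "N \<in> null_sets lebesgue" using assms(1) by (simp add: negligible_iff_null_sets)
  then have "AE x in lebesgue. x \<notin> N" by (rule AE_not_in)
  then have "AE x in lebesgue. x \<in> {0..2 * pi} \<longrightarrow> P x" by eventually_elim (use assms(2) in auto)
  then show ?thesis by (subst AE_restrict_space_iff) auto
qed

lemma trig_poly_finite: "trig_poly UNIV f \<Longrightarrow> \<exists>N. trig_poly {- int N..int N} f"
proof (induction rule: trig_poly.induct)
  case (trig_poly_step f k c)
  then obtain N where "trig_poly {- int N..int N} f" by auto
  then have "trig_poly {- int (max N (nat \<bar>k\<bar>))..int (max N (nat \<bar>k\<bar>))} (\<lambda>x. c * character k x + f x)"
    by (intro trig_poly.trig_poly_step trig_poly_mono[OF \<open>trig_poly {- int N..int N} f\<close>]) auto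
  then show ?case by blast
qed (auto intro: trig_poly_zero)

lemma trig_poly_power: "trig_poly UNIV f \<Longrightarrow> trig_poly UNIV (\<lambda>x. f x ^ p)"
  by (induction p) (auto intro!: trig_poly_mult[of UNIV _ UNIV] trig_poly_const)

lemma character_cos: "complex_of_real (cos (real k * x)) = (1 / 2) * character (int k) x + (1 / 2) * character (- int k) x"
  and character_sin: "complex_of_real (sin (real k * x)) = (- \<i> / 2) * character (int k) x + (\<i> / 2) * character (- int k) x"
  by (auto simp: character_def complex_eq_iff)

lemma trig_poly_real_polynomial_cis:
  "real_polynomial_function p \<Longrightarrow> trig_poly UNIV (\<lambda>x. of_real (p (cis x)))"
proof (induction rule: real_polynomial_function.induct)
  case (linear f)
  have "cis x = cos x *\<^sub>R 1 + sin x *\<^sub>R \<i>" for x by (simp add: complex_eq_iff)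
  then have f: "f (cis x) = cos x * f 1 + sin x * f \<i>" for x
    using linear by (simp add: linear_simps)
  have "(\<lambda>x. complex_of_real (f (cis x)))
      = (\<lambda>x. of_real (f 1) * ((1 / 2) * character 1 x + (1 / 2) * character (- 1) x)
          + of_real (f \<i>) * ((- \<i> / 2) * character 1 x + (\<i> / 2) * character (- 1) x))"
    using character_cos[of 1] character_sin[of 1] by (simp add: f mult.commute)
  then show ?case by (simp only:) (intro trig_poly_add trig_poly_cmult trig_poly_character; simp)
next
  case (mult f g)
  then show ?case by (simp add: trig_poly_mult[of UNIV _ UNIV])
qed (simp_all add: trig_poly_const trig_poly_add)

text \<open>G is transported to the unit circle by \<open>Arg2pi\<close> and approximated there by
  Stone-Weierstrass. The branch cut is harmless because the end values of G agree: preimages of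
  closed sets are images under \<open>cis\<close> of compact subsets of the interval, so the
  transported function is continuous.\<close>

lemma trig_poly_uniform_approx:
  fixes G :: "real \<Rightarrow> real"
  assumes G: "continuous_on {0..2 * pi} G" and per: "G 0 = G (2 * pi)" and e: "e > 0"
  obtains T :: "real \<Rightarrow> real" where "trig_poly UNIV (\<lambda>x. of_real (T x))" "\<And>x. x \<in> {0..2 * pi} \<Longrightarrow> \<bar>G x - T x\<bar> < e"
proof -
  define \<psi> where "\<psi> z = G (Arg2pi z)" for z
  have \<psi>: "\<psi> (cis x) = G x" if "x \<in> {0..2 * pi}" for x
  proof (cases "x = 2 * pi")
    case True
    then show ?thesis using per Arg2pi_of_real[of 1] by (simp add: \<psi>_def)
  next
    case False
    then have "Arg2pi (cis x) = x" using that by (intro Arg2pi_unique[of 1]) (auto simp: cis_conv_exp)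
    then show ?thesis by (simp add: \<psi>_def)
  qed
  have sph: "\<exists>x\<in>{0..2 * pi}. z = cis x" if "z \<in> sphere 0 1" for z
    using that complex_norm_eq_1_exp[of z] Arg2pi_ge_0[of z] Arg2pi_lt_2pi[of z] Arg2pi_eq[of z]
    by (intro bexI[of _ "Arg2pi z"]) (auto simp: cis_conv_exp dist_norm)
  have "continuous_on (sphere 0 1) \<psi>"
  proof (subst continuous_on_closed_vimage, simp, intro allI impI)
    fix B :: "real set" assume "closed B"
    then have "closed ({0..2 * pi} \<inter> G -` B)"
      using G by (intro continuous_closed_preimage) auto
    then have "compact ({0..2 * pi} \<inter> G -` B)"
      using compact_Int_closed[of "{0..2 * pi}" "{0..2 * pi} \<inter> G -` B"] by (simp add: Int_absorb1)
    then have "compact (cis ` ({0..2 * pi} \<inter> G -` B))"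
      by (intro compact_continuous_image continuous_intros)
    moreover have "\<psi> -` B \<inter> sphere 0 1 = cis ` ({0..2 * pi} \<inter> G -` B)"
      using sph \<psi> by (force simp: dist_norm)
    ultimately show "closed (\<psi> -` B \<inter> sphere 0 1)" by (simp add: compact_imp_closed)
  qed
  then obtain g where g: "real_polynomial_function g" "\<And>z. z \<in> sphere 0 1 \<Longrightarrow> \<bar>\<psi> z - g z\<bar> < e"
    using Stone_Weierstrass_real_polynomial_function[OF compact_sphere _ e] by metis
  show ?thesis
  proof (rule that[of "\<lambda>x. g (cis x)"])
    show "trig_poly UNIV (\<lambda>x. of_real (g (cis x)))" using g(1) by (rule trig_poly_real_polynomial_cis)
    show "\<bar>G x - g (cis x)\<bar> < e" if "x \<in> {0..2 * pi}" for x
      using g(2)[of "cis x"] \<psi>[OF that] by (simp add: dist_norm)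
  qed
qed

text \<open>Measurability yields continuous functions converging to \<phi> almost everywhere. They
  are truncated to [-R, R], forced to vanish at the ends of the period, and then approximated
  uniformly within 1 / (i + 1), whence the bound R + 1.\<close>

lemma trig_poly_bounded_AE_approx:
  fixes \<phi> :: "real \<Rightarrow> real"
  assumes \<phi>: "\<phi> \<in> borel_measurable circ" "\<And>x. \<bar>\<phi> x\<bar> \<le> R"
  obtains T :: "nat \<Rightarrow> real \<Rightarrow> real" where
    "\<And>i. trig_poly UNIV (\<lambda>x. of_real (T i x))" "\<And>i x. x \<in> {0..2 * pi} \<Longrightarrow> \<bar>T i x\<bar> \<le> R + 1"
    "AE x in circ. (\<lambda>i. T i x) \<longlonglongrightarrow> \<phi> x"
proof -
  have R: "R \<ge> 0" using \<phi>(2)[of 0] by linarith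
  have "\<phi> measurable_on {0..2 * pi}" using \<phi>(1) by (simp add: measurable_on_iff_borel_measurable)
  then obtain N g where N: "negligible N" and g: "\<And>n. cont (g n)"
    "\<And>x. x \<notin> N \<Longrightarrow> (\<lambda>n. g n x) \<longlonglongrightarrow> (if x \<in> {0..2 * pi} then \<phi> x else 0)"
    unfolding measurable_on_def by blast
  \<comment> \<open>A cutoff that vanishes at both ends, so that \<open>G i\<close> has equal end
    values, and that is eventually 1 at each interior point.\<close>
  define \<kappa> where "\<kappa> i x = max 0 (min 1 (real i * (x * (2 * pi - x))))" for i x
  define G where "G i x = \<kappa> i x * max (- R) (min R (g i x))" for i x
  have "\<exists>T :: real \<Rightarrow> real. trig_poly UNIV (\<lambda>x. of_real (T x)) \<and> (\<forall>x\<in>{0..2 * pi}. \<bar>G i x - T x\<bar> < 1 / real (Suc i))" for i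
  proof -
    have "continuous_on {0..2 * pi} (G i)"
      unfolding G_def \<kappa>_def by (intro continuous_intros continuous_on_subset[OF g(1)]) auto
    then show ?thesis
      by (rule trig_poly_uniform_approx[of "G i" "1 / real (Suc i)"]) (auto simp: G_def \<kappa>_def)
  qed
  then obtain T :: "nat \<Rightarrow> real \<Rightarrow> real" where T: "\<And>i. trig_poly UNIV (\<lambda>x. of_real (T i x))"
    "\<And>i x. x \<in> {0..2 * pi} \<Longrightarrow> \<bar>G i x - T i x\<bar> < 1 / real (Suc i)" by metis
  have bound: "\<bar>T i x\<bar> \<le> R + 1" if "x \<in> {0..2 * pi}" for i x
  proof -
    have "\<bar>G i x\<bar> \<le> 1 * R" unfolding G_def abs_mult using R by (intro mult_mono) (auto simp: \<kappa>_def)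
    moreover have "1 / real (Suc i) \<le> 1" by simp
    ultimately show ?thesis using T(2)[OF that, of i] by linarith
  qed
  have conv: "(\<lambda>i. T i x) \<longlonglongrightarrow> \<phi> x" if x: "x \<in> {0..2 * pi}" "x \<notin> N \<union> {0, 2 * pi}" for x
  proof -
    define c where "c = x * (2 * pi - x)"
    have c: "c > 0" unfolding c_def using x by (intro mult_pos_pos) auto
    have "\<kappa> i x = 1" if "i \<ge> nat \<lceil>1 / c\<rceil>" for i
    proof -
      have "1 / c \<le> real i" using that by linarith
      then have "1 \<le> real i * c" using c by (simp add: divide_le_eq)
      then show ?thesis by (simp add: \<kappa>_def c_def[symmetric])
    qed
    then have "(\<lambda>i. \<kappa> i x) \<longlonglongrightarrow> 1"
      by (intro tendsto_eventually eventually_sequentiallyI)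
    moreover have "(\<lambda>i. max (- R) (min R (g i x))) \<longlonglongrightarrow> max (- R) (min R (\<phi> x))"
      using g(2)[of x] x by (intro tendsto_intros) auto
    moreover have "max (- R) (min R (\<phi> x)) = \<phi> x" using \<phi>(2)[of x] by linarith
    ultimately have "(\<lambda>i. G i x) \<longlonglongrightarrow> \<phi> x" unfolding G_def using tendsto_mult[of _ 1 _ _ "\<phi> x"] by simp
    moreover have "(\<lambda>i. G i x - T i x) \<longlonglongrightarrow> 0"
    proof (rule Lim_null_comparison)
      show "\<forall>\<^sub>F i in sequentially. norm (G i x - T i x) \<le> 1 / real (Suc i)"
        using T(2)[OF x(1)] by (auto intro!: always_eventually less_imp_le)
      show "(\<lambda>i. 1 / real (Suc i)) \<longlonglongrightarrow> 0" by (rule LIMSEQ_Suc) (rule lim_1_over_n)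
    qed
    ultimately have "(\<lambda>i. G i x - (G i x - T i x)) \<longlonglongrightarrow> \<phi> x - 0" by (rule tendsto_diff)
    then show ?thesis by simp
  qed
  show ?thesis
  proof (rule that[OF T(1) bound])
    show "AE x in circ. (\<lambda>i. T i x) \<longlonglongrightarrow> \<phi> x"
      by (rule AE_circ[of "N \<union> {0, 2 * pi}", OF _ conv]) (use N in auto)
  qed
qed

section \<open>Norm bounds from Fejer means\<close>

text \<open>The cases b \<le> 2a and b > 2a. The coefficient 1/2 is what allows the absorption in
  \<open>nn_integral_le_of_fejer_means\<close>.\<close>

lemma young_power:
  fixes a b :: real
  assumes "0 \<le> a" "0 \<le> b" shows "a * b ^ p \<le> 2 ^ p * a ^ Suc p + b ^ Suc p / 2"
proof (cases "b \<le> 2 * a")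
  case True
  then have "a * b ^ p \<le> a * (2 * a) ^ p" using assms by (intro mult_left_mono power_mono) auto
  also have "\<dots> = 2 ^ p * a ^ Suc p" by (simp add: power_mult_distrib)
  finally show ?thesis using assms by (simp add: add_increasing2)
next
  case False
  then have "a * b ^ p \<le> (b / 2) * b ^ p" using assms by (intro mult_right_mono) auto
  then show ?thesis using assms by (simp add: add_increasing)
qed

lemma fejer_weight_tendsto: "filterlim M at_top F \<Longrightarrow> ((\<lambda>i. fejer_weight (M i) k) \<longlongrightarrow> 1) F"
proof -
  assume M: "filterlim M at_top F"
  have "((\<lambda>i. max 0 (1 - \<bar>real_of_int k\<bar> / real (M i))) \<longlongrightarrow> max 0 (1 - 0)) F"
    by (intro tendsto_intros tendsto_divide_0[OF tendsto_const] filterlim_at_top_imp_at_infinity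
        filterlim_compose[OF filterlim_real_sequentially M])
  then show ?thesis by (simp add: fejer_weight_def)
qed

lemma avg_fejer_sum_mult_trig_poly:
  assumes t: "trig_poly {- int N..int N} t"
    and H: "\<And>x. H x = (\<Sum>k = - int M..int M. of_real (fejer_weight M k) * \<gamma> k * character k x)" and M: "M > 0"
  shows "avg (\<lambda>x. H x * t x) = (\<Sum>k = - int N..int N. fc t k * (of_real (fejer_weight M (- k)) * \<gamma> (- k)))"
proof -
  have H': "H = (\<lambda>x. \<Sum>k = - int M..int M. of_real (fejer_weight M k) * \<gamma> k * character k x)" using H by auto
  have Hc: "cont H" unfolding H' by (intro continuous_intros)
  have fcH: "fc H k = of_real (fejer_weight M k) * \<gamma> k" for k
    unfolding H' by (subst fc_sum) (auto simp: fejer_weight_eq_0 M)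
  have "avg (\<lambda>x. H x * t x) = avg (\<lambda>x. \<Sum>k = - int N..int N. fc t k * (H x * character (- (- k)) x))"
    by (subst trig_poly_expand[OF t]) (simp_all add: sum_distrib_left mult_ac)
  also have "\<dots> = (\<Sum>k = - int N..int N. fc t k * fc H (- k))"
    unfolding fc_def[of H] avg_cmult[symmetric] by (intro avg_sum continuous_intros Hc)
  finally show ?thesis unfolding fcH .
qed

text \<open>Duality: \<open>h\<close>, truncated to \<open>{x. \<bar>h x\<bar> \<le> R}\<close>, is approximated by trigonometric polynomials
  \<open>T i\<close>, and \<open>h\<close> is tested against \<open>T i ^ p\<close>.\<close>

lemma nn_integral_le_of_fejer_means:
  fixes h :: "real \<Rightarrow> real"
  assumes h: "integrable circ h" and p: "odd p"
    and \<gamma>: "\<And>k. \<gamma> k = 1 / (2 * pi) * integral\<^sup>L circ (\<lambda>x. of_real (h x) * character (- k) x)"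
    and M: "filterlim M at_top sequentially"
    and bd: "\<And>i. M i > 0 \<Longrightarrow>
      avg (\<lambda>x. norm (\<Sum>k = - int (M i)..int (M i). of_real (fejer_weight (M i) k) * \<gamma> k * character k x) ^ Suc p) \<le> B"
  shows "(\<integral>\<^sup>+x. ennreal (\<bar>h x\<bar> ^ Suc p) \<partial>circ) \<le> ennreal (2 * pi * 2 ^ Suc p * B)"
proof -
  have [measurable]: "h \<in> borel_measurable circ" using h by simp
  define H where "H i x = (\<Sum>k = - int (M i)..int (M i). of_real (fejer_weight (M i) k) * \<gamma> k * character k x)" for i x
  have Hc: "cont (H i)" for i unfolding H_def by (intro continuous_intros)
  \<comment> \<open>The pairing is the limit of pairings with the Fejer sums \<open>H i\<close>, as
    the weights tend to 1 on the finitely many frequencies of the test function. For each i, Young's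
    inequality and the assumed moment bound apply, leaving half a moment of T.\<close>
  have test: "\<bar>integral\<^sup>L circ (\<lambda>x. h x * T x ^ p)\<bar> \<le> 2 * pi * 2 ^ p * B + (1 / 2) * integral\<^sup>L circ (\<lambda>x. T x ^ Suc p)"
    if T: "trig_poly UNIV (\<lambda>x. of_real (T x))" for T :: "real \<Rightarrow> real"
  proof -
    define t where "t x = complex_of_real (T x) ^ p" for x
    have "cont (\<lambda>x. Re (of_real (T x)))" by (intro continuous_intros trig_poly_cont[OF T])
    then have Tc: "cont T" by simp
    have tc: "cont t" unfolding t_def by (intro continuous_intros Tc)
    have "trig_poly UNIV t" unfolding t_def using T by (rule trig_poly_power)
    then obtain N where N: "trig_poly {- int N..int N} t" using trig_poly_finite by blast
    have hch: "integrable circ (\<lambda>x. of_real (h x) * character k x)" for k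
    proof (rule Bochner_Integration.integrable_bound[OF h])
      show "(\<lambda>x. of_real (h x) * character k x) \<in> borel_measurable circ"
        using cont_borel_circ[OF cont_character, of k] by (auto intro!: borel_measurable_times)
    qed (auto simp: norm_mult)
    have "integral\<^sup>L circ (\<lambda>x. of_real (h x) * t x)
        = integral\<^sup>L circ (\<lambda>x. \<Sum>k = - int N..int N. fc t k * (of_real (h x) * character (- (- k)) x))"
      by (subst trig_poly_expand[OF N]) (simp_all add: sum_distrib_left mult_ac)
    also have "\<dots> = (\<Sum>k = - int N..int N. fc t k * (2 * pi * \<gamma> (- k)))"
      using hch by (subst Bochner_Integration.integral_sum) (auto simp: \<gamma> intro!: sum.cong)
    finally have ht: "integral\<^sup>L circ (\<lambda>x. of_real (h x) * t x) = 2 * pi * (\<Sum>k = - int N..int N. fc t k * \<gamma> (- k))"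
      by (simp add: sum_distrib_left mult_ac)
    have ev: "\<forall>\<^sub>F i in sequentially. M i > 0"
      using eventually_compose_filterlim[OF eventually_gt_at_top M] .
    have "((\<lambda>i. \<Sum>k = - int N..int N. fc t k * (of_real (fejer_weight (M i) (- k)) * \<gamma> (- k)))
        \<longlonglongrightarrow> (\<Sum>k = - int N..int N. fc t k * (of_real 1 * \<gamma> (- k))))"
      by (intro tendsto_intros fejer_weight_tendsto M)
    moreover have "\<forall>\<^sub>F i in sequentially. (\<Sum>k = - int N..int N. fc t k * (of_real (fejer_weight (M i) (- k)) * \<gamma> (- k)))
        = avg (\<lambda>x. H i x * t x)"
      using ev by eventually_elim (subst avg_fejer_sum_mult_trig_poly[OF N], auto simp: H_def)
    ultimately have lim: "(\<lambda>i. avg (\<lambda>x. H i x * t x)) \<longlonglongrightarrow> (\<Sum>k = - int N..int N. fc t k * \<gamma> (- k))"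
      using Lim_transform_eventually by fastforce
    have "norm (\<Sum>k = - int N..int N. fc t k * \<gamma> (- k)) \<le> 2 ^ p * B + (1 / 2) * avg (\<lambda>x. T x ^ Suc p)"
    proof (rule tendsto_upperbound[OF tendsto_norm[OF lim]])
      show "\<forall>\<^sub>F i in sequentially. norm (avg (\<lambda>x. H i x * t x)) \<le> 2 ^ p * B + (1 / 2) * avg (\<lambda>x. T x ^ Suc p)"
        using ev
      proof eventually_elim
        case (elim i)
        have "norm (avg (\<lambda>x. H i x * t x)) \<le> avg (\<lambda>x. norm (H i x * t x))"
          by (intro norm_avg_le continuous_intros Hc tc)
        also have "\<dots> \<le> avg (\<lambda>x. 2 ^ p * norm (H i x) ^ Suc p + (1 / 2) * T x ^ Suc p)"
        proof (intro avg_mono continuous_intros Hc Tc tc)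
          fix x
          have "\<bar>T x\<bar> ^ Suc p = T x ^ Suc p" using p by (intro power_even_abs) simp
          then show "norm (H i x * t x) \<le> 2 ^ p * norm (H i x) ^ Suc p + (1 / 2) * T x ^ Suc p"
            using young_power[of "norm (H i x)" "\<bar>T x\<bar>" p]
            by (simp add: t_def norm_mult norm_power del: power_Suc)
        qed
        also have "\<dots> = 2 ^ p * avg (\<lambda>x. norm (H i x) ^ Suc p) + (1 / 2) * avg (\<lambda>x. T x ^ Suc p)"
          unfolding avg_cmult_real[symmetric] by (intro avg_add continuous_intros Hc Tc)
        also have "\<dots> \<le> 2 ^ p * B + (1 / 2) * avg (\<lambda>x. T x ^ Suc p)"
          using bd[OF elim] by (simp add: H_def)
        finally show ?case .
      qed
    qed simp
    then have "2 * pi * norm (\<Sum>k = - int N..int N. fc t k * \<gamma> (- k))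
        \<le> 2 * pi * (2 ^ p * B + (1 / 2) * avg (\<lambda>x. T x ^ Suc p))" by (intro mult_left_mono) auto
    also have "\<dots> = 2 * pi * 2 ^ p * B + (1 / 2) * integral\<^sup>L circ (\<lambda>x. T x ^ Suc p)"
      by (subst integral_circ_eq_avg) (auto intro!: continuous_intros Tc simp: algebra_simps)
    finally have "norm (integral\<^sup>L circ (\<lambda>x. of_real (h x) * t x)) \<le> \<dots>"
      unfolding ht by (simp add: norm_mult)
    moreover have "integral\<^sup>L circ (\<lambda>x. of_real (h x) * t x) = of_real (integral\<^sup>L circ (\<lambda>x. h x * T x ^ p))"
      by (simp add: t_def flip: of_real_mult of_real_power integral_complex_of_real)
    ultimately show ?thesis by simp
  qed
  \<comment> \<open>Integrability of the power of h is not yet known; truncation makes the moment X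
    finite, so that half of it can be subtracted.\<close>
  have trunc: "(\<integral>\<^sup>+x. ennreal (if \<bar>h x\<bar> \<le> R then \<bar>h x\<bar> ^ Suc p else 0) \<partial>circ) \<le> ennreal (2 * pi * 2 ^ Suc p * B)"
    if R: "R \<ge> 0" for R
  proof -
    define \<phi> where "\<phi> x = (if \<bar>h x\<bar> \<le> R then h x else 0)" for x
    have \<phi>m[measurable]: "\<phi> \<in> borel_measurable circ" unfolding \<phi>_def by measurable
    obtain T :: "nat \<Rightarrow> real \<Rightarrow> real" where T: "\<And>i. trig_poly UNIV (\<lambda>x. of_real (T i x))"
      "\<And>i x. x \<in> {0..2 * pi} \<Longrightarrow> \<bar>T i x\<bar> \<le> R + 1" "AE x in circ. (\<lambda>i. T i x) \<longlonglongrightarrow> \<phi> x"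
      by (rule trig_poly_bounded_AE_approx[OF \<phi>m, of R]) (auto simp: \<phi>_def R)
    have Tc: "cont (T i)" for i
    proof -
      have "cont (\<lambda>x. Re (of_real (T i x)))" by (intro continuous_intros trig_poly_cont[OF T(1)])
      then show ?thesis by simp
    qed
    have [measurable]: "T i \<in> borel_measurable circ" for i using Tc by (rule cont_borel_circ)
    define X where "X = integral\<^sup>L circ (\<lambda>x. \<phi> x ^ Suc p)"
    have bdd: "\<bar>\<phi> x ^ Suc p\<bar> \<le> R ^ Suc p" for x
      using R unfolding power_abs by (intro power_mono) (auto simp: \<phi>_def)
    have "(\<lambda>i. integral\<^sup>L circ (\<lambda>x. h x * T i x ^ p)) \<longlonglongrightarrow> integral\<^sup>L circ (\<lambda>x. h x * \<phi> x ^ p)"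
    proof (rule integral_dominated_convergence)
      show "integrable circ (\<lambda>x. \<bar>h x\<bar> * (R + 1) ^ p)" using h by auto
      show "AE x in circ. (\<lambda>i. h x * T i x ^ p) \<longlonglongrightarrow> h x * \<phi> x ^ p"
        using T(3) by eventually_elim (intro tendsto_intros)
      show "AE x in circ. norm (h x * T i x ^ p) \<le> \<bar>h x\<bar> * (R + 1) ^ p" for i
        using T(2) by (intro AE_I2) (auto simp: abs_mult power_abs intro!: mult_left_mono power_mono)
    qed measurable
    \<comment> \<open>Where \<phi> differs from h it is 0, and both sides vanish there since p >
      0.\<close>
    moreover have "(\<lambda>x. h x * \<phi> x ^ p) = (\<lambda>x. \<phi> x ^ Suc p)" using p by (auto simp: \<phi>_def fun_eq_iff odd_pos)
    ultimately have 1: "(\<lambda>i. \<bar>integral\<^sup>L circ (\<lambda>x. h x * T i x ^ p)\<bar>) \<longlonglongrightarrow> \<bar>X\<bar>"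
      unfolding X_def by (simp add: tendsto_rabs)
    have "(\<lambda>i. integral\<^sup>L circ (\<lambda>x. T i x ^ Suc p)) \<longlonglongrightarrow> X"
      unfolding X_def
    proof (rule integral_dominated_convergence)
      show "integrable circ (\<lambda>x. (R + 1) ^ Suc p)"
        by (intro finite_measure.integrable_const finite_measure_circ)
      show "AE x in circ. (\<lambda>i. T i x ^ Suc p) \<longlonglongrightarrow> \<phi> x ^ Suc p"
        using T(3) by eventually_elim (intro tendsto_intros)
      show "AE x in circ. norm (T i x ^ Suc p) \<le> (R + 1) ^ Suc p" for i
        using T(2) by (intro AE_I2) (auto simp: power_abs simp del: power_Suc intro!: power_mono)
    qed measurable
    then have 2: "(\<lambda>i. 2 * pi * 2 ^ p * B + (1 / 2) * integral\<^sup>L circ (\<lambda>x. T i x ^ Suc p))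
        \<longlonglongrightarrow> 2 * pi * 2 ^ p * B + (1 / 2) * X" by (intro tendsto_intros)
    \<comment> \<open>In the limit the leftover half moment of T is half of X itself, and the
      inequality can be solved for X.\<close>
    have "\<bar>X\<bar> \<le> 2 * pi * 2 ^ p * B + (1 / 2) * X"
      using test[OF T(1)] by (intro LIMSEQ_le[OF 1 2]) blast
    then have X: "X \<le> 2 * pi * 2 ^ Suc p * B" by simp
    have "(\<integral>\<^sup>+x. ennreal (if \<bar>h x\<bar> \<le> R then \<bar>h x\<bar> ^ Suc p else 0) \<partial>circ) = (\<integral>\<^sup>+x. ennreal (\<phi> x ^ Suc p) \<partial>circ)"
    proof (intro nn_integral_cong arg_cong[of _ _ ennreal])
      fix x
      have "\<bar>h x\<bar> ^ Suc p = h x ^ Suc p" using p by (intro power_even_abs) simp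
      then show "(if \<bar>h x\<bar> \<le> R then \<bar>h x\<bar> ^ Suc p else 0) = \<phi> x ^ Suc p" by (simp add: \<phi>_def)
    qed
    also have "\<dots> = ennreal X"
      unfolding X_def
    proof (rule nn_integral_eq_integral)
      show "integrable circ (\<lambda>x. \<phi> x ^ Suc p)"
        using bdd by (intro finite_measure.integrable_const_bound[OF finite_measure_circ, of _ "R ^ Suc p"]) auto
      show "AE x in circ. 0 \<le> \<phi> x ^ Suc p"
        using p by (intro AE_I2 zero_le_even_power) simp
    qed
    also have "\<dots> \<le> ennreal (2 * pi * 2 ^ Suc p * B)" using X by (rule ennreal_leI)
    finally show ?thesis .
  qed
  have "(\<integral>\<^sup>+x. ennreal (\<bar>h x\<bar> ^ Suc p) \<partial>circ)
      = (\<integral>\<^sup>+x. (SUP R. ennreal (if \<bar>h x\<bar> \<le> real R then \<bar>h x\<bar> ^ Suc p else 0)) \<partial>circ)"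
  proof (intro nn_integral_cong antisym)
    fix x
    obtain R :: nat where "\<bar>h x\<bar> \<le> real R" using real_arch_simple by blast
    then show "ennreal (\<bar>h x\<bar> ^ Suc p) \<le> (SUP R. ennreal (if \<bar>h x\<bar> \<le> real R then \<bar>h x\<bar> ^ Suc p else 0))"
      by (intro SUP_upper2[of R]) auto
    show "(SUP R. ennreal (if \<bar>h x\<bar> \<le> real R then \<bar>h x\<bar> ^ Suc p else 0)) \<le> ennreal (\<bar>h x\<bar> ^ Suc p)"
      by (intro SUP_least) (auto intro!: ennreal_leI)
  qed
  also have "\<dots> = (SUP R. \<integral>\<^sup>+x. ennreal (if \<bar>h x\<bar> \<le> real R then \<bar>h x\<bar> ^ Suc p else 0) \<partial>circ)"
    by (intro nn_integral_monotone_convergence_SUP) (auto intro!: incseq_SucI le_funI ennreal_leI)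
  also have "\<dots> \<le> ennreal (2 * pi * 2 ^ Suc p * B)"
    by (intro SUP_least trunc) simp
  finally show ?thesis .
qed

section \<open>Fourier coefficients of periodic functions\<close>

text \<open>Reconciles the period [-pi, pi] of \<open>fourier_coeff\<close> with the period
  [0, 2 pi] used elsewhere, by moving [-pi, 0] to [pi, 2 pi].\<close>

lemma periodic_integral_shift:
  fixes q :: "real \<Rightarrow> 'a::euclidean_space"
  assumes per: "\<And>x. q (x + 2 * pi) = q x" and q: "q integrable_on {0..2 * pi}"
  shows "q integrable_on {- pi..pi}" "integral {- pi..pi} q = integral {0..2 * pi} q"
proof -
  have sub: "q integrable_on {0..pi}" "q integrable_on {pi..2 * pi}"
    using q by (auto intro: integrable_subinterval_real)
  have "q \<circ> (+) (2 * pi) = q" using per by (auto simp: fun_eq_iff add.commute)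
  then have shift: "(q has_integral I) {- pi..0} \<longleftrightarrow> (q has_integral I) {pi..2 * pi}" for I
    using has_integral_shift_Icc_real[of q "2 * pi" I "- pi" 0] by simp
  then have neg: "q integrable_on {- pi..0}" "integral {- pi..0} q = integral {pi..2 * pi} q"
    using sub(2) by (auto simp: integrable_on_def integral_unique)
  show i: "q integrable_on {- pi..pi}"
    using neg(1) sub(1) by (intro Henstock_Kurzweil_Integration.integrable_combine[of "- pi" 0 pi]) auto
  show "integral {- pi..pi} q = integral {0..2 * pi} q"
    using Henstock_Kurzweil_Integration.integral_combine[OF _ _ i, of 0]
      Henstock_Kurzweil_Integration.integral_combine[OF _ _ q, of pi] neg(2)
    by (simp add: add.commute)
qed

lemma integrable_mult_character:
  assumes "integrable circ f" shows "integrable circ (\<lambda>x. f x * character k x)"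
proof (rule Bochner_Integration.integrable_bound[OF assms])
  show "(\<lambda>x. f x * character k x) \<in> borel_measurable circ"
    using assms cont_borel_circ[OF cont_character, of k] by (intro borel_measurable_times) auto
qed (simp add: norm_mult)

lemma character_periodic: "character k (x + 2 * pi) = character k x"
proof -
  have "character k (x + 2 * pi) = character k x * cis (2 * pi * of_int k)"
    by (simp add: character_def cis_mult algebra_simps)
  then show ?thesis by simp
qed

lemma L1_per_integrable_circ:
  assumes "f \<in> L1_per" shows "integrable circ f"
proof -
  have "f absolutely_integrable_on {0..<2 * pi}" using assms by (simp add: L1_per_def)
  moreover have "negligible {x \<in> {0..<2 * pi} - {0..2 * pi}. f x \<noteq> 0}"
    by (rule negligible_subset[OF negligible_empty]) auto
  moreover have "negligible {x \<in> {0..2 * pi} - {0..<2 * pi}. f x \<noteq> 0}"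
    by (rule negligible_subset[OF negligible_sing[of "2 * pi"]]) auto
  ultimately have "f absolutely_integrable_on {0..2 * pi}"
    using absolutely_integrable_spike_set_eq by blast
  then show ?thesis by (simp add: set_integrable_def integrable_restrict_space)
qed

lemma L1_perI:
  assumes "\<And>x. f (x + 2 * pi) = f x" "cont f" shows "f \<in> L1_per"
proof -
  have "f absolutely_integrable_on {0..2 * pi}"
    using cont_integrable_circ[OF assms(2)] by (simp add: set_integrable_def integrable_restrict_space)
  then have "f absolutely_integrable_on {0..<2 * pi}" by (rule set_integrable_subset) auto
  then show ?thesis using assms(1) by (simp add: L1_per_def)
qed

lemma fourier_coeff_eq_circ:
  assumes f: "f \<in> L1_per"
  shows "fourier_coeff f k = 1 / (2 * pi) * integral\<^sup>L circ (\<lambda>x. f x * character (- k) x)"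
proof -
  define q where "q x = f x * character (- k) x" for x
  have per: "q (x + 2 * pi) = q x" for x using f by (simp add: q_def L1_per_def character_periodic)
  have i: "integrable circ q" unfolding q_def by (intro integrable_mult_character L1_per_integrable_circ f)
  then have ab: "q absolutely_integrable_on {0..2 * pi}"
    by (simp add: set_integrable_def integrable_restrict_space)
  have "q absolutely_integrable_on {- pi..pi}"
    using periodic_integral_shift(1)[of q] periodic_integral_shift(1)[of "\<lambda>x. norm (q x)"] per ab
    by (auto simp: absolutely_integrable_on_def)
  then have "(LINT x:{- pi..pi}|lebesgue. q x) = integral {- pi..pi} q"
    by (rule set_lebesgue_integral_eq_integral)
  also have "\<dots> = integral {0..2 * pi} q"
    using per ab by (intro periodic_integral_shift(2)) (auto simp: absolutely_integrable_on_def)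
  also have "\<dots> = integral\<^sup>L circ q" using i by (simp add: lebesgue_integral_eq_integral)
  finally have main: "(LINT x:{- pi..pi}|lebesgue. q x) = integral\<^sup>L circ q" .
  have "exp (- \<i> * of_int k * of_real x) = character (- k) x" for x
    by (simp add: character_def cis_conv_exp mult.assoc)
  then show ?thesis
    unfolding fourier_coeff_def using main by (simp only: q_def[abs_def])
qed

lemma fourier_coeff_eq_fc:
  assumes "u \<in> L1_per" "cont u" shows "fourier_coeff u k = fc u k"
proof -
  have "integral\<^sup>L circ (\<lambda>x. u x * character (- k) x) = (2 * pi) *\<^sub>R fc u k"
    unfolding fc_def by (intro integral_circ_eq_avg continuous_intros cont_character assms)
  then show ?thesis by (simp add: fourier_coeff_eq_circ[OF assms(1)] scaleR_conv_of_real)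
qed

lemma fourier_sum_eq: "fourier_sum m f x = (\<Sum>k = - int m..int m. fourier_coeff f k * character k x)"
  by (simp add: fourier_sum_def character_def cis_conv_exp mult.assoc)

lemma cnj_fourier_coeff:
  assumes f: "f \<in> L1_per" and re: "\<And>x. f x \<in> \<real>"
  shows "cnj (fourier_coeff f k) = fourier_coeff f (- k)"
proof -
  have "cnj (f x) = f x" for x using re by (simp add: Reals_cnj_iff)
  then have "(\<lambda>x. f x * character k x) = (\<lambda>x. cnj (f x * character (- k) x))" by (simp add: cnj_character)
  then have "integral\<^sup>L circ (\<lambda>x. f x * character k x) = cnj (integral\<^sup>L circ (\<lambda>x. f x * character (- k) x))"
    by (simp only: Bochner_Integration.integral_cnj)
  then show ?thesis by (simp add: fourier_coeff_eq_circ[OF f])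
qed

lemma sum_symmetric:
  fixes F :: "int \<Rightarrow> 'a::comm_monoid_add"
  shows "(\<Sum>k = - int m..int m. F k) = F 0 + (\<Sum>k=1..m. F (int k) + F (- int k))"
proof (induction m)
  case (Suc m)
  have neg: "- int m - 1 = - 1 - int m" by simp
  show ?case unfolding sum_symmetric_Suc Suc neg by (simp add: add_ac)
qed simp

lemma sum_symmetric_Re:
  assumes "F 0 \<in> \<real>" "\<And>k. F (- k) = cnj (F k)"
  shows "(\<Sum>k = - int m..int m. F k) = of_real (Re (F 0) + (\<Sum>k=1..m. 2 * Re (F (int k))))"
  using assms by (simp add: sum_symmetric complex_add_cnj)

lemma fourier_sum_in_trig_polys:
  assumes f: "f \<in> L1_per" "\<And>x. f x \<in> \<real>"
  shows "fourier_sum m f \<in> trig_polys m"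
proof -
  define c where "c = fourier_coeff f"
  have cc: "c (- k) = cnj (c k)" for k using cnj_fourier_coeff[OF f] by (simp add: c_def)
  then have c0: "c 0 \<in> \<real>" using cc[of 0] by (simp add: Reals_cnj_iff)
  \<comment> \<open>The constant term is not doubled, hence the case distinction in the cosine
    coefficients; the trivial condition 0 = 0 keeps the shape of the witness for
    \<open>a 0\<close>.\<close>
  have "fourier_sum m f x = of_real ((if 0 = (0::nat) then Re (c 0) else 0)
      + (\<Sum>k=1..m. (if k = 0 then Re (c 0) else 2 * Re (c (int k))) * cos (real k * x)
          + (- 2 * Im (c (int k))) * sin (real k * x)))" for x
  proof -
    have "fourier_sum m f x = of_real (Re (c 0 * character 0 x) + (\<Sum>k=1..m. 2 * Re (c (int k) * character (int k) x)))"
      unfolding fourier_sum_eq c_def[symmetric] using c0 cc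
      by (subst sum_symmetric_Re) (auto simp: cnj_character)
    also have "(\<Sum>k=1..m. 2 * Re (c (int k) * character (int k) x))
        = (\<Sum>k=1..m. (if k = 0 then Re (c 0) else 2 * Re (c (int k))) * cos (real k * x)
          + (- 2 * Im (c (int k))) * sin (real k * x))"
      by (intro sum.cong refl) (auto simp: character_def algebra_simps)
    finally show ?thesis by simp
  qed
  then show ?thesis
    unfolding trig_polys_def
    by (intro CollectI exI[of _ "\<lambda>k. if k = 0 then Re (c 0) else 2 * Re (c (int k))"]
        exI[of _ "\<lambda>k. - 2 * Im (c (int k))"]) auto
qed

text \<open>A Fejer mean is a convolution with a nonnegative kernel of mean 1, so it inherits the
  bound on g. This provides the continuous bounded functions to which the multiplier estimate is
  applied.\<close>

lemma norm_fejer_mean_le_1: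
  assumes g: "integrable circ g" and g1: "AE x in circ. norm (g x) \<le> 1" and M: "M > 0"
    and \<gamma>: "\<And>k. \<gamma> k = 1 / (2 * pi) * integral\<^sup>L circ (\<lambda>x. g x * character (- k) x)"
  shows "norm (\<Sum>k = - int M..int M. of_real (fejer_weight M k) * \<gamma> k * character k x) \<le> 1"
proof -
  let ?w = "\<lambda>y. fejer_kernel M (x - y)"
  have wc: "cont ?w" by (intro cont_fejer_kernel continuous_intros)
  have "integral\<^sup>L circ (\<lambda>y. of_real (?w y) * g y)
      = integral\<^sup>L circ (\<lambda>y. \<Sum>k = - int M..int M. (of_real (fejer_weight M k) * character k x) * (g y * character (- k) y))"
    unfolding fejer_kernel_eq[OF M] character_diff_arg by (simp add: sum_distrib_right sum_distrib_left mult_ac)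
  also have "\<dots> = (\<Sum>k = - int M..int M. (of_real (fejer_weight M k) * character k x) * (2 * pi * \<gamma> k))"
    using integrable_mult_character[OF g]
    by (subst Bochner_Integration.integral_sum) (auto simp: \<gamma> intro!: sum.cong)
  finally have eq: "integral\<^sup>L circ (\<lambda>y. of_real (?w y) * g y)
      = 2 * pi * (\<Sum>k = - int M..int M. of_real (fejer_weight M k) * \<gamma> k * character k x)"
    by (simp add: sum_distrib_left mult_ac)
  have iw: "integrable circ ?w" by (rule cont_integrable_circ[OF wc])
  have ae: "AE y in circ. norm (of_real (?w y) * g y) \<le> ?w y"
    using g1 by eventually_elim (simp add: norm_mult fejer_kernel_nonneg mult_left_le)
  have ig: "integrable circ (\<lambda>y. of_real (?w y) * g y)"
  proof (rule Bochner_Integration.integrable_bound[OF iw])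
    show "(\<lambda>y. of_real (?w y) * g y) \<in> borel_measurable circ"
      using g cont_borel_circ[OF wc] by (intro borel_measurable_times) auto
    show "AE y in circ. norm (of_real (?w y) * g y) \<le> norm (?w y)"
      using ae by eventually_elim (simp add: fejer_kernel_nonneg)
  qed
  have "norm (integral\<^sup>L circ (\<lambda>y. of_real (?w y) * g y)) \<le> integral\<^sup>L circ (\<lambda>y. norm (of_real (?w y) * g y))"
    by (rule integral_norm_bound)
  also have "\<dots> \<le> integral\<^sup>L circ ?w"
    using ae ig iw by (intro integral_mono_AE integrable_norm)
  also have "\<dots> = 2 * pi" using integral_circ_eq_avg[OF wc] avg_fejer_kernel[OF M] by simp
  finally show ?thesis unfolding eq by (simp add: norm_mult)
qed

section \<open>The extended norms\<close>

lemma Linf_norm_le_AE: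
  assumes "Linf_norm g \<le> 1" shows "AE x in circ. norm (g x) \<le> 1"
proof -
  have "AE x in lebesgue. ennreal (norm (g x)) \<le> Linf_norm g"
    unfolding Linf_norm_def by (rule esssup_AE)
  then have "AE x in lebesgue. x \<in> {0..2 * pi} \<longrightarrow> norm (g x) \<le> 1"
    by eventually_elim (use assms in \<open>auto dest: order_trans simp: ennreal_le_1\<close>)
  then show ?thesis by (subst AE_restrict_space_iff) auto
qed

lemma nn_integral_period_eq_circ:
  "(\<integral>\<^sup>+ t\<in>{0..<2 * pi}. F t \<partial>lebesgue) = (\<integral>\<^sup>+ t. F t \<partial>circ)"
proof -
  have "{2 * pi} \<in> null_sets lebesgue" using negligible_sing negligible_iff_null_sets by blast
  then have "AE t in lebesgue. t \<notin> {2 * pi}" by (rule AE_not_in)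
  then have "AE t in lebesgue. F t * indicator {0..<2 * pi} t = F t * indicator {0..2 * pi} t"
    by eventually_elim (auto simp: indicator_def)
  then have "(\<integral>\<^sup>+ t\<in>{0..<2 * pi}. F t \<partial>lebesgue) = (\<integral>\<^sup>+ t\<in>{0..2 * pi}. F t \<partial>lebesgue)"
    by (rule nn_integral_cong_AE)
  then show ?thesis by (simp add: nn_integral_restrict_space)
qed

lemma Lp_norm_le:
  assumes "(\<integral>\<^sup>+ t. ennreal (norm (f t) powr p) \<partial>circ) \<le> ennreal J" "0 \<le> J" "0 < p"
  shows "Lp_norm p f \<le> ennreal (J powr (1 / p))"
proof -
  define I where "I = (\<integral>\<^sup>+ t. ennreal (norm (f t) powr p) \<partial>circ)"
  have "I < \<infinity>" using assms(1) ennreal_less_top[of J] unfolding I_def infinity_ennreal_def by (rule le_less_trans)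
  moreover have "enn2real I powr (1 / p) \<le> J powr (1 / p)"
    using assms enn2real_leI[of J I] by (intro powr_mono2) (auto simp: I_def)
  ultimately show ?thesis
    by (auto simp: Lp_norm_def nn_integral_period_eq_circ I_def[symmetric] intro!: ennreal_leI)
qed

lemma Lp_norm_ge:
  assumes "ennreal J \<le> (\<integral>\<^sup>+ t. ennreal (norm (f t) powr p) \<partial>circ)" "0 \<le> J" "0 < p"
  shows "ennreal (J powr (1 / p)) \<le> Lp_norm p f"
proof (cases "(\<integral>\<^sup>+ t. ennreal (norm (f t) powr p) \<partial>circ) = \<infinity>")
  case False
  define I where "I = (\<integral>\<^sup>+ t. ennreal (norm (f t) powr p) \<partial>circ)"
  have "ennreal J \<le> ennreal (enn2real I)" using assms False by (simp add: I_def less_top)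
  then have "J powr (1 / p) \<le> enn2real I powr (1 / p)"
    using assms by (intro powr_mono2) (auto simp: ennreal_le_iff)
  then show ?thesis
    using False by (auto simp: Lp_norm_def nn_integral_period_eq_circ I_def intro!: ennreal_leI)
qed (simp add: Lp_norm_def nn_integral_period_eq_circ)

section \<open>The upper bound\<close>

lemma class_P_bounds:
  assumes "\<psi> \<in> class_P"
  obtains \<kappa> where "\<kappa> > 0" "\<And>n k. n \<ge> 1 \<Longrightarrow> k \<ge> 1 \<Longrightarrow> \<bar>psi_trunc \<psi> n k\<bar> \<le> \<kappa> * \<psi> n"
    "\<And>n j. n \<ge> 1 \<Longrightarrow> (\<Sum>k=2^j..<2^(j+1) - 1. \<bar>psi_trunc \<psi> n (k + 1) - psi_trunc \<psi> n k\<bar>) \<le> \<kappa> * \<psi> n"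
proof -
  have pos: "\<psi> k > 0" if "k \<ge> 1" for k using assms that by (simp add: class_P_def)
  obtain M where M: "M > 0" "\<And>k1 k2. 1 \<le> k1 \<Longrightarrow> k1 \<le> k2 \<Longrightarrow> \<psi> k2 \<le> M * \<psi> k1"
    using assms unfolding class_P_def almost_decreasing_def by blast
  obtain K where K: "\<And>n. n \<ge> 1 \<Longrightarrow>
      (SUP m\<in>{1..}. ereal (\<Sum>k = 2 ^ m..2 ^ (m + 1). \<bar>psi_trunc \<psi> n (k + 1) - psi_trunc \<psi> n k\<bar>)) \<le> ereal (K * \<psi> n)"
    using assms unfolding class_P_def by blast
  show ?thesis
  proof (rule that[of "M + \<bar>K\<bar>"])
    show "M + \<bar>K\<bar> > 0" using M(1) by linarith
  next
    fix n k :: nat assume n: "n \<ge> 1" and k: "k \<ge> 1"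
    have "\<bar>psi_trunc \<psi> n k\<bar> \<le> M * \<psi> n"
      using M(2)[OF n, of k] pos[OF k] pos[OF n] M(1) by (auto simp: psi_trunc_def)
    also have "\<dots> \<le> (M + \<bar>K\<bar>) * \<psi> n" using pos[OF n] by (intro mult_right_mono) auto
    finally show "\<bar>psi_trunc \<psi> n k\<bar> \<le> (M + \<bar>K\<bar>) * \<psi> n" .
  next
    fix n j :: nat assume n: "n \<ge> 1"
    let ?v = "\<lambda>k. \<bar>psi_trunc \<psi> n (k + 1) - psi_trunc \<psi> n k\<bar>"
    show "(\<Sum>k=2^j..<2^(j+1) - 1. ?v k) \<le> (M + \<bar>K\<bar>) * \<psi> n"
    proof (cases "j = 0")
      \<comment> \<open>The range 1..<1 is empty. This matters because the supremum in
        \<open>class_P\<close> starts at m = 1 and says nothing about this block.\<close>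
      case True
      then show ?thesis using pos[OF n] M(1) by simp
    next
      case False
      have "(\<Sum>k=2^j..<2^(j+1) - 1. ?v k) \<le> (\<Sum>k=2^j..2^(j+1). ?v k)"
        by (intro sum_mono2) auto
      also have "ereal \<dots> \<le> ereal (K * \<psi> n)"
        by (rule order_trans[OF SUP_upper K[OF n]]) (use False in auto)
      then have "(\<Sum>k=2^j..2^(j+1). ?v k) \<le> K * \<psi> n" by simp
      also have "\<dots> \<le> (M + \<bar>K\<bar>) * \<psi> n" using pos[OF n] M(1) by (intro mult_right_mono) auto
      finally show ?thesis .
    qed
  qed
qed

lemma fourier_coeff_remainder:
  assumes f: "f \<in> L1_per"
  shows "1 / (2 * pi) * integral\<^sup>L circ (\<lambda>x. (f x - fourier_sum m f x) * character (- k) x)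
    = (if \<bar>k\<bar> \<le> int m then 0 else fourier_coeff f k)"
proof -
  have sc: "cont (fourier_sum m f)" unfolding fourier_sum_eq[abs_def] by (intro continuous_intros)
  have "integral\<^sup>L circ (\<lambda>x. fourier_sum m f x * character (- k) x) = (2 * pi) *\<^sub>R fc (fourier_sum m f) k"
    unfolding fc_def by (intro integral_circ_eq_avg continuous_intros sc)
  moreover have "integral\<^sup>L circ (\<lambda>x. (f x - fourier_sum m f x) * character (- k) x)
      = integral\<^sup>L circ (\<lambda>x. f x * character (- k) x) - integral\<^sup>L circ (\<lambda>x. fourier_sum m f x * character (- k) x)"
    unfolding left_diff_distrib
    by (intro Bochner_Integration.integral_diff integrable_mult_character L1_per_integrable_circ f cont_integrable_circ sc)
  moreover have "fc (fourier_sum m f) k = (if \<bar>k\<bar> \<le> int m then fourier_coeff f k else 0)"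
    unfolding fourier_sum_eq[abs_def] by (subst fc_sum) auto
  ultimately show ?thesis
    by (simp add: fourier_coeff_eq_circ[OF f] scaleR_conv_of_real right_diff_distrib)
qed

text \<open>For k > 0 the sign is constant, so the rotation does not depend on k and f arises from
  its derivative by the multiplier \<psi> up to a constant of modulus 1.\<close>

lemma psi_class_coeff:
  assumes g: "has_psi_beta_deriv \<psi> \<beta> f g" and k: "k \<ge> 1" and pos: "\<psi> k > 0"
  shows "fourier_coeff f (int k) = of_real (\<psi> k) * exp (- \<i> * of_real (\<beta> * pi / 2)) * fourier_coeff g (int k)"
proof -
  define E where "E = exp (\<i> * complex_of_real (\<beta> * pi / 2))"
  have "exp (- \<i> * complex_of_real (\<beta> * pi / 2)) * E = 1"
    unfolding E_def exp_add[symmetric] by simp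
  moreover have "fourier_coeff g (int k) = fourier_coeff f (int k) / of_real (\<psi> k) * E"
    using g k by (simp add: has_psi_beta_deriv_def E_def)
  ultimately show ?thesis using pos by (simp add: mult_ac)
qed

text \<open>Since f is real, the mean is twice the real part of its positive frequency half; the
  unimodular rotation then disappears under the norm. The Fejer weights are carried by G, a Fejer
  mean of the derivative, so that \<open>psi_trunc \<psi> n\<close> is the only multiplier
  left.\<close>

lemma psi_class_fejer_mean_le:
  assumes f: "f \<in> L1_per" "\<And>x. f x \<in> \<real>" and g: "has_psi_beta_deriv \<psi> \<beta> f g"
    and pos: "\<And>k. k \<ge> 1 \<Longrightarrow> \<psi> k > 0" and n: "n \<ge> 1" and M: "M > 0"
    and \<gamma>: "\<And>k. \<gamma> k = (if \<bar>k\<bar> \<le> int (n - 1) then 0 else fourier_coeff f k)"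
    and G: "\<And>x. G x = (\<Sum>k = - int M..int M. of_real (fejer_weight M k) * fourier_coeff g k * character k x)"
  shows "norm (\<Sum>k = - int M..int M. of_real (fejer_weight M k) * \<gamma> k * character k x)
    \<le> 2 * norm (\<Sum>k=1..<M. of_real (psi_trunc \<psi> n k) * fc G (int k) * character (int k) x)"
proof -
  define \<omega> where "\<omega> = exp (- \<i> * complex_of_real (\<beta> * pi / 2))"
  have \<omega>: "norm \<omega> = 1" by (simp add: \<omega>_def norm_exp_eq_Re)
  have G': "G = (\<lambda>x. \<Sum>k = - int M..int M. of_real (fejer_weight M k) * fourier_coeff g k * character k x)" using G by auto
  have fcG: "fc G k = of_real (fejer_weight M k) * fourier_coeff g k" for k
    unfolding G' by (subst fc_sum) (auto simp: fejer_weight_eq_0 M)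
  define F where "F k = of_real (fejer_weight M k) * \<gamma> k * character k x" for k
  have F0: "F 0 = 0" by (simp add: F_def \<gamma>)
  have "F (- k) = cnj (F k)" for k
    using cnj_fourier_coeff[OF f] by (simp add: F_def \<gamma> fejer_weight_def cnj_character)
  then have "(\<Sum>k = - int M..int M. F k) = of_real (\<Sum>k=1..M. 2 * Re (F (int k)))"
    by (subst sum_symmetric_Re) (auto simp: F0)
  also have "(\<Sum>k=1..M. 2 * Re (F (int k))) = 2 * Re (\<Sum>k=1..M. F (int k))"
    by (simp add: sum_distrib_left)
  \<comment> \<open>The Fejer weight vanishes at k = M, which gives the half-open range of the
    multiplier estimate.\<close>
  also have "(\<Sum>k=1..M. F (int k)) = (\<Sum>k=1..<M. F (int k))"
    using M by (subst sum.last_plus) (auto simp: F_def fejer_weight_eq_0)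
  also have "\<dots> = (\<Sum>k=1..<M. \<omega> * (of_real (psi_trunc \<psi> n k) * fc G (int k) * character (int k) x))"
  proof (intro sum.cong refl)
    fix k assume k: "k \<in> {1..<M}"
    have "\<gamma> (int k) = \<omega> * of_real (psi_trunc \<psi> n k) * fourier_coeff g (int k)"
      using psi_class_coeff[OF g, of k] pos[of k] k n by (auto simp: \<gamma> psi_trunc_def \<omega>_def)
    then show "F (int k) = \<omega> * (of_real (psi_trunc \<psi> n k) * fc G (int k) * character (int k) x)"
      by (simp add: F_def fcG mult_ac)
  qed
  also have "\<dots> = \<omega> * (\<Sum>k=1..<M. of_real (psi_trunc \<psi> n k) * fc G (int k) * character (int k) x)"
    by (simp add: sum_distrib_left)
  finally have eq: "(\<Sum>k = - int M..int M. F k)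
      = of_real (2 * Re (\<omega> * (\<Sum>k=1..<M. of_real (psi_trunc \<psi> n k) * fc G (int k) * character (int k) x)))" .
  have "norm (complex_of_real (2 * Re z)) \<le> 2 * norm z" for z
    using abs_Re_le_cmod[of z] by (simp add: abs_mult)
  then have "norm (\<Sum>k = - int M..int M. F k)
      \<le> 2 * norm (\<omega> * (\<Sum>k=1..<M. of_real (psi_trunc \<psi> n k) * fc G (int k) * character (int k) x))"
    unfolding eq .
  then show ?thesis by (simp add: F_def norm_mult \<omega>)
qed

text \<open>In the constant, 2^S with S = 2 * 2^r occurs twice: once from duality and once from
  joining the two halves of the spectrum.\<close>

lemma psi_class_remainder_power:
  assumes \<psi>: "\<psi> \<in> class_P"
  shows "\<exists>\<kappa> C. \<kappa> > 0 \<and> C \<ge> 0 \<and> (\<forall>n\<ge>1. \<forall>f\<in>psi_class \<psi> \<beta>.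
    (\<integral>\<^sup>+x. ennreal (norm (f x - fourier_sum (n - 1) f x) ^ (2 * 2 ^ r)) \<partial>circ) \<le> ennreal (C * (\<kappa> * \<psi> n) ^ (2 * 2 ^ r)))"
proof -
  obtain \<kappa> where \<kappa>: "\<kappa> > 0" "\<And>n k. n \<ge> 1 \<Longrightarrow> k \<ge> 1 \<Longrightarrow> \<bar>psi_trunc \<psi> n k\<bar> \<le> \<kappa> * \<psi> n"
    "\<And>n j. n \<ge> 1 \<Longrightarrow> (\<Sum>k=2^j..<2^(j+1) - 1. \<bar>psi_trunc \<psi> n (k + 1) - psi_trunc \<psi> n k\<bar>) \<le> \<kappa> * \<psi> n"
    using class_P_bounds[OF \<psi>] by blast
  have pos: "\<psi> k > 0" if "k \<ge> 1" for k using \<psi> that by (simp add: class_P_def)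
  define S where "S = 2 * (2::nat) ^ r"
  \<comment> \<open>Duality tests against an odd power, and S = p + 1 is even.\<close>
  obtain p where p: "S = Suc p" "odd p"
    using even_Suc[of "S - 1"] by (metis S_def Suc_pred' dvd_triv_left nat_0_less_mult_iff zero_less_numeral zero_less_power)
  obtain C where C: "C \<ge> 0" and mult: "\<And>\<mu> A g m. cont g \<Longrightarrow> (\<And>x. norm (g x) \<le> 1) \<Longrightarrow>
     (\<forall>k\<ge>1. \<bar>\<mu> k\<bar> \<le> A) \<Longrightarrow>
     (\<forall>j. (\<Sum>k=2^j..<2^(j+1) - 1. \<bar>\<mu> (k + 1) - \<mu> k\<bar>) \<le> A) \<Longrightarrow>
     avg (\<lambda>x. norm (\<Sum>k=1..<2^(m * (r + 2)). of_real (\<mu> k) * fc g (int k) * character (int k) x) ^ S) \<le> C * A ^ S"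
    unfolding S_def using dyadic_variation_multiplier[of r] by blast
  have "(\<integral>\<^sup>+x. ennreal (norm (f x - fourier_sum (n - 1) f x) ^ S) \<partial>circ)
      \<le> ennreal ((2 * pi * 2 ^ S * 2 ^ S * C) * (\<kappa> * \<psi> n) ^ S)"
    if n: "n \<ge> 1" and fc: "f \<in> psi_class \<psi> \<beta>" for n f
  proof -
    obtain g where f: "f \<in> L1_per" "\<And>x. f x \<in> \<real>" and g: "has_psi_beta_deriv \<psi> \<beta> f g" "Linf_norm g \<le> 1"
      using fc unfolding psi_class_def by blast
    have gL: "g \<in> L1_per" using g(1) by (simp add: has_psi_beta_deriv_def)
    define h where "h x = Re (f x - fourier_sum (n - 1) f x)" for x
    have "fourier_sum (n - 1) f x \<in> \<real>" for x
      using fourier_sum_in_trig_polys[OF f, of "n - 1"] by (auto simp: trig_polys_def)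
    then have h: "complex_of_real (h x) = f x - fourier_sum (n - 1) f x" for x
      unfolding h_def using f(2) by (intro of_real_Re Reals_diff)
    define \<gamma> where "\<gamma> k = (if \<bar>k\<bar> \<le> int (n - 1) then 0 else fourier_coeff f k)" for k
    \<comment> \<open>Orders for which \<open>dyadic_variation_multiplier\<close> is stated, with m
      = i.\<close>
    define M where "M i = (2::nat) ^ (i * (r + 2))" for i
    have "(\<integral>\<^sup>+x. ennreal (\<bar>h x\<bar> ^ Suc p) \<partial>circ) \<le> ennreal (2 * pi * 2 ^ Suc p * (2 ^ S * (C * (\<kappa> * \<psi> n) ^ S)))"
    proof (rule nn_integral_le_of_fejer_means[where \<gamma> = \<gamma> and M = M])
      have "cont (fourier_sum (n - 1) f)" unfolding fourier_sum_eq[abs_def] by (intro continuous_intros)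
      then have "integrable circ (\<lambda>x. f x - fourier_sum (n - 1) f x)"
        by (intro Bochner_Integration.integrable_diff L1_per_integrable_circ f cont_integrable_circ)
      then show "integrable circ h" unfolding h_def by (rule integrable_Re)
      show "\<gamma> k = 1 / (2 * pi) * integral\<^sup>L circ (\<lambda>x. of_real (h x) * character (- k) x)" for k
        unfolding h \<gamma>_def by (rule fourier_coeff_remainder[OF f(1), symmetric])
      have "strict_mono M" unfolding M_def by (intro strict_monoI power_strict_increasing mult_strict_right_mono) auto
      then show "filterlim M at_top sequentially" by (rule filterlim_subseq)
      fix i assume Mi: "M i > 0"
      define G where "G x = (\<Sum>k = - int (M i)..int (M i). of_real (fejer_weight (M i) k) * fourier_coeff g k * character k x)" for x
      have Gc: "cont G" unfolding G_def by (intro continuous_intros)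
      have G1: "norm (G x) \<le> 1" for x
        unfolding G_def
        by (rule norm_fejer_mean_le_1[OF L1_per_integrable_circ[OF gL] Linf_norm_le_AE[OF g(2)] Mi fourier_coeff_eq_circ[OF gL]])
      have "avg (\<lambda>x. norm (\<Sum>k = - int (M i)..int (M i). of_real (fejer_weight (M i) k) * \<gamma> k * character k x) ^ S)
          \<le> avg (\<lambda>x. 2 ^ S * norm (\<Sum>k=1..<M i. of_real (psi_trunc \<psi> n k) * fc G (int k) * character (int k) x) ^ S)"
      proof (intro avg_mono continuous_intros)
        fix x
        show "norm (\<Sum>k = - int (M i)..int (M i). of_real (fejer_weight (M i) k) * \<gamma> k * character k x) ^ S
            \<le> 2 ^ S * norm (\<Sum>k=1..<M i. of_real (psi_trunc \<psi> n k) * fc G (int k) * character (int k) x) ^ S"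
          unfolding power_mult_distrib[symmetric]
          by (intro power_mono psi_class_fejer_mean_le[OF f g(1) pos n Mi \<gamma>_def G_def]) auto
      qed
      also have "\<dots> \<le> 2 ^ S * (C * (\<kappa> * \<psi> n) ^ S)"
        unfolding avg_cmult_real M_def using \<kappa>(2,3)[OF n] by (intro mult_left_mono mult Gc G1) auto
      finally show "avg (\<lambda>x. norm (\<Sum>k = - int (M i)..int (M i). of_real (fejer_weight (M i) k) * \<gamma> k * character k x) ^ Suc p)
          \<le> 2 ^ S * (C * (\<kappa> * \<psi> n) ^ S)" by (simp only: p(1))
    qed (rule p(2))
    moreover have "norm (f x - fourier_sum (n - 1) f x) = \<bar>h x\<bar>" for x unfolding h[symmetric] by simp
    ultimately show ?thesis by (simp only: p(1)[symmetric] mult.assoc)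
  qed
  then show ?thesis
    unfolding S_def[symmetric] using \<kappa>(1) C
    by (intro exI[of _ \<kappa>] exI[of _ "2 * pi * 2 ^ S * 2 ^ S * C"]) auto
qed

lemma fourier_approx_err_upper:
  assumes \<psi>: "\<psi> \<in> class_P" and s: "1 \<le> s"
  shows "\<exists>K>0. \<forall>n\<ge>1. fourier_approx_err n (psi_class \<psi> \<beta>) s \<le> ennreal (K * \<psi> n)"
proof -
  define r where "r = nat \<lceil>s\<rceil>"
  define S where "S = 2 * (2::nat) ^ r"
  have "s \<le> real r" using s by (simp add: r_def)
  also have "real r \<le> real S" using less_exp[of r] unfolding S_def by (intro of_nat_mono) linarith
  finally have sS: "s \<le> real S" .
  obtain \<kappa> C where \<kappa>: "\<kappa> > 0" and C: "C \<ge> 0" and bd: "\<And>n f. n \<ge> 1 \<Longrightarrow> f \<in> psi_class \<psi> \<beta> \<Longrightarrow>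
     (\<integral>\<^sup>+x. ennreal (norm (f x - fourier_sum (n - 1) f x) ^ S) \<partial>circ) \<le> ennreal (C * (\<kappa> * \<psi> n) ^ S)"
    unfolding S_def using psi_class_remainder_power[OF \<psi>, of \<beta> r] by blast
  \<comment> \<open>The summand 2 * pi is the measure of a period; it also keeps D positive when C =
    0.\<close>
  define D where "D = 2 * pi + C"
  have D: "D > 0" using C by (simp add: D_def add_pos_nonneg)
  have "fourier_approx_err n (psi_class \<psi> \<beta>) s \<le> ennreal (\<kappa> * D powr (1 / s) * \<psi> n)" if n: "n \<ge> 1" for n
    unfolding fourier_approx_err_def
  proof (rule SUP_least)
    fix f assume f: "f \<in> psi_class \<psi> \<beta>"
    define A where "A = \<kappa> * \<psi> n"
    have A: "A > 0" using \<kappa> n \<psi> by (simp add: A_def class_P_def)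
    define h where "h x = norm (f x - fourier_sum (n - 1) f x)" for x
    have "f \<in> L1_per" using f by (simp add: psi_class_def)
    then have fm: "f \<in> borel_measurable circ"
      using L1_per_integrable_circ by (intro borel_measurable_integrable)
    have fsc: "cont (fourier_sum (n - 1) f)" unfolding fourier_sum_eq[abs_def] by (intro continuous_intros)
    have [measurable]: "h \<in> borel_measurable circ"
      unfolding h_def
      by (rule measurable_compose[OF borel_measurable_diff[OF fm cont_borel_circ[OF fsc]] borel_measurable_norm])
    \<comment> \<open>A substitute for Hoelder's inequality: h is compared with its expected size A,
      a multiple of \<open>\<psi> n\<close>. After integration both terms are multiples of A powr s,
      so the final bound is linear in \<open>\<psi> n\<close>.\<close>
    have pw: "h x powr s \<le> A powr s + A powr s / A ^ S * h x ^ S" for x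
    proof (cases "h x \<le> A")
      case True
      then have "h x powr s \<le> A powr s" using s by (intro powr_mono2) (auto simp: h_def)
      then show ?thesis using A by (simp add: add_increasing2 h_def)
    next
      case False
      then have "1 \<le> h x / A" using A by simp
      then have "(h x / A) powr s \<le> (h x / A) powr real S" using sS by (intro powr_mono)
      also have "\<dots> = h x ^ S / A ^ S" using False A by (simp add: powr_realpow power_divide)
      finally have "A powr s * (h x / A) powr s \<le> A powr s * (h x ^ S / A ^ S)" by (intro mult_left_mono) auto
      moreover have "A powr s * (h x / A) powr s = h x powr s" using A False by (simp flip: powr_mult)
      ultimately have "h x powr s \<le> A powr s / A ^ S * h x ^ S" by simp
      then show ?thesis by (simp add: add_increasing)
    qed
    have "(\<integral>\<^sup>+x. ennreal (h x powr s) \<partial>circ)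
        \<le> (\<integral>\<^sup>+x. ennreal (A powr s) + ennreal (A powr s / A ^ S) * ennreal (h x ^ S) \<partial>circ)"
      using pw A by (intro nn_integral_mono) (simp add: h_def flip: ennreal_mult ennreal_plus)
    also have "\<dots> = ennreal (A powr s) * emeasure circ (space circ) + ennreal (A powr s / A ^ S) * (\<integral>\<^sup>+x. ennreal (h x ^ S) \<partial>circ)"
      by (simp add: nn_integral_add nn_integral_cmult)
    also have "emeasure circ (space circ) = ennreal (2 * pi)"
      by (simp add: emeasure_restrict_space)
    also have "ennreal (A powr s) * ennreal (2 * pi) + ennreal (A powr s / A ^ S) * (\<integral>\<^sup>+x. ennreal (h x ^ S) \<partial>circ)
        \<le> ennreal (A powr s) * ennreal (2 * pi) + ennreal (A powr s / A ^ S) * ennreal (C * A ^ S)"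
      using bd[OF n f] unfolding h_def A_def[symmetric] by (intro add_left_mono mult_left_mono) auto
    also have "ennreal (A powr s) * ennreal (2 * pi) + ennreal (A powr s / A ^ S) * ennreal (C * A ^ S)
        = ennreal (A powr s * D)"
      using A C by (simp add: D_def field_simps flip: ennreal_mult ennreal_plus)
    finally have "(\<integral>\<^sup>+x. ennreal (h x powr s) \<partial>circ) \<le> ennreal (A powr s * D)" .
    then have "Lp_norm s (\<lambda>x. f x - fourier_sum (n - 1) f x) \<le> ennreal ((A powr s * D) powr (1 / s))"
      unfolding h_def using D s by (intro Lp_norm_le) auto
    also have "(A powr s * D) powr (1 / s) = \<kappa> * D powr (1 / s) * \<psi> n"
    proof -
      have "(A powr s * D) powr (1 / s) = A * D powr (1 / s)" using A D s by (simp add: powr_mult powr_powr)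
      then show ?thesis by (simp add: A_def)
    qed
    finally show "Lp_norm s (\<lambda>x. f x - fourier_sum (n - 1) f x) \<le> \<dots>" .
  qed
  moreover have "\<kappa> * D powr (1 / s) > 0" using \<kappa> D by simp
  ultimately show ?thesis by blast
qed

section \<open>The lower bound\<close>

lemma trig_poly_if_trig_polys:
  assumes "t \<in> trig_polys m" shows "trig_poly {- int m..int m} t"
proof -
  obtain a b where t: "t = (\<lambda>x. of_real (a 0 + (\<Sum>k = 1..m. a k * cos (real k * x) + b k * sin (real k * x))))"
    using assms unfolding trig_polys_def by auto
  show ?thesis
    unfolding t of_real_add of_real_sum of_real_mult character_cos character_sin
    by (intro trig_poly_add trig_poly_sum trig_poly_cmult trig_poly_character trig_poly_const) auto
qed

text \<open>The tangent at \<tau> lies below the convex power. Averaged over y = norm (u x), it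
  turns a lower bound \<tau> for the mean into a lower bound for the mean of the s-th power.\<close>

lemma powr_tangent_le:
  fixes s y \<tau> :: real
  assumes "0 \<le> y" "0 < \<tau>" "1 \<le> s"
  shows "s * \<tau> powr (s - 1) * y - (s - 1) * \<tau> powr s \<le> y powr s"
proof -
  define z where "z = y / \<tau>"
  have z: "0 \<le> z" using assms by (simp add: z_def)
  have "z \<le> 1 / s * z powr s + (1 - 1 / s)"
  proof (cases "z = 0")
    case False
    then have "(z powr s) powr (1 / s) * 1 powr (1 - 1 / s) \<le> 1 / s * z powr s + (1 - 1 / s) * 1"
      using assms z by (intro Youngs_inequality_0) auto
    then show ?thesis using assms z by (simp add: powr_powr)
  qed (use assms in simp)
  then have "s * z \<le> s * (1 / s * z powr s + (1 - 1 / s))" using assms by (intro mult_left_mono) auto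
  then have "s * z - (s - 1) \<le> z powr s" using assms by (simp add: algebra_simps)
  then have "\<tau> powr s * (s * z - (s - 1)) \<le> \<tau> powr s * z powr s" by (intro mult_left_mono) auto
  moreover have "\<tau> powr s * z powr s = y powr s" using assms by (simp add: z_def flip: powr_mult)
  moreover have "\<tau> powr s = \<tau> powr (s - 1) * \<tau>" using assms by (simp add: powr_diff)
  ultimately show ?thesis using assms by (simp add: z_def algebra_simps)
qed

text \<open>The test function has derivative cos (n x + \<beta> pi / 2). Subtracting a polynomial of
  degree below n does not affect its coefficient \<psi>(n) / 2 at frequency n, which therefore
  bounds the mean of the modulus of the difference from below; this is the origin of 1/2.\<close>

lemma best_approx_err_lower:
  assumes pos: "\<psi> n > 0" and n: "n \<ge> 1" and s: "1 \<le> s"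
  shows "ennreal (1 / 2 * \<psi> n) \<le> best_approx_err n (psi_class \<psi> \<beta>) s"
proof -
  define \<theta> where "\<theta> = \<beta> * pi / 2"
  define f g where "f x = complex_of_real (\<psi> n * cos (real n * x))"
    and "g x = complex_of_real (cos (real n * x + \<theta>))" for x
  define c where "c k = 1 / 2 * exp (\<i> * of_real (\<theta> * of_int (sgn k)))" for k :: int
  have fe: "f = (\<lambda>x. \<Sum>k\<in>{int n, - int n}. of_real (\<psi> n / 2) * character k x)"
    using n by (auto simp: f_def character_def complex_eq_iff fun_eq_iff)
  have ge: "g = (\<lambda>x. \<Sum>k\<in>{int n, - int n}. c k * character k x)"
    using n by (auto simp: g_def c_def character_def complex_eq_iff fun_eq_iff Re_exp Im_exp cos_add sin_add) (simp add: field_simps)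
  have fc: "cont f" and gc: "cont g" unfolding fe ge by (intro continuous_intros)+
  have fL: "f \<in> L1_per" and gL: "g \<in> L1_per"
    using fc gc by (auto intro!: L1_perI simp: fe ge character_periodic)
  have fcf: "fc f k = (if k \<in> {int n, - int n} then of_real (\<psi> n / 2) else 0)" for k
    unfolding fe by (subst fc_sum) auto
  have fcg: "fc g k = (if k \<in> {int n, - int n} then c k else 0)" for k
    unfolding ge by (subst fc_sum) auto
  have "has_psi_beta_deriv \<psi> \<beta> f g"
    unfolding has_psi_beta_deriv_def fourier_coeff_eq_fc[OF fL fc] fourier_coeff_eq_fc[OF gL gc] fcf fcg
    using gL n pos by (auto simp: c_def \<theta>_def)
  moreover have "Linf_norm g \<le> 1"
    unfolding Linf_norm_def
  proof (rule esssup_I)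
    have "g \<in> borel_measurable borel" using gc by (rule borel_measurable_continuous_onI)
    then have "g \<in> borel_measurable lebesgue" by (intro measurable_completion) auto
    then show "(\<lambda>t. ennreal (norm (g t))) \<in> borel_measurable lebesgue" by measurable
    show "AE x in lebesgue. ennreal (norm (g x)) \<le> 1"
      by (intro AE_I2) (simp add: g_def)
  qed
  ultimately have f: "f \<in> psi_class \<psi> \<beta>" using fL by (auto simp: psi_class_def f_def)
  have "ennreal (1 / 2 * \<psi> n) \<le> Lp_norm s (\<lambda>x. f x - t x)" if t: "t \<in> trig_polys (n - 1)" for t
  proof -
    define u where "u x = f x - t x" for x
    define \<tau> where "\<tau> = \<psi> n / 2"
    have \<tau>: "\<tau> > 0" using pos by (simp add: \<tau>_def)
    have tt: "trig_poly {- int (n - 1)..int (n - 1)} t" using t by (rule trig_poly_if_trig_polys)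
    have uc: "cont u" unfolding u_def using fc trig_poly_cont[OF tt] by (intro continuous_intros)
    have "fc u (int n) = fc f (int n) - fc t (int n)"
      unfolding fc_def u_def left_diff_distrib by (intro avg_diff continuous_intros fc trig_poly_cont[OF tt])
    also have "fc t (int n) = 0" using n by (intro fc_trig_poly[OF tt]) auto
    finally have "fc u (int n) = of_real \<tau>" by (simp add: fcf \<tau>_def)
    then have "\<tau> = norm (avg (\<lambda>x. u x * character (- int n) x))" using \<tau> by (simp add: fc_def)
    also have "\<dots> \<le> avg (\<lambda>x. norm (u x * character (- int n) x))" by (intro norm_avg_le continuous_intros uc)
    finally have au: "\<tau> \<le> avg (\<lambda>x. norm (u x))" by (simp add: norm_mult)
    have pc: "cont (\<lambda>x. norm (u x) powr s)"
      using s by (intro continuous_on_powr' continuous_intros uc) auto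
    have "\<tau> powr s = s * \<tau> powr (s - 1) * \<tau> - (s - 1) * \<tau> powr s"
      using \<tau> by (simp add: powr_diff algebra_simps)
    also have "\<dots> \<le> s * \<tau> powr (s - 1) * avg (\<lambda>x. norm (u x)) - (s - 1) * \<tau> powr s"
      using au s by (intro diff_right_mono mult_left_mono) auto
    also have "\<dots> = avg (\<lambda>x. s * \<tau> powr (s - 1) * norm (u x) - (s - 1) * \<tau> powr s)"
      by (subst avg_diff) (auto intro!: continuous_intros uc simp: avg_cmult_real)
    also have "\<dots> \<le> avg (\<lambda>x. norm (u x) powr s)"
      using \<tau> s by (intro avg_mono continuous_intros uc pc powr_tangent_le) auto
    \<comment> \<open>\<open>avg\<close> is normalised but the norm is not; the factor 2 * pi \<ge>
      1 is simply given away.\<close>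
    also have "\<dots> \<le> 2 * pi * avg (\<lambda>x. norm (u x) powr s)"
    proof -
      have "0 \<le> avg (\<lambda>x. norm (u x) powr s)" by (intro avg_nonneg pc) auto
      then show ?thesis using pi_ge_two mult_right_mono[of 1 "2 * pi"] by simp
    qed
    also have "\<dots> = integral\<^sup>L circ (\<lambda>x. norm (u x) powr s)" by (simp add: integral_circ_eq_avg[OF pc])
    finally have "ennreal (\<tau> powr s) \<le> ennreal (integral\<^sup>L circ (\<lambda>x. norm (u x) powr s))" by (rule ennreal_leI)
    also have "\<dots> = (\<integral>\<^sup>+x. ennreal (norm (u x) powr s) \<partial>circ)"
      by (intro nn_integral_eq_integral[symmetric] cont_integrable_circ pc) auto
    finally have "ennreal ((\<tau> powr s) powr (1 / s)) \<le> Lp_norm s u" using s by (intro Lp_norm_ge) auto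
    then show ?thesis using \<tau> s by (simp add: powr_powr \<tau>_def u_def[abs_def])
  qed
  then show ?thesis
    unfolding best_approx_err_def by (intro SUP_upper2[OF f] INF_greatest)
qed

text \<open>The Fourier sum of a real function is one of the competitors. Hence a lower bound for
  the best approximation and an upper bound for the Fourier sums yield all four
  inequalities.\<close>

lemma best_approx_err_le_fourier:
  "best_approx_err n (psi_class \<psi> \<beta>) s \<le> fourier_approx_err n (psi_class \<psi> \<beta>) s"
  unfolding best_approx_err_def fourier_approx_err_def
proof (rule SUP_mono)
  fix f assume f: "f \<in> psi_class \<psi> \<beta>"
  then have "fourier_sum (n - 1) f \<in> trig_polys (n - 1)"
    by (intro fourier_sum_in_trig_polys) (auto simp: psi_class_def)
  then show "\<exists>f'\<in>psi_class \<psi> \<beta>. (INF t\<in>trig_polys (n - 1). Lp_norm s (\<lambda>x. f x - t x))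
      \<le> Lp_norm s (\<lambda>x. f' x - fourier_sum (n - 1) f' x)"
    using f by (intro bexI[of _ f] INF_lower) auto
qed

theorem theorem1:
  fixes \<psi> :: "nat \<Rightarrow> real" and s \<beta> :: real
  assumes "\<psi> \<in> class_P" and "1 \<le> s"
  shows "\<exists>K1 K2 :: real. K1 > 0 \<and> K2 > 0 \<and>
    (\<forall>n\<ge>1.
       ennreal (K1 * \<psi> n) \<le> best_approx_err n (psi_class \<psi> \<beta>) s \<and>
       best_approx_err n (psi_class \<psi> \<beta>) s \<le> ennreal (K2 * \<psi> n) \<and>
       ennreal (K1 * \<psi> n) \<le> fourier_approx_err n (psi_class \<psi> \<beta>) s \<and>
       fourier_approx_err n (psi_class \<psi> \<beta>) s \<le> ennreal (K2 * \<psi> n))"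
proof -
  obtain K where K: "K > 0" "\<And>n. n \<ge> 1 \<Longrightarrow> fourier_approx_err n (psi_class \<psi> \<beta>) s \<le> ennreal (K * \<psi> n)"
    using fourier_approx_err_upper[OF assms] by blast
  have lower: "ennreal (1 / 2 * \<psi> n) \<le> best_approx_err n (psi_class \<psi> \<beta>) s" if "n \<ge> 1" for n
    using assms that by (intro best_approx_err_lower) (auto simp: class_P_def)
  note le = best_approx_err_le_fourier[of _ \<psi> \<beta> s]
  show ?thesis
  proof (intro exI conjI allI impI)
    fix n :: nat assume n: "n \<ge> 1"
    show "ennreal (1 / 2 * \<psi> n) \<le> best_approx_err n (psi_class \<psi> \<beta>) s"
      "fourier_approx_err n (psi_class \<psi> \<beta>) s \<le> ennreal (K * \<psi> n)"
      using lower K(2) n by auto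
    then show "best_approx_err n (psi_class \<psi> \<beta>) s \<le> ennreal (K * \<psi> n)"
      "ennreal (1 / 2 * \<psi> n) \<le> fourier_approx_err n (psi_class \<psi> \<beta>) s"
      using le order_trans by blast+
  qed (use K(1) in auto)
qed

end
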